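(* Suppose there is a constant $\gamma\in[0,1/2)$ with $k_u\lesssim p^\gamma$, that $\sqrt n/\log p\ll k_u\lesssim n/\log p$, and that $D\lesssim p$. Let $$k_{\mathrm{eff}}=\left\lfloor\frac{n}{\log p}\wedge\frac{k_u^2}{D\log p}\right\rfloor,\qquad \nu_3=H(k_{\mathrm{eff}};\xi).$$ Then for any $1\le k\le k_u$, no degree-$D$ polynomial weakly separates $\Theta(k_u;\xi,t_0)$ and $\Theta_{\pm\tau}(k;\xi,t_0)$ when $$\tau=c\,\nu_3\,\frac{k_u\log p}{n},$$ where $c>0$ is a sufficiently small constant.
   Context: Model: one observes $n$ i.i.d. pairs $Z_i=(Y_i,X_{i\cdot})\in\mathbb R\times\mathbb R^p$, with $X_{i\cdot}\sim\mathcal N(0,\Sigma)$, $Y_i=X_{i\cdot}^\top\beta+\varepsilon_i$, $\varepsilon_i\sim\mathcal N(0,\sigma^2)$ independent of the $X$'s. Write $\theta=(\beta,\Sigma,\sigma)$, and $\mathbb P^n_\theta$ for the law of the data $\mathcal Z=(Z_1,\dots,Z_n)$. For fixed constants $M_1>1$, $M_2>0$, $$\Theta(k)=\{(\beta,\Sigma,\sigma):\|\beta\|_0\le k,\ 1/M_1\le\lambda_{\min}(\Sigma)\le\lambda_{\max}(\Sigma)\le M_1,\ 0<\sigma\le M_2\}.$$ For $t_0\in\mathbb R$: $\Theta(k;\xi,t_0)=\{\theta\in\Theta(k):\xi^\top\beta=t_0\}$ and $\Theta_{\pm\tau}(k;\xi,t_0)=\{\theta\in\Theta(k):|\xi^\top\beta-t_0|\ge\tau\}$.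 The loading vector $\xi\in\mathbb R^p$ is nonzero and ordered so that $|\xi_1|\ge\dots\ge|\xi_p|$. For $t>0$, $H(t;\xi)=\big(\sum_{j\le\lceil t\rceil\wedge p}\xi_j^2\big)^{1/2}$, and $H(0;\xi)=0$. Weak separation: $\mathbb R[\mathcal Z]_{\le D}$ is the space of polynomials of degree at most $D$ in the coordinates of $\mathcal Z$ ($D=D_n$ may grow; a "polynomial" is a sequence indexed by $n$). Such an $f$, with $\mathbb E_{\mathbb Q_1}f\ne\mathbb E_{\mathbb Q_2}f$, weakly separates (sequences of) distributions $\mathbb Q_1,\mathbb Q_2$ if, as $n\to\infty$, $$\sqrt{\max\{\mathrm{Var}_{\mathbb Q_1}(f(\mathcal Z)),\mathrm{Var}_{\mathbb Q_2}(f(\mathcal Z))\}}=O\big(|\mathbb E_{\mathbb Q_1}f(\mathcal Z)-\mathbb E_{\mathbb Q_2}f(\mathcal Z)|\big).$$ "No degree-$D$ polynomial weakly separates two parameter spaces $\Theta_1$ and $\Theta_2$" means: there exist priors $\pi_1,\pi_2$ supported on $\Theta_1,\Theta_2$ respectively such that no $f\in\mathbb R[\mathcal Z]_{\le D}$ weakly separates the mixtures $\mathbb P^n_{\pi_i}=\int\mathbb P^n_\theta\,\pi_i(d\theta)$, $i=1,2$. Asymptotics: $n,p,k_u\to\infty$ along a sequence; $M_1,M_2,\gamma$ are fixed; $k,\xi,t_0$ may vary along the sequence. $a\lesssim b$ means $a\le Cb$ for a constant $C>0$; $a\ll b$ means $a/b\to0$. *)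

theory Defs
  imports
    "HOL-Probability.Probability"
    "Jordan_Normal_Form.Spectral_Radius"
begin

text \<open>
  Since the sample size \<open>n\<close> and the dimension \<open>p\<close> vary along a sequence, vectors of length \<open>p\<close> are
  extensional functions on \<open>{..<p}\<close>, and square matrices are extensional functions on
  \<open>{..<p} \<times> {..<p}\<close>. Coordinates are counted from 0.
\<close>

type_synonym param = "(nat \<Rightarrow> real) \<times> (nat \<times> nat \<Rightarrow> real) \<times> real"
type_synonym data = "nat \<Rightarrow> real \<times> (nat \<Rightarrow> real)"

definition inner_on :: "nat \<Rightarrow> (nat \<Rightarrow> real) \<Rightarrow> (nat \<Rightarrow> real) \<Rightarrow> real" where
  "inner_on p u v = (\<Sum>j<p. u j * v j)"

definition param_algebra :: "nat \<Rightarrow> param measure" where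
  "param_algebra p =
     (\<Pi>\<^sub>M j\<in>{..<p}. borel) \<Otimes>\<^sub>M ((\<Pi>\<^sub>M ij\<in>{..<p} \<times> {..<p}. borel) \<Otimes>\<^sub>M borel)"

definition Theta :: "real \<Rightarrow> real \<Rightarrow> nat \<Rightarrow> nat \<Rightarrow> param set" where
  "Theta M1 M2 p k = {(\<beta>, S, \<sigma>).
     \<beta> \<in> {..<p} \<rightarrow>\<^sub>E UNIV \<and> S \<in> {..<p} \<times> {..<p} \<rightarrow>\<^sub>E UNIV \<and>
     card {j. j < p \<and> \<beta> j \<noteq> 0} \<le> k \<and>
     (\<forall>i<p. \<forall>j<p. S (i, j) = S (j, i)) \<and>
     1 / M1 \<le> Min (spectrum (Matrix.mat p p S)) \<and> Max (spectrum (Matrix.mat p p S)) \<le> M1 \<and>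
     0 < \<sigma> \<and> \<sigma> \<le> M2}"

definition Theta_null ::
  "real \<Rightarrow> real \<Rightarrow> nat \<Rightarrow> nat \<Rightarrow> (nat \<Rightarrow> real) \<Rightarrow> real \<Rightarrow> param set" where
  "Theta_null M1 M2 p k \<xi> t0 = {(\<beta>, S, \<sigma>) \<in> Theta M1 M2 p k. inner_on p \<xi> \<beta> = t0}"

definition Theta_alt ::
  "real \<Rightarrow> real \<Rightarrow> nat \<Rightarrow> nat \<Rightarrow> (nat \<Rightarrow> real) \<Rightarrow> real \<Rightarrow> real \<Rightarrow> param set" where
  "Theta_alt M1 M2 p k \<xi> t0 \<tau> =
     {(\<beta>, S, \<sigma>) \<in> Theta M1 M2 p k. \<tau> \<le> \<bar>inner_on p \<xi> \<beta> - t0\<bar>}"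

definition H :: "nat \<Rightarrow> (nat \<Rightarrow> real) \<Rightarrow> real \<Rightarrow> real" where
  "H p \<xi> t = sqrt (\<Sum>j<min (nat \<lceil>t\<rceil>) p. (\<xi> j)\<^sup>2)"

text \<open>
  The law \<open>N(0, S)\<close> is the law of \<open>A G\<close>, where \<open>G\<close> has i.i.d. standard normal entries and
  \<open>A\<close> is a square matrix with \<open>A A\<^sup>T = S\<close>. Such an \<open>A\<close> exists for every symmetric positive
  semidefinite \<open>S\<close>, and the law does not depend on which one is chosen.
\<close>

definition cov_root :: "nat \<Rightarrow> (nat \<times> nat \<Rightarrow> real) \<Rightarrow> (nat \<times> nat \<Rightarrow> real)" where
  "cov_root p S = (SOME A. \<forall>i<p. \<forall>j<p. (\<Sum>l<p. A (i, l) * A (j, l)) = S (i, j))"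

definition gaussian :: "nat \<Rightarrow> (nat \<times> nat \<Rightarrow> real) \<Rightarrow> (nat \<Rightarrow> real) measure" where
  "gaussian p S =
     distr (\<Pi>\<^sub>M j\<in>{..<p}. density lborel std_normal_density) (\<Pi>\<^sub>M j\<in>{..<p}. borel)
       (\<lambda>g. \<lambda>i\<in>{..<p}. \<Sum>l<p. cov_root p S (i, l) * g l)"

definition obs_law :: "nat \<Rightarrow> param \<Rightarrow> (real \<times> (nat \<Rightarrow> real)) measure" where
  "obs_law p = (\<lambda>(\<beta>, S, \<sigma>).
     distr (gaussian p S \<Otimes>\<^sub>M density lborel (normal_density 0 \<sigma>))
       (borel \<Otimes>\<^sub>M (\<Pi>\<^sub>M j\<in>{..<p}. borel))
       (\<lambda>(x, e). (inner_on p x \<beta> + e, x)))"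

definition data_law :: "nat \<Rightarrow> nat \<Rightarrow> param \<Rightarrow> data measure" where
  "data_law n p \<theta> = (\<Pi>\<^sub>M i\<in>{..<n}. obs_law p \<theta>)"

definition data_algebra :: "nat \<Rightarrow> nat \<Rightarrow> data measure" where
  "data_algebra n p = (\<Pi>\<^sub>M i\<in>{..<n}. borel \<Otimes>\<^sub>M (\<Pi>\<^sub>M j\<in>{..<p}. borel))"

definition prior_on :: "nat \<Rightarrow> param set \<Rightarrow> param measure \<Rightarrow> bool" where
  "prior_on p T \<pi> \<longleftrightarrow> prob_space \<pi> \<and> sets \<pi> = sets (param_algebra p) \<and> (AE \<theta> in \<pi>. \<theta> \<in> T)"

definition mixture :: "nat \<Rightarrow> nat \<Rightarrow> param measure \<Rightarrow> data measure" where
  "mixture n p \<pi> =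
     measure_of (space (data_algebra n p)) (sets (data_algebra n p))
       (\<lambda>A. \<integral>\<^sup>+ \<theta>. emeasure (data_law n p \<theta>) A \<partial>\<pi>)"

text \<open>
  \<open>(i, None)\<close> indexes the response \<open>Y\<^sub>i\<close>, and \<open>(i, Some j)\<close> the covariate \<open>X\<^sub>i\<^sub>j\<close>.
  A monomial is a multiset of such indices, whose size is its degree.
\<close>

fun coord :: "data \<Rightarrow> nat \<times> nat option \<Rightarrow> real" where
  "coord z (i, None) = fst (z i)"
| "coord z (i, Some j) = snd (z i) j"

definition coord_set :: "nat \<Rightarrow> nat \<Rightarrow> (nat \<times> nat option) set" where
  "coord_set n p = {..<n} \<times> insert None (Some ` {..<p})"

definition polynomials :: "nat \<Rightarrow> nat \<Rightarrow> nat \<Rightarrow> (data \<Rightarrow> real) set" where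
  "polynomials n p D = {f. \<exists>M c. finite M \<and>
     (\<forall>m\<in>M. set_mset m \<subseteq> coord_set n p \<and> size m \<le> D) \<and>
     f = (\<lambda>z. \<Sum>m\<in>M. c m * (\<Prod>v\<in>#m. coord z v))}"

definition weakly_separates ::
  "(nat \<Rightarrow> data \<Rightarrow> real) \<Rightarrow> (nat \<Rightarrow> data measure) \<Rightarrow> (nat \<Rightarrow> data measure) \<Rightarrow> bool" where
  "weakly_separates f Q1 Q2 \<longleftrightarrow>
     (\<forall>\<^sub>F m in sequentially.
        prob_space.expectation (Q1 m) (f m) \<noteq> prob_space.expectation (Q2 m) (f m)) \<and>
     (\<lambda>m. sqrt (max (prob_space.variance (Q1 m) (f m)) (prob_space.variance (Q2 m) (f m))))
       \<in> O(\<lambda>m. \<bar>prob_space.expectation (Q1 m) (f m) - prob_space.expectation (Q2 m) (f m)\<bar>)"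

text \<open>
  The parameter spaces do not bound \<open>\<beta>\<close>, so a prior may have heavy tails. Means and variances of
  the polynomials must exist under both mixtures: the integral of a non-integrable function is 0 by
  convention, and without the requirement below such priors would make non-separation trivial.
\<close>

definition no_polynomial_weakly_separates ::
  "(nat \<Rightarrow> nat) \<Rightarrow> (nat \<Rightarrow> nat) \<Rightarrow> (nat \<Rightarrow> nat) \<Rightarrow>
   (nat \<Rightarrow> param set) \<Rightarrow> (nat \<Rightarrow> param set) \<Rightarrow> bool" where
  "no_polynomial_weakly_separates n p D T1 T2 \<longleftrightarrow> (\<exists>\<pi>1 \<pi>2.
     (\<forall>m. prior_on (p m) (T1 m) (\<pi>1 m) \<and> prior_on (p m) (T2 m) (\<pi>2 m)) \<and>
     (\<forall>m. \<forall>f\<in>polynomials (n m) (p m) (D m). \<forall>Q\<in>{mixture (n m) (p m) (\<pi>1 m), mixture (n m) (p m) (\<pi>2 m)}.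
        integrable Q f \<and> integrable Q (\<lambda>z. (f z)\<^sup>2)) \<and>
     (\<forall>f. (\<forall>m. f m \<in> polynomials (n m) (p m) (D m)) \<longrightarrow>
        \<not> weakly_separates f (\<lambda>m. mixture (n m) (p m) (\<pi>1 m)) (\<lambda>m. mixture (n m) (p m) (\<pi>2 m))))"

definition k_eff :: "nat \<Rightarrow> nat \<Rightarrow> nat \<Rightarrow> nat \<Rightarrow> int" where
  "k_eff n p ku D =
     \<lfloor>min (real n / ln (real p)) ((real ku)\<^sup>2 / (real D * ln (real p)))\<rfloor>"

end

theory Submission
  imports Defs
begin

text \<open>
  The alternative prior is a point mass at independent standard covariates and \<open>\<beta>\<close> supported on the
  first coordinate. Under the null prior a latent factor \<open>h = \<rho> (z\<^sub>Y + \<langle>w, z\<^sub>X\<rangle>)\<close>, where \<open>z\<^sub>Y\<close> is the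
  noise and \<open>w\<close> is supported on the \<open>k\<^sub>e\<^sub>f\<^sub>f\<close> largest loadings, is added along a random sparse
  direction \<open>s\<close> orthogonal to \<open>\<xi>\<close>. Regressing out \<open>h\<close> moves \<open>\<xi>\<^sup>T \<beta>\<close> by about
  \<open>\<rho>\<^sup>2 |s|\<^sup>2 \<langle>\<xi>, w\<rangle>\<close>, which is of the order of \<open>\<tau>\<close> when \<open>\<rho>\<^sup>2\<close> is a small multiple of
  \<open>log p / n\<close>, \<open>|s|\<^sup>2\<close> one of \<open>k\<^sub>u\<close>, and \<open>\<langle>\<xi>, w\<rangle> = \<nu>\<^sub>3\<close>.

  The factor is detectable only through the columns carrying \<open>s\<close>, and a polynomial of degree \<open>D\<close>
  sees at most \<open>D\<close> of them at a time. Hence the likelihood ratio may be truncated, by Moebius inversion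
  over sets of columns, to its components on at most \<open>D\<close> columns. Two independent directions have
  orthogonal components unless they share columns; with \<open>r\<close> shared pairs the inner product is at
  most \<open>p\<^sup>\<epsilon>\<^sup>r\<close>, and since a given pair is shared with probability of order \<open>k\<^sub>u / p\<close> and \<open>k\<^sub>u\<^sup>2 = O(p\<^sup>2\<^sup>\<gamma>)\<close>
  with \<open>\<gamma> < 1/2\<close>, the truncated chi-square divergence tends to zero.
\<close>

subsection \<open>Functions with all moments\<close>

text \<open>The loading w has to be random. A sparse random w keeps <\<xi>, w> = \<nu>_3, but |w|^2
  may grow to order 1 + k_eff / k_u. Eigenvalues stay near 1 and likelihood ratios stay
  square-integrable when \<rho>^2 |s|^2 (1 + |w|^2) is small; with \<rho>^2 of order log p / n and
  |s|^2 of order k_u, the growth is paid for by k_eff log p \<le> n. Two independent copies need an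
  exponential moment of <w, w'> with exponent of order D log p, since at most D shared columns
  count, and this needs k_eff D log p \<le> k_u^2. These are the two bounds whose minimum is k_eff.

  The regression law and the hidden factor model are compared only through moments, by the recursion
  that determines Gaussian moments from covariances. This is enough for polynomials.\<close>

definition all_moments :: "'a measure \<Rightarrow> ('a \<Rightarrow> real) \<Rightarrow> bool" where
  "all_moments M f \<longleftrightarrow> f \<in> borel_measurable M \<and> (\<forall>k::nat. integrable M (\<lambda>x. \<bar>f x\<bar> ^ k))"

lemma all_moments_measurable [dest]: "all_moments M f \<Longrightarrow> f \<in> borel_measurable M"
  by (simp add: all_moments_def)

lemma all_moments_integrable: "all_moments M f \<Longrightarrow> integrable M f"
  unfolding all_moments_def by (metis (no_types, lifting) ext integrable_abs_cancel power_one_right)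

lemma all_moments_const:
  assumes "finite_measure M"
  shows "all_moments M (\<lambda>_. c)"
  using assms by (auto simp: all_moments_def finite_measure.integrable_const)

lemma all_moments_add:
  assumes "all_moments M f" "all_moments M g"
  shows "all_moments M (\<lambda>x. f x + g x)"
  unfolding all_moments_def
proof (intro conjI allI)
  have [measurable]: "f \<in> borel_measurable M" "g \<in> borel_measurable M"
    using assms by auto
  show "(\<lambda>x. f x + g x) \<in> borel_measurable M" by measurable
  fix k :: nat
  have le: "\<bar>f x + g x\<bar> ^ k \<le> 2 ^ k * (\<bar>f x\<bar> ^ k + \<bar>g x\<bar> ^ k)" for x
  proof -
    have "\<bar>f x + g x\<bar> ^ k \<le> (2 * max \<bar>f x\<bar> \<bar>g x\<bar>) ^ k"
      by (intro power_mono) auto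
    also have "\<dots> = 2 ^ k * max \<bar>f x\<bar> \<bar>g x\<bar> ^ k"
      by (simp add: power_mult_distrib)
    also have "\<dots> \<le> 2 ^ k * (\<bar>f x\<bar> ^ k + \<bar>g x\<bar> ^ k)"
      by (intro mult_left_mono) (auto simp: max_def)
    finally show ?thesis .
  qed
  have "integrable M (\<lambda>x. 2 ^ k * (\<bar>f x\<bar> ^ k + \<bar>g x\<bar> ^ k))"
    using assms by (auto simp: all_moments_def)
  then show "integrable M (\<lambda>x. \<bar>f x + g x\<bar> ^ k)"
    by (rule Bochner_Integration.integrable_bound) (use le in auto)
qed

text \<open>Closure under products is the reason for demanding all powers at once: integrability, or
  square integrability, would be lost here. The bound is ab \<le> a^2 + b^2 for the k-th
  powers.\<close>

lemma all_moments_mult: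
  assumes "all_moments M f" "all_moments M g"
  shows "all_moments M (\<lambda>x. f x * g x)"
  unfolding all_moments_def
proof (intro conjI allI)
  have [measurable]: "f \<in> borel_measurable M" "g \<in> borel_measurable M"
    using assms by auto
  show "(\<lambda>x. f x * g x) \<in> borel_measurable M" by measurable
  fix k :: nat
  have le: "\<bar>f x * g x\<bar> ^ k \<le> \<bar>f x\<bar> ^ (2 * k) + \<bar>g x\<bar> ^ (2 * k)" for x
  proof -
    define a b where "a = \<bar>f x\<bar> ^ k" and "b = \<bar>g x\<bar> ^ k"
    have "0 \<le> a * b" by (simp add: a_def b_def)
    moreover have "2 * a * b \<le> a\<^sup>2 + b\<^sup>2" by (rule sum_squares_bound)
    ultimately have "a * b \<le> a\<^sup>2 + b\<^sup>2" by linarith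
    moreover have "a\<^sup>2 = \<bar>f x\<bar> ^ (2 * k)" "b\<^sup>2 = \<bar>g x\<bar> ^ (2 * k)"
      unfolding a_def b_def by (simp_all only: power2_eq_square mult_2 power_add)
    moreover have "\<bar>f x * g x\<bar> ^ k = a * b" by (simp only: a_def b_def abs_mult power_mult_distrib)
    ultimately show ?thesis by simp
  qed
  have "integrable M (\<lambda>x. \<bar>f x\<bar> ^ (2 * k) + \<bar>g x\<bar> ^ (2 * k))"
    using assms unfolding all_moments_def by (intro Bochner_Integration.integrable_add) auto
  then show "integrable M (\<lambda>x. \<bar>f x * g x\<bar> ^ k)"
    by (rule Bochner_Integration.integrable_bound) (use le in auto)
qed

lemma all_moments_sum:
  assumes "finite_measure M" "\<And>i. i \<in> A \<Longrightarrow> all_moments M (f i)"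
  shows "all_moments M (\<lambda>x. \<Sum>i\<in>A. f i x)"
  using assms(2)
proof (induction A rule: infinite_finite_induct)
  case (insert i A)
  then show ?case by (simp add: all_moments_add)
qed (simp_all add: all_moments_const assms(1))

lemma all_moments_prod_mset:
  assumes "finite_measure M" "\<And>i. i \<in># m \<Longrightarrow> all_moments M (f i)"
  shows "all_moments M (\<lambda>x. \<Prod>i\<in>#m. f i x)"
  using assms(2)
proof (induction m)
  case (add i m)
  then show ?case by (simp add: all_moments_mult)
qed (simp add: all_moments_const assms(1))

lemma all_moments_distr:
  assumes [measurable]: "g \<in> measurable M N" and "f \<in> borel_measurable N"
  shows "all_moments (distr M N g) f \<longleftrightarrow> all_moments M (\<lambda>x. f (g x))"
proof -
  have [measurable]: "f \<in> borel_measurable N" by fact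
  have "(\<lambda>x. f (g x)) \<in> borel_measurable M" by measurable
  then show ?thesis
    unfolding all_moments_def by (simp add: integrable_distr_eq assms(2))
qed

lemma all_moments_PiM_component:
  assumes "\<And>i. i \<in> I \<Longrightarrow> prob_space (M i)" "i \<in> I" "all_moments (M i) f"
  shows "all_moments (PiM I M) (\<lambda>z. f (z i))"
proof -
  have "all_moments (distr (PiM I M) (M i) (\<lambda>z. z i)) f"
    using assms by (subst distr_PiM_component) auto
  then show ?thesis
    using assms(2,3) by (subst (asm) all_moments_distr) (auto intro!: measurable_component_singleton)
qed

subsection \<open>Standard Gaussian vectors\<close>

abbreviation gN :: "real measure" where
  "gN \<equiv> density lborel std_normal_density"

abbreviation std_gauss :: "'i set \<Rightarrow> ('i \<Rightarrow> real) measure" where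
  "std_gauss I \<equiv> (\<Pi>\<^sub>M c\<in>I. gN)"

lemma prob_space_gN: "prob_space gN"
  by (rule prob_space_normal_density) simp

lemma prob_space_std_gauss: "prob_space (std_gauss I)"
  by (intro prob_space_PiM prob_space_gN)

lemma product_prob_space_gN: "product_prob_space (\<lambda>_. gN)"
  unfolding product_prob_space_def product_prob_space_axioms_def product_sigma_finite_def
  using prob_space_gN prob_space_imp_sigma_finite by blast

lemma all_moments_gN: "all_moments gN (\<lambda>x. x)"
proof -
  have "integrable gN (\<lambda>x. \<bar>x\<bar> ^ k)" for k
    using integrable_std_normal_moment_abs[of k]
    by (subst integrable_density) (auto simp: normal_density_nonneg)
  then show ?thesis by (simp add: all_moments_def)
qed

lemma all_moments_std_gauss: "c \<in> I \<Longrightarrow> all_moments (std_gauss I) (\<lambda>z. z c)"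
  by (rule all_moments_PiM_component[OF prob_space_gN _ all_moments_gN])

lemma gN_moment_even: "(\<integral>x. x ^ (2 * k) \<partial>gN) = fact (2 * k) / (2 ^ k * fact k)"
  using integral_std_normal_moment_even[of k]
  by (subst integral_density) (auto simp: normal_density_nonneg)

lemma gN_moment_odd: "(\<integral>x. x ^ (2 * k + 1) \<partial>gN) = 0"
  using integral_std_normal_moment_odd[of k]
  by (subst integral_density) (auto simp: normal_density_nonneg)

text \<open>Both parities of the moment formula reduce to one recursion, which is Stein's identity
  on monomials. In the even case a factor 2 (j + 1) is split off from numerator and denominator and
  cancelled.\<close>

lemma gN_moment_step: "(\<integral>x. x ^ (k + 2) \<partial>gN) = real (k + 1) * (\<integral>x. x ^ k \<partial>gN)"
proof (cases "even k")
  case True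
  then obtain j where j: "k = 2 * j" by auto
  have "(\<integral>x. x ^ (2 * (j + 1)) \<partial>gN) = real (2 * j + 1) * (\<integral>x. x ^ (2 * j) \<partial>gN)"
  proof -
    have "(fact (2 * (j + 1)) :: real) = (2 * real (j + 1)) * (real (2 * j + 1) * fact (2 * j))"
      by (simp add: distrib_right)
    moreover have "2 ^ (j + 1) * fact (j + 1) = (2 * real (j + 1)) * (2 ^ j * (fact j :: real))"
      by simp
    moreover have "2 * real (j + 1) \<noteq> 0" by simp
    moreover have "(x * u) / (x * w) = u / w" if "x \<noteq> 0" for x u w :: real
      using that by simp
    ultimately show ?thesis
      unfolding gN_moment_even by (simp only: times_divide_eq_right not_False_eq_True)
  qed
  then show ?thesis by (simp add: j)
next
  case False
  then obtain j where j: "k = 2 * j + 1" by (elim oddE)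
  then have *: "k + 2 = 2 * (j + 1) + 1" by simp
  show ?thesis unfolding * gN_moment_odd unfolding j gN_moment_odd by simp
qed

lemma integrable_gN_power: "integrable gN (\<lambda>x. x ^ k)"
  using integrable_std_normal_moment[of k]
  by (subst integrable_density) (auto simp: normal_density_nonneg)

lemma integrable_gN_poly: "integrable gN (poly P)"
  unfolding poly_altdef[abs_def] by (intro Bochner_Integration.integrable_sum integrable_mult_right integrable_gN_power)

text \<open>Gaussian integration by parts. For polynomials it needs no boundary terms: both sides
  are linear, and on monomials it is the moment recursion.\<close>

lemma gN_stein_poly: "(\<integral>x. x * poly P x \<partial>gN) = (\<integral>x. poly (pderiv P) x \<partial>gN)"
proof -
  have int: "integrable gN (\<lambda>x. x * poly Q x)" for Q
  proof -
    have "poly (pCons 0 Q) = (\<lambda>x. x * poly Q x)" by auto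
    then show ?thesis using integrable_gN_poly[of "pCons 0 Q"] by (simp only:)
  qed
  have monom: "(\<integral>x. x * poly (monom c k) x \<partial>gN) = (\<integral>x. poly (pderiv (monom c k)) x \<partial>gN)" for c k
  proof (cases k)
    case 0
    have "(\<integral>x. x ^ (2 * 0 + 1) \<partial>gN) = 0" by (rule gN_moment_odd)
    then show ?thesis using 0 by (simp add: poly_monom pderiv_monom)
  next
    case (Suc j)
    have "(\<integral>x. x * poly (monom c k) x \<partial>gN) = (\<integral>x. c * x ^ (j + 2) \<partial>gN)"
      by (simp add: poly_monom Suc mult_ac)
    also have "\<dots> = (\<integral>x. (c * real k) * x ^ j \<partial>gN)"
      using gN_moment_step[of j] by (simp add: Suc)
    finally show ?thesis by (simp add: pderiv_monom poly_monom Suc mult_ac)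
  qed
  have "(\<integral>x. x * poly (\<Sum>i\<in>A. monom (coeff P i) i) x \<partial>gN)
      = (\<integral>x. poly (pderiv (\<Sum>i\<in>A. monom (coeff P i) i)) x \<partial>gN)" if "finite A" for A
    using that
  proof induction
    case (insert i A)
    then show ?case
      using int integrable_gN_poly monom[of "coeff P i" i]
      by (simp add: distrib_left pderiv_add)
  qed simp
  from this[of "{..degree P}"] show ?thesis by (simp add: poly_as_sum_of_monoms)
qed

text \<open>The product rule in the shape of Wick's recursion: each summand takes one factor out of
  the multiset.\<close>

lemma pderiv_prod_mset:
  "pderiv (\<Prod>r\<in>#m. g r) = (\<Sum>r\<in>#m. pderiv (g r) * (\<Prod>r'\<in>#m - {#r#}. g r'))"
proof (induction m)
  case (add x m)
  have *: "image_mset (\<lambda>r. pderiv (g r) * (\<Prod>r'\<in>#add_mset x m - {#r#}. g r')) m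
      = image_mset (\<lambda>r. g x * (pderiv (g r) * (\<Prod>r'\<in>#m - {#r#}. g r'))) m"
    by (intro image_mset_cong) (simp add: diff_union_swap2 mult_ac)
  have "pderiv (\<Prod>r\<in>#add_mset x m. g r) = g x * pderiv (\<Prod>r\<in>#m. g r) + pderiv (g x) * (\<Prod>r\<in>#m. g r)"
    by (simp add: pderiv_mult mult.commute)
  also have "g x * pderiv (\<Prod>r\<in>#m. g r)
      = (\<Sum>r\<in>#m. pderiv (g r) * (\<Prod>r'\<in>#add_mset x m - {#r#}. g r'))"
    unfolding add * sum_mset_distrib_left ..
  finally show ?case by (simp add: add.commute)
qed (simp add: pderiv_1)

definition lin :: "'i set \<Rightarrow> ('i \<Rightarrow> real) \<Rightarrow> ('i \<Rightarrow> real) \<Rightarrow> real" where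
  "lin I a z = (\<Sum>j\<in>I. a j * z j)"

lemma all_moments_lin: "all_moments (std_gauss I) (lin I a)"
  unfolding lin_def
  by (intro all_moments_sum all_moments_mult all_moments_const all_moments_std_gauss
      prob_space.finite_measure prob_space_std_gauss)

lemma all_moments_prod_lin: "all_moments (std_gauss I) (\<lambda>z. \<Prod>r\<in>#m. lin I (a r) z)"
  by (intro all_moments_prod_mset all_moments_lin prob_space.finite_measure prob_space_std_gauss)

lemma integral_sum_mset:
  fixes f :: "'b \<Rightarrow> 'a \<Rightarrow> real"
  assumes "\<And>r. r \<in># m \<Longrightarrow> integrable M (f r)"
  shows "(\<integral>x. (\<Sum>r\<in>#m. f r x) \<partial>M) = (\<Sum>r\<in>#m. \<integral>x. f r x \<partial>M)"
    and "integrable M (\<lambda>x. \<Sum>r\<in>#m. f r x)"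
  using assms by (induction m) auto

text \<open>With all coordinates but \<open>c\<close> frozen, every linear form is affine in the
  remaining variable. The product is then the polynomial \<open>P m x\<close>, and Stein's identity
  applies to the inner integral of Fubini's theorem.\<close>

lemma std_gauss_stein:
  assumes I: "finite I" "c \<in> I"
  shows "(\<integral>z. z c * (\<Prod>r\<in>#m. lin I (a r) z) \<partial>std_gauss I)
    = (\<Sum>r\<in>#m. a r c * (\<integral>z. (\<Prod>r'\<in>#m - {#r#}. lin I (a r') z) \<partial>std_gauss I))"
proof -
  interpret G: product_prob_space "\<lambda>_. gN" by (rule product_prob_space_gN)
  define J where "J = I - {c}"
  have J: "finite J" "c \<notin> J" "I = insert c J" using I by (auto simp: J_def)
  define P where "P k x = (\<Prod>r\<in>#k. [:lin J (a r) x, a r c:])" for k and x :: "'a \<Rightarrow> real"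
  have lin_upd: "lin I (a r) (x(c := y)) = poly [:lin J (a r) x, a r c:] y" for r x y
  proof -
    have "lin J (a r) (x(c := y)) = lin J (a r) x"
      unfolding lin_def using J(2) by (intro sum.cong) auto
    then show ?thesis using J by (simp add: lin_def mult.commute)
  qed
  have prod_upd: "(\<Prod>r\<in>#k. lin I (a r) (x(c := y))) = poly (P k x) y" for k x y
    unfolding P_def by (induction k) (simp_all add: lin_upd distrib_right mult.assoc del: fun_upd_apply)
  have am: "all_moments (std_gauss I) (\<lambda>z. z c * (\<Prod>r\<in>#k. lin I (a r) z))" for k
    by (intro all_moments_mult all_moments_std_gauss I all_moments_prod_lin)
  have ins: "(\<integral>z. f z \<partial>std_gauss I) = (\<integral>x. (\<integral>y. f (x(c := y)) \<partial>gN) \<partial>std_gauss J)"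
    if "integrable (std_gauss I) f" for f :: "_ \<Rightarrow> real"
    unfolding J(3) using G.product_integral_insert[OF J(1,2), of f] that J(3) by simp
  have D: "pderiv (P m x) = (\<Sum>r\<in>#m. Polynomial.smult (a r c) (P (m - {#r#}) x))" for x
    unfolding P_def pderiv_prod_mset by (simp add: pderiv_pCons)
  have poly_sum: "poly (\<Sum>r\<in>#k. Polynomial.smult (a r c) (Q r)) y = (\<Sum>r\<in>#k. a r c * poly (Q r) y)" for k Q y
    by (induction k) auto
  have "(\<integral>z. z c * (\<Prod>r\<in>#m. lin I (a r) z) \<partial>std_gauss I)
      = (\<integral>x. (\<integral>y. y * poly (P m x) y \<partial>gN) \<partial>std_gauss J)"
    by (subst ins) (simp_all add: all_moments_integrable am prod_upd)
  also have "\<dots> = (\<integral>x. (\<integral>y. (\<Sum>r\<in>#m. a r c * (\<Prod>r'\<in>#m - {#r#}. lin I (a r') (x(c := y)))) \<partial>gN) \<partial>std_gauss J)"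
    unfolding gN_stein_poly D poly_sum prod_upd ..
  also have "\<dots> = (\<integral>z. (\<Sum>r\<in>#m. a r c * (\<Prod>r'\<in>#m - {#r#}. lin I (a r') z)) \<partial>std_gauss I)"
    by (subst ins) (simp_all add: integral_sum_mset(2) all_moments_integrable all_moments_prod_lin)
  also have "\<dots> = (\<Sum>r\<in>#m. a r c * (\<integral>z. (\<Prod>r'\<in>#m - {#r#}. lin I (a r') z) \<partial>std_gauss I))"
    by (subst integral_sum_mset)
      (auto intro!: integrable_mult_right all_moments_integrable all_moments_prod_lin)
  finally show ?thesis .
qed

subsection \<open>Wick recursion for Gaussian moments\<close>

text \<open>Isserlis' recursion: one variable is contracted with each of the others in turn. It
  fixes all moments in terms of \<open>K\<close>, so Gaussian vectors that are built differently can
  be compared without comparing their laws.\<close>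

definition wick :: "'b set \<Rightarrow> ('b \<Rightarrow> 'b \<Rightarrow> real) \<Rightarrow> ('b multiset \<Rightarrow> real) \<Rightarrow> bool" where
  "wick V K E \<longleftrightarrow> E {#} = 1 \<and>
     (\<forall>a\<in>V. \<forall>m. set_mset m \<subseteq> V \<longrightarrow> E (add_mset a m) = (\<Sum>r\<in>#m. K a r * E (m - {#r#})))"

lemma wick_unique:
  assumes "wick V K E" "wick V K' E'" "\<And>a b. a \<in> V \<Longrightarrow> b \<in> V \<Longrightarrow> K a b = K' a b"
    and "set_mset m \<subseteq> V"
  shows "E m = E' m"
  using assms(4)
proof (induction "size m" arbitrary: m rule: less_induct)
  case less
  show ?case
  proof (cases m)
    case empty
    then show ?thesis using assms by (simp add: wick_def)
  next
    case (add a k)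
    have "E (k - {#r#}) = E' (k - {#r#})" if "r \<in># k" for r
      using less.prems that add
      by (intro less.hyps) (auto simp: size_Diff_singleton dest: in_diffD)
    then have "(\<Sum>r\<in>#k. K a r * E (k - {#r#})) = (\<Sum>r\<in>#k. K' a r * E' (k - {#r#}))"
      using less.prems assms(3) add by (intro arg_cong[where f = sum_mset] image_mset_cong) auto
    then show ?thesis using assms(1,2) less.prems add by (simp add: wick_def)
  qed
qed

lemma wick_lin:
  assumes "finite I"
  shows "wick V (\<lambda>r r'. \<Sum>j\<in>I. a r j * a r' j) (\<lambda>m. \<integral>z. (\<Prod>r\<in>#m. lin I (a r) z) \<partial>std_gauss I)"
  unfolding wick_def
proof (intro conjI ballI allI impI)
  interpret prob_space "std_gauss I" by (rule prob_space_std_gauss)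
  show "(\<integral>z. (\<Prod>r\<in>#{#}. lin I (a r) z) \<partial>std_gauss I) = 1" by (simp add: prob_space)
  fix b m
  let ?E = "\<lambda>m. \<integral>z. (\<Prod>r\<in>#m. lin I (a r) z) \<partial>std_gauss I"
  have "?E (add_mset b m) = (\<integral>z. (\<Sum>c\<in>I. a b c * (z c * (\<Prod>r\<in>#m. lin I (a r) z))) \<partial>std_gauss I)"
    by (simp add: lin_def[of I "a b"] sum_distrib_right mult.assoc)
  also have "\<dots> = (\<Sum>c\<in>I. a b c * (\<integral>z. z c * (\<Prod>r\<in>#m. lin I (a r) z) \<partial>std_gauss I))"
    by (subst Bochner_Integration.integral_sum)
      (auto intro!: integrable_mult_right all_moments_integrable all_moments_mult all_moments_std_gauss all_moments_prod_lin)
  also have "\<dots> = (\<Sum>c\<in>I. a b c * (\<Sum>r\<in>#m. a r c * ?E (m - {#r#})))"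
    using assms by (intro sum.cong) (simp_all add: std_gauss_stein)
  also have "\<dots> = (\<Sum>r\<in>#m. (\<Sum>j\<in>I. a b j * a r j) * ?E (m - {#r#}))"
  proof -
    have "(\<Sum>c\<in>I. a b c * (\<Sum>r\<in>#k. a r c * F r)) = (\<Sum>r\<in>#k. (\<Sum>j\<in>I. a b j * a r j) * F r)" for k F
      by (induction k) (auto simp: distrib_left sum.distrib sum_distrib_right mult.assoc)
    then show ?thesis .
  qed
  finally show "?E (add_mset b m) = (\<Sum>r\<in>#m. (\<Sum>j\<in>I. a b j * a r j) * ?E (m - {#r#}))" .
qed

subsection \<open>Conditional mean shifts\<close>

text \<open>The one-dimensional Cameron-Martin formula: the exponential moves the standard normal
  density from y to y - t.\<close>

lemma gN_shift:
  assumes [measurable]: "g \<in> borel_measurable borel"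
  shows "(\<integral>\<^sup>+y. ennreal (exp (t * y - t\<^sup>2 / 2)) * g y \<partial>gN) = (\<integral>\<^sup>+y. g (y + t) \<partial>gN)"
proof -
  have *: "std_normal_density y * exp (t * y - t\<^sup>2 / 2) = std_normal_density (y - t)" for y
    by (simp add: normal_density_def exp_add[symmetric] power2_eq_square field_simps)
  have "(\<integral>\<^sup>+y. ennreal (exp (t * y - t\<^sup>2 / 2)) * g y \<partial>gN)
      = (\<integral>\<^sup>+y. ennreal (std_normal_density (y - t)) * g y \<partial>lborel)"
    by (subst nn_integral_density)
      (auto simp: *[symmetric] ennreal_mult normal_density_nonneg mult.assoc intro!: nn_integral_cong)
  also have "\<dots> = (\<integral>\<^sup>+y. ennreal (std_normal_density y) * g (t + y) \<partial>lborel)"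
    by (subst nn_integral_real_affine[where c = 1 and t = t]) auto
  also have "\<dots> = (\<integral>\<^sup>+y. g (y + t) \<partial>gN)"
    by (subst nn_integral_density) (auto simp: add.commute)
  finally show ?thesis .
qed

text \<open>A product of Cameron-Martin densities. When \<open>v\<close> vanishes on
  \<open>V\<close>, it is the likelihood ratio of the law under which each coordinate l in
  \<open>V\<close> has conditional mean \<open>s l * lin I v z\<close> given the coordinates outside
  \<open>V\<close>; \<open>shift\<close> is the corresponding transport map.\<close>

definition tilt :: "'i set \<Rightarrow> 'i set \<Rightarrow> ('i \<Rightarrow> real) \<Rightarrow> ('i \<Rightarrow> real) \<Rightarrow> ('i \<Rightarrow> real) \<Rightarrow> real" where
  "tilt I V v s z = (\<Prod>l\<in>V. exp (s l * lin I v z * z l - (s l * lin I v z)\<^sup>2 / 2))"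

definition shift :: "'i set \<Rightarrow> 'i set \<Rightarrow> ('i \<Rightarrow> real) \<Rightarrow> ('i \<Rightarrow> real) \<Rightarrow> ('i \<Rightarrow> real) \<Rightarrow> 'i \<Rightarrow> real" where
  "shift I V v s z = (\<lambda>c\<in>I. z c + (if c \<in> V then s c * lin I v z else 0))"

lemma tilt_pos: "0 < tilt I V v s z"
  unfolding tilt_def by (intro prod_pos) auto

lemma measurable_lin [measurable]: "lin I v \<in> borel_measurable (std_gauss I)"
  by (rule all_moments_measurable[OF all_moments_lin])

lemma measurable_coord: "c \<in> I \<Longrightarrow> (\<lambda>z. z c) \<in> borel_measurable (std_gauss I)"
  by (rule all_moments_measurable[OF all_moments_std_gauss])

lemma measurable_tilt: "V \<subseteq> I \<Longrightarrow> tilt I V v s \<in> borel_measurable (std_gauss I)"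
  unfolding tilt_def[abs_def]
  by (intro borel_measurable_prod borel_measurable_exp[THEN measurable_compose_rev] borel_measurable_diff
      borel_measurable_times borel_measurable_const measurable_lin measurable_coord borel_measurable_divide
      borel_measurable_power) auto

lemma measurable_shift: "shift I V v s \<in> measurable (std_gauss I) (std_gauss I)"
  unfolding shift_def[abs_def]
proof (rule measurable_restrict)
  fix c assume c: "c \<in> I"
  have "(\<lambda>z. z c + (if c \<in> V then s c * lin I v z else 0)) \<in> borel_measurable (std_gauss I)"
    using measurable_coord[OF c] by simp
  then show "(\<lambda>z. z c + (if c \<in> V then s c * lin I v z else 0)) \<in> measurable (std_gauss I) gN"
    by simp
qed

lemma lin_shift:
  assumes "\<And>l. l \<in> V \<Longrightarrow> v' l = 0"
  shows "lin I v' (shift I V v s z) = lin I v' z"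
  unfolding lin_def shift_def using assms by (intro sum.cong) auto

lemma shift_empty: "z \<in> space (std_gauss I) \<Longrightarrow> shift I {} v s z = z"
  by (auto simp: shift_def space_PiM PiE_def extensional_def)

lemma shift_insert:
  assumes "l \<notin> V" "v l = 0"
  shows "shift I V v s (shift I {l} v s z) = shift I (insert l V) v s z"
proof -
  have "lin I v (shift I {l} v s z) = lin I v z" by (rule lin_shift) (use assms in auto)
  then show ?thesis using assms by (auto simp: shift_def fun_eq_iff)
qed

text \<open>Fubini's theorem singles out the coordinate \<open>l\<close>. Because
  \<open>v l = 0\<close>, the shift is constant in the inner integral and \<open>gN_shift\<close>
  applies.\<close>

lemma tilt_single:
  assumes I: "finite I" "l \<in> I" and v: "v l = 0"
  shows "density (std_gauss I) (\<lambda>z. ennreal (tilt I {l} v s z)) = distr (std_gauss I) (std_gauss I) (shift I {l} v s)"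
proof (rule measure_eqI)
  interpret G: product_prob_space "\<lambda>_. gN" by (rule product_prob_space_gN)
  fix A assume "A \<in> sets (density (std_gauss I) (\<lambda>z. ennreal (tilt I {l} v s z)))"
  then have A [measurable]: "A \<in> sets (std_gauss I)" by simp
  define J where "J = I - {l}"
  have J: "finite J" "l \<notin> J" "I = insert l J" using I by (auto simp: J_def)
  have lin_upd: "lin I v (x(l := y)) = lin J v x" for x y
    unfolding lin_def J(3) using J(1,2) v by (auto intro!: sum.cong)
  have [measurable]: "tilt I {l} v s \<in> borel_measurable (std_gauss I)"
    using I by (intro measurable_tilt) auto
  have [measurable]: "shift I {l} v s \<in> measurable (std_gauss I) (std_gauss I)"
    by (rule measurable_shift)
  have ins: "(\<integral>\<^sup>+z. f z \<partial>std_gauss I) = (\<integral>\<^sup>+x. (\<integral>\<^sup>+y. f (x(l := y)) \<partial>gN) \<partial>std_gauss J)"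
    if "f \<in> borel_measurable (std_gauss I)" for f
    unfolding J(3) using G.product_nn_integral_insert[OF J(1,2), of f] that J(3) by simp
  have "emeasure (density (std_gauss I) (\<lambda>z. ennreal (tilt I {l} v s z))) A
      = (\<integral>\<^sup>+z. ennreal (tilt I {l} v s z) * indicator A z \<partial>std_gauss I)"
    by (subst emeasure_density) auto
  also have "\<dots> = (\<integral>\<^sup>+x. (\<integral>\<^sup>+y. ennreal (exp ((s l * lin J v x) * y - (s l * lin J v x)\<^sup>2 / 2))
        * indicator A (x(l := y)) \<partial>gN) \<partial>std_gauss J)"
    by (subst ins, measurable) (simp add: tilt_def lin_upd)
  also have "\<dots> = (\<integral>\<^sup>+x. (\<integral>\<^sup>+y. indicator A (x(l := y + s l * lin J v x)) \<partial>gN) \<partial>std_gauss J)"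
  proof (rule nn_integral_cong)
    fix x assume x: "x \<in> space (std_gauss J)"
    have "(\<lambda>y. x(l := y)) \<in> measurable gN (std_gauss I)"
      unfolding J(3) using x by (intro measurable_fun_upd[where J = J]) auto
    then have [measurable]: "(\<lambda>y. x(l := y)) \<in> measurable borel (std_gauss I)" by simp
    show "(\<integral>\<^sup>+y. ennreal (exp ((s l * lin J v x) * y - (s l * lin J v x)\<^sup>2 / 2)) * indicator A (x(l := y)) \<partial>gN)
        = (\<integral>\<^sup>+y. indicator A (x(l := y + s l * lin J v x)) \<partial>gN)"
      by (rule gN_shift) measurable
  qed
  also have "\<dots> = (\<integral>\<^sup>+x. (\<integral>\<^sup>+y. indicator A (shift I {l} v s (x(l := y))) \<partial>gN) \<partial>std_gauss J)"
  proof (intro nn_integral_cong)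
    fix x y assume "x \<in> space (std_gauss J)"
    then have "x \<in> extensional J" by (auto simp: space_PiM PiE_def)
    then have "shift I {l} v s (x(l := y)) c = (x(l := y + s l * lin J v x)) c" for c
      using I(2) by (cases "c = l"; cases "c \<in> I") (auto simp: shift_def lin_upd extensional_def J_def)
    then have "shift I {l} v s (x(l := y)) = x(l := y + s l * lin J v x)" by blast
    then show "indicator A (x(l := y + s l * lin J v x)) = (indicator A (shift I {l} v s (x(l := y))) :: ennreal)"
      by simp
  qed
  also have "\<dots> = (\<integral>\<^sup>+z. indicator A (shift I {l} v s z) \<partial>std_gauss I)"
    by (subst ins) auto
  also have "\<dots> = emeasure (distr (std_gauss I) (std_gauss I) (shift I {l} v s)) A"
  proof -
    have "(\<integral>\<^sup>+z. indicator A (shift I {l} v s z) \<partial>std_gauss I)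
        = (\<integral>\<^sup>+z. indicator A z \<partial>distr (std_gauss I) (std_gauss I) (shift I {l} v s))"
      by (rule nn_integral_distr[symmetric]) measurable
    then show ?thesis by simp
  qed
  finally show "emeasure (density (std_gauss I) (\<lambda>z. ennreal (tilt I {l} v s z))) A
    = emeasure (distr (std_gauss I) (std_gauss I) (shift I {l} v s)) A" .
qed simp

text \<open>The shifted coordinates do not enter the shift, so they can be treated one after the other.\<close>

lemma density_tilt:
  assumes I: "finite I" and "V \<subseteq> I" "\<forall>l\<in>V. v l = 0"
  shows "density (std_gauss I) (\<lambda>z. ennreal (tilt I V v s z)) = distr (std_gauss I) (std_gauss I) (shift I V v s)"
proof -
  have "finite V" using assms finite_subset by blast
  then show ?thesis using assms(2,3)
  proof (induction V)
    case empty
    have "distr (std_gauss I) (std_gauss I) (shift I {} v s) = distr (std_gauss I) (std_gauss I) (\<lambda>z. z)"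
      by (rule distr_cong) (auto simp: shift_empty)
    then show ?case by (simp add: tilt_def density_1)
  next
    case (insert l V)
    have tm: "tilt I U v s \<in> borel_measurable (std_gauss I)" if "U \<subseteq> insert l V" for U
      using insert.prems that by (intro measurable_tilt) auto
    have lV [measurable]: "tilt I V v s \<in> borel_measurable (std_gauss I)"
      "tilt I {l} v s \<in> borel_measurable (std_gauss I)" using tm by auto
    note [measurable] = measurable_shift
    have "density (std_gauss I) (\<lambda>z. ennreal (tilt I (insert l V) v s z))
        = density (density (std_gauss I) (\<lambda>z. ennreal (tilt I V v s z))) (\<lambda>z. ennreal (tilt I {l} v s z))"
    proof -
      have "ennreal (tilt I (insert l V) v s z) = ennreal (tilt I V v s z) * ennreal (tilt I {l} v s z)" for z
        using insert.hyps
        by (simp add: tilt_def ennreal_mult[symmetric] prod_nonneg mult.commute)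
      then show ?thesis by (subst density_density_eq) simp_all
    qed
    also have "\<dots> = density (distr (std_gauss I) (std_gauss I) (shift I V v s)) (\<lambda>z. ennreal (tilt I {l} v s z))"
      using insert by simp
    also have "\<dots> = distr (density (std_gauss I) (\<lambda>z. ennreal (tilt I {l} v s (shift I V v s z)))) (std_gauss I) (shift I V v s)"
      by (rule density_distr) measurable
    also have "density (std_gauss I) (\<lambda>z. ennreal (tilt I {l} v s (shift I V v s z)))
        = density (std_gauss I) (\<lambda>z. ennreal (tilt I {l} v s z))"
    proof -
      have "tilt I {l} v s (shift I V v s z) = tilt I {l} v s z" for z
        using insert.hyps insert.prems lin_shift[of V v I v s z]
        by (auto simp: tilt_def shift_def[of I V])
      then show ?thesis by simp
    qed
    also have "\<dots> = distr (std_gauss I) (std_gauss I) (shift I {l} v s)"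
      using insert.prems I by (intro tilt_single) auto
    also have "distr \<dots> (std_gauss I) (shift I V v s)
        = distr (std_gauss I) (std_gauss I) (shift I V v s \<circ> shift I {l} v s)"
      by (rule distr_distr) measurable
    also have "shift I V v s \<circ> shift I {l} v s = shift I (insert l V) v s"
      using insert.hyps insert.prems by (auto simp: shift_insert fun_eq_iff)
    finally show ?case .
  qed
qed

lemma tilt_integral:
  fixes f :: "_ \<Rightarrow> real"
  assumes I: "finite I" and V: "V \<subseteq> I" "\<forall>l\<in>V. v l = 0"
    and f [measurable]: "f \<in> borel_measurable (std_gauss I)"
  shows "(\<integral>z. tilt I V v s z * f z \<partial>std_gauss I) = (\<integral>z. f (shift I V v s z) \<partial>std_gauss I)"
    and "integrable (std_gauss I) (\<lambda>z. tilt I V v s z * f z) \<longleftrightarrow>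
         integrable (std_gauss I) (\<lambda>z. f (shift I V v s z))"
proof -
  note [measurable] = measurable_shift measurable_tilt[OF V(1)]
  note eq = density_tilt[where v = v and s = s, OF I V]
  show "(\<integral>z. tilt I V v s z * f z \<partial>std_gauss I) = (\<integral>z. f (shift I V v s z) \<partial>std_gauss I)"
    using arg_cong[OF eq, where f = "\<lambda>M. integral\<^sup>L M f"]
    by (subst (asm) integral_density) (auto simp: integral_distr less_imp_le[OF tilt_pos])
  show "integrable (std_gauss I) (\<lambda>z. tilt I V v s z * f z) \<longleftrightarrow>
         integrable (std_gauss I) (\<lambda>z. f (shift I V v s z))"
    using arg_cong[OF eq, where f = "\<lambda>M. integrable M f"]
    by (subst (asm) integrable_density) (auto simp: integrable_distr_eq less_imp_le[OF tilt_pos])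
qed

text \<open>Each tilt is used once as a change of measure. The shift belonging to the first
  multiplies the second by the cross term, to which only coordinates shifted by both contribute. The
  second change of measure leaves the cross term as it is, because neither linear form sees a
  shifted coordinate.\<close>

lemma tilt_tilt:
  fixes s s' :: "'i \<Rightarrow> real"
  assumes I: "finite I" and V: "V \<subseteq> I" "V' \<subseteq> I"
    and v: "\<forall>l\<in>V \<union> V'. v l = 0" "\<forall>l\<in>V \<union> V'. v' l = 0"
  defines "c \<equiv> \<Sum>l\<in>V \<inter> V'. s l * s' l"
  shows "(\<integral>z. tilt I V v s z * tilt I V' v' s' z \<partial>std_gauss I) = (\<integral>z. exp (c * (lin I v z * lin I v' z)) \<partial>std_gauss I)"
    and "integrable (std_gauss I) (\<lambda>z. tilt I V v s z * tilt I V' v' s' z) \<longleftrightarrow>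
         integrable (std_gauss I) (\<lambda>z. exp (c * (lin I v z * lin I v' z)))"
proof -
  have fin: "finite V'" using I V finite_subset by blast
  have eq: "tilt I V' v' s' (shift I V v s z) = tilt I V' v' s' z * exp (c * (lin I v z * lin I v' z))" for z
  proof -
    have "lin I v' (shift I V v s z) = lin I v' z" by (rule lin_shift) (use v in auto)
    then have "tilt I V' v' s' (shift I V v s z)
        = (\<Prod>l\<in>V'. exp (s' l * lin I v' z * z l - (s' l * lin I v' z)\<^sup>2 / 2)
              * exp (if l \<in> V then s l * s' l * (lin I v z * lin I v' z) else 0))"
      unfolding tilt_def using V(2)
      by (intro prod.cong) (auto simp: shift_def exp_add[symmetric] algebra_simps)
    also have "\<dots> = tilt I V' v' s' z * exp (\<Sum>l\<in>V'. if l \<in> V then s l * s' l * (lin I v z * lin I v' z) else 0)"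
      using fin by (simp add: prod.distrib tilt_def exp_sum)
    also have "(\<Sum>l\<in>V'. if l \<in> V then s l * s' l * (lin I v z * lin I v' z) else 0) = c * (lin I v z * lin I v' z)"
      unfolding c_def sum_distrib_right Int_commute[of V V'] using fin by (subst sum.inter_restrict) auto
    finally show ?thesis .
  qed
  have sh: "exp (c * (lin I v (shift I V' v' s' z) * lin I v' (shift I V' v' s' z))) = exp (c * (lin I v z * lin I v' z))" for z
    using v by (simp add: lin_shift)
  have m: "(\<lambda>z. exp (c * (lin I v z * lin I v' z))) \<in> borel_measurable (std_gauss I)" by measurable
  have v1: "\<forall>l\<in>V. v l = 0" and v2: "\<forall>l\<in>V'. v' l = 0" using v by auto
  note 1 = tilt_integral[OF I V(1) v1 measurable_tilt[OF V(2)], of s v' s']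
  note 2 = tilt_integral[OF I V(2) v2 m, of s']
  show "(\<integral>z. tilt I V v s z * tilt I V' v' s' z \<partial>std_gauss I) = (\<integral>z. exp (c * (lin I v z * lin I v' z)) \<partial>std_gauss I)"
    using 1(1) 2(1) by (simp add: eq sh)
  show "integrable (std_gauss I) (\<lambda>z. tilt I V v s z * tilt I V' v' s' z) \<longleftrightarrow>
         integrable (std_gauss I) (\<lambda>z. exp (c * (lin I v z * lin I v' z)))"
    using 1(2) 2(2) by (simp add: eq sh)
qed

subsection \<open>Exponential moments of a product of two linear forms\<close>

lemma gN_exp: "(\<integral>\<^sup>+y. ennreal (exp (t * y)) \<partial>gN) = ennreal (exp (t\<^sup>2 / 2))"
proof -
  interpret prob_space gN by (rule prob_space_gN)
  have "(\<integral>\<^sup>+y. ennreal (exp (t * y)) \<partial>gN)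
      = (\<integral>\<^sup>+y. ennreal (exp (t * y - t\<^sup>2 / 2)) * ennreal (exp (t\<^sup>2 / 2)) \<partial>gN)"
    by (intro nn_integral_cong) (simp add: ennreal_mult[symmetric] exp_add[symmetric])
  also have "\<dots> = (\<integral>\<^sup>+y. ennreal (exp (t\<^sup>2 / 2)) \<partial>gN)"
    by (rule gN_shift) simp
  also have "\<dots> = ennreal (exp (t\<^sup>2 / 2))" using emeasure_space_1 by simp
  finally show ?thesis .
qed

lemma lin_exp:
  assumes "finite I"
  shows "(\<integral>\<^sup>+z. ennreal (exp (t * lin I a z)) \<partial>std_gauss I) = ennreal (exp (t\<^sup>2 * (\<Sum>j\<in>I. (a j)\<^sup>2) / 2))"
proof -
  interpret G: product_prob_space "\<lambda>_. gN" by (rule product_prob_space_gN)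
  have "(\<integral>\<^sup>+z. ennreal (exp (t * lin I a z)) \<partial>std_gauss I)
      = (\<integral>\<^sup>+z. (\<Prod>j\<in>I. ennreal (exp ((t * a j) * z j))) \<partial>std_gauss I)"
    using assms by (intro nn_integral_cong) (simp add: lin_def sum_distrib_left exp_sum prod_ennreal mult.assoc)
  also have "\<dots> = (\<Prod>j\<in>I. \<integral>\<^sup>+y. ennreal (exp ((t * a j) * y)) \<partial>gN)"
    using assms by (intro G.product_nn_integral_prod) auto
  also have "\<dots> = ennreal (\<Prod>j\<in>I. exp ((t * a j)\<^sup>2 / 2))"
    by (simp add: gN_exp prod_ennreal)
  also have "(\<Prod>j\<in>I. exp ((t * a j)\<^sup>2 / 2)) = exp (t\<^sup>2 * (\<Sum>j\<in>I. (a j)\<^sup>2) / 2)"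
    using assms by (simp add: exp_sum[symmetric] sum_distrib_left sum_divide_distrib power_mult_distrib)
  finally show ?thesis .
qed

text \<open>The factor exp (y^2 / 4) doubles the variance: the product with the density is
  \<open>sqrt 2\<close> times the density of N(0, 2).\<close>

lemma gN_exp_sq: "(\<integral>\<^sup>+y. ennreal (exp (y\<^sup>2 / 4)) \<partial>gN) = ennreal (sqrt 2)"
proof -
  have *: "std_normal_density y * exp (y\<^sup>2 / 4) = sqrt 2 * normal_density 0 (sqrt 2) y" for y :: real
    by (simp add: normal_density_def exp_add[symmetric] real_sqrt_mult field_simps)
  interpret prob_space "density lborel (normal_density 0 (sqrt 2))"
    by (rule prob_space_normal_density) simp
  have one: "(\<integral>\<^sup>+y. ennreal (normal_density 0 (sqrt 2) y) \<partial>lborel) = 1"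
    using emeasure_space_1 by (simp add: emeasure_density)
  have "(\<integral>\<^sup>+y. ennreal (exp (y\<^sup>2 / 4)) \<partial>gN)
      = (\<integral>\<^sup>+y. ennreal (std_normal_density y * exp (y\<^sup>2 / 4)) \<partial>lborel)"
    by (subst nn_integral_density) (auto simp: ennreal_mult normal_density_nonneg)
  also have "\<dots> = (\<integral>\<^sup>+y. ennreal (sqrt 2) * ennreal (normal_density 0 (sqrt 2) y) \<partial>lborel)"
    unfolding * by (simp add: ennreal_mult normal_density_nonneg)
  also have "\<dots> = ennreal (sqrt 2)"
    by (subst nn_integral_cmult) (auto simp: one)
  finally show ?thesis .
qed

text \<open>Writing \<open>exp (x\<^sup>2 / (4 A))\<close> as an average of \<open>exp (y x / sqrt (2 A))\<close> over a standard normal \<open>y\<close>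
  linearises the square.\<close>

lemma lin_exp_sq:
  assumes I: "finite I" and A: "A = (\<Sum>j\<in>I. (a j)\<^sup>2)" "A > 0"
  shows "(\<integral>\<^sup>+z. ennreal (exp ((lin I a z)\<^sup>2 / (4 * A))) \<partial>std_gauss I) = ennreal (sqrt 2)"
proof -
  interpret N: prob_space gN by (rule prob_space_gN)
  interpret S: prob_space "std_gauss I" by (rule prob_space_std_gauss)
  interpret P: pair_sigma_finite "std_gauss I" gN by unfold_locales
  let ?b = "1 / sqrt (2 * A)"
  have b: "?b\<^sup>2 = 1 / (2 * A)" using A(2) by (simp add: power_divide)
  have "ennreal (exp ((lin I a z)\<^sup>2 / (4 * A))) = (\<integral>\<^sup>+y. ennreal (exp ((?b * lin I a z) * y)) \<partial>gN)" for z
    unfolding gN_exp power_mult_distrib b by simp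
  then have "(\<integral>\<^sup>+z. ennreal (exp ((lin I a z)\<^sup>2 / (4 * A))) \<partial>std_gauss I)
      = (\<integral>\<^sup>+z. (\<integral>\<^sup>+y. ennreal (exp ((?b * lin I a z) * y)) \<partial>gN) \<partial>std_gauss I)" by simp
  also have "\<dots> = (\<integral>\<^sup>+y. (\<integral>\<^sup>+z. ennreal (exp ((?b * lin I a z) * y)) \<partial>std_gauss I) \<partial>gN)"
    by (rule P.Fubini'[symmetric]) measurable
  also have "\<dots> = (\<integral>\<^sup>+y. ennreal (exp (y\<^sup>2 / 4)) \<partial>gN)"
  proof (rule nn_integral_cong)
    fix y
    have "(\<integral>\<^sup>+z. ennreal (exp ((?b * lin I a z) * y)) \<partial>std_gauss I)
        = (\<integral>\<^sup>+z. ennreal (exp ((?b * y) * lin I a z)) \<partial>std_gauss I)" by (simp add: mult_ac)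
    also have "\<dots> = ennreal (exp (y\<^sup>2 / 4))"
      unfolding lin_exp[OF I] A(1)[symmetric] power_mult_distrib b using A(2) by simp
    finally show "(\<integral>\<^sup>+z. ennreal (exp ((?b * lin I a z) * y)) \<partial>std_gauss I) = ennreal (exp (y\<^sup>2 / 4))" .
  qed
  also have "\<dots> = ennreal (sqrt 2)" by (rule gN_exp_sq)
  finally show ?thesis .
qed

lemma lin_exp_sq':
  assumes I: "finite I" and A: "A = (\<Sum>j\<in>I. (a j)\<^sup>2)" "A > 0"
  shows "integrable (std_gauss I) (\<lambda>z. exp ((lin I a z)\<^sup>2 / (4 * A)))"
    and "(\<integral>z. exp ((lin I a z)\<^sup>2 / (4 * A)) \<partial>std_gauss I) = sqrt 2"
proof -
  note nn = lin_exp_sq[OF assms]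
  have m: "(\<lambda>z. exp ((lin I a z)\<^sup>2 / (4 * A))) \<in> borel_measurable (std_gauss I)" by measurable
  show "integrable (std_gauss I) (\<lambda>z. exp ((lin I a z)\<^sup>2 / (4 * A)))"
    using m nn by (intro integrableI_nonneg) auto
  show "(\<integral>z. exp ((lin I a z)\<^sup>2 / (4 * A)) \<partial>std_gauss I) = sqrt 2"
    using m nn by (subst integral_eq_nn_integral) auto
qed

lemma lin_lin_integral:
  assumes "finite I"
  shows "(\<integral>z. lin I a z * lin I b z \<partial>std_gauss I) = (\<Sum>j\<in>I. a j * b j)"
proof -
  note w = wick_lin[OF assms, of UNIV "\<lambda>r. if r then a else b"]
  show ?thesis
    using w[unfolded wick_def, THEN conjunct2, rule_format, of True "{#False#}"]
      w[unfolded wick_def, THEN conjunct1] by simp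
qed

lemma exp_le_quadratic: "exp y \<le> 1 + y + y\<^sup>2 / 2 * exp \<bar>y\<bar>" for y :: real
proof -
  obtain t where t: "\<bar>t\<bar> \<le> \<bar>y\<bar>" "exp y = (\<Sum>m<2. y ^ m / fact m) + exp t / fact 2 * y ^ 2"
    using Maclaurin_exp_le[of y 2] by auto
  have "exp t * y\<^sup>2 \<le> exp \<bar>y\<bar> * y\<^sup>2" using t(1) by (intro mult_right_mono) auto
  then show ?thesis unfolding t(2) by (simp add: numeral_2_eq_2 field_simps)
qed

text \<open>The expansion of exp keeps the linear term, so the covariance of the two forms enters to
  first order and the variances only through t^2 A B. The hypothesis says that \<bar>t\<bar> sqrt (A
  B) \<le> 1/8; this makes the remainder fit below the moments exp (x^2 / 4) of the normalised
  forms, whose mean is \<open>sqrt 2\<close>.\<close>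

lemma lin_lin_exp:
  assumes I: "finite I" and A: "A = (\<Sum>j\<in>I. (a j)\<^sup>2)" "A > 0" and B: "B = (\<Sum>j\<in>I. (b j)\<^sup>2)" "B > 0"
    and t: "t\<^sup>2 * (A * B) \<le> 1 / 64"
  shows "integrable (std_gauss I) (\<lambda>z. exp (t * (lin I a z * lin I b z)))"
    and "(\<integral>z. exp (t * (lin I a z * lin I b z)) \<partial>std_gauss I)
           \<le> exp (\<bar>t\<bar> * \<bar>\<Sum>j\<in>I. a j * b j\<bar> + 128 * (t\<^sup>2 * (A * B)))"
proof -
  interpret S: prob_space "std_gauss I" by (rule prob_space_std_gauss)
  define M where "M = \<bar>t\<bar> * (sqrt A * sqrt B)"
  have M2: "M\<^sup>2 = t\<^sup>2 * (A * B)" using A(2) B(2) by (simp add: M_def power_mult_distrib)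
  have M: "0 \<le> M" "M \<le> 1 / 8"
  proof -
    show "0 \<le> M" using A(2) B(2) by (simp add: M_def)
    have "M\<^sup>2 \<le> (1 / 8)\<^sup>2" using t unfolding M2 by (simp add: power_divide)
    then show "M \<le> 1 / 8" by (rule power2_le_imp_le) simp
  qed
  define ea where "ea z = exp ((lin I a z)\<^sup>2 / (4 * A))" for z
  define eb where "eb z = exp ((lin I b z)\<^sup>2 / (4 * B))" for z
  note ea = lin_exp_sq'[OF I A, folded ea_def] and eb = lin_exp_sq'[OF I B, folded eb_def]
  define y where "y z = t * (lin I a z * lin I b z)" for z
  have le: "exp (y z) \<le> 1 + y z + 32 * M\<^sup>2 * (ea z + eb z)" for z
  proof -
    define u where "u = lin I a z / sqrt A"
    define w where "w = lin I b z / sqrt B"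
    have u2: "u\<^sup>2 / 4 = (lin I a z)\<^sup>2 / (4 * A)" and w2: "w\<^sup>2 / 4 = (lin I b z)\<^sup>2 / (4 * B)"
      using A(2) B(2) by (simp_all add: u_def w_def power_divide)
    have y_abs: "\<bar>y z\<bar> = M * (\<bar>u\<bar> * \<bar>w\<bar>)"
      using A(2) B(2) by (simp add: y_def M_def u_def w_def abs_mult)
    have y_sq: "(y z)\<^sup>2 = M\<^sup>2 * (u\<^sup>2 * w\<^sup>2)"
      using arg_cong[OF y_abs, of "\<lambda>x. x\<^sup>2"] by (simp add: power_mult_distrib)
    have "\<bar>u\<bar> * \<bar>w\<bar> \<le> (u\<^sup>2 + w\<^sup>2) / 2" using sum_squares_bound[of "\<bar>u\<bar>" "\<bar>w\<bar>"] by simp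
    then have "\<bar>y z\<bar> \<le> M * ((u\<^sup>2 + w\<^sup>2) / 2)" unfolding y_abs using M by (intro mult_left_mono) auto
    then have "exp \<bar>y z\<bar> \<le> exp (M * u\<^sup>2 / 2) * exp (M * w\<^sup>2 / 2)"
      by (simp add: exp_add[symmetric] algebra_simps add_divide_distrib)
    then have "(y z)\<^sup>2 / 2 * exp \<bar>y z\<bar> \<le> (M\<^sup>2 * (u\<^sup>2 * w\<^sup>2)) / 2 * (exp (M * u\<^sup>2 / 2) * exp (M * w\<^sup>2 / 2))"
      unfolding y_sq by (intro mult_left_mono) auto
    also have "\<dots> = M\<^sup>2 / 4 * (2 * (u\<^sup>2 * exp (M * u\<^sup>2 / 2)) * (w\<^sup>2 * exp (M * w\<^sup>2 / 2)))"
      by simp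
    also have "\<dots> \<le> M\<^sup>2 / 4 * ((u\<^sup>2 * exp (M * u\<^sup>2 / 2))\<^sup>2 + (w\<^sup>2 * exp (M * w\<^sup>2 / 2))\<^sup>2)"
      by (intro mult_left_mono sum_squares_bound) auto
    also have "\<dots> \<le> M\<^sup>2 / 4 * (128 * exp (u\<^sup>2 / 4) + 128 * exp (w\<^sup>2 / 4))"
    proof -
      have "(x\<^sup>2 * exp (M * x\<^sup>2 / 2))\<^sup>2 \<le> 128 * exp (x\<^sup>2 / 4)" for x :: real
      proof -
        \<comment> \<open>The quadratic Taylor term gives x^4 \<le> 128 exp (x^2 / 8), and M \<le>
          1/8 supplies the other half of the exponent x^2 / 4.\<close>
        have "(x\<^sup>2 / 8)\<^sup>2 / 2 \<le> exp (x\<^sup>2 / 8)"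
        proof -
          have "1 + x\<^sup>2 / 8 + (x\<^sup>2 / 8)\<^sup>2 / 2 \<le> exp (x\<^sup>2 / 8)"
            by (rule exp_lower_Taylor_quadratic) simp
          moreover have "0 \<le> x\<^sup>2 / 8" by simp
          ultimately show ?thesis by linarith
        qed
        then have "(x\<^sup>2)\<^sup>2 \<le> 128 * exp (x\<^sup>2 / 8)" by (simp add: power_divide)
        moreover have "exp (M * x\<^sup>2) \<le> exp (x\<^sup>2 / 8)"
          using mult_right_mono[OF M(2), of "x\<^sup>2"] by simp
        ultimately have "(x\<^sup>2)\<^sup>2 * exp (M * x\<^sup>2) \<le> (128 * exp (x\<^sup>2 / 8)) * exp (x\<^sup>2 / 8)"
          by (intro mult_mono) auto
        also have "\<dots> = 128 * exp (x\<^sup>2 / 4)" by (simp add: exp_add[symmetric])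
        finally show ?thesis by (simp add: power_mult_distrib power2_eq_square[of "exp _"] exp_add[symmetric])
      qed
      then show ?thesis by (intro mult_left_mono add_mono) auto
    qed
    also have "\<dots> = 32 * M\<^sup>2 * (ea z + eb z)"
      unfolding ea_def eb_def u2[symmetric] w2[symmetric] by (simp add: algebra_simps)
    finally show ?thesis using exp_le_quadratic[of "y z"] by linarith
  qed
  have inty: "integrable (std_gauss I) y"
    unfolding y_def by (intro integrable_mult_right all_moments_integrable all_moments_mult all_moments_lin)
  have intu: "integrable (std_gauss I) (\<lambda>z. 1 + y z + 32 * M\<^sup>2 * (ea z + eb z))"
    using inty ea eb by auto
  show int: "integrable (std_gauss I) (\<lambda>z. exp (t * (lin I a z * lin I b z)))"
  proof (rule Bochner_Integration.integrable_bound[OF intu])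
    have "norm (exp (y z)) \<le> norm (1 + y z + 32 * M\<^sup>2 * (ea z + eb z))" for z
      using le[of z] by simp
    then show "AE z in std_gauss I. norm (exp (t * (lin I a z * lin I b z)))
        \<le> norm (1 + y z + 32 * M\<^sup>2 * (ea z + eb z))" by (simp add: y_def)
  qed measurable
  have "(\<integral>z. exp (t * (lin I a z * lin I b z)) \<partial>std_gauss I)
      \<le> (\<integral>z. 1 + y z + 32 * M\<^sup>2 * (ea z + eb z) \<partial>std_gauss I)"
    using le by (intro integral_mono int intu) (auto simp: y_def)
  also have "\<dots> = 1 + t * (\<Sum>j\<in>I. a j * b j) + 32 * M\<^sup>2 * (sqrt 2 + sqrt 2)"
  proof -
    have "(\<integral>z. y z \<partial>std_gauss I) = t * (\<Sum>j\<in>I. a j * b j)"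
      unfolding y_def using lin_lin_integral[OF I, of a b] by simp
    then show ?thesis using inty ea eb by (simp add: S.prob_space)
  qed
  \<comment> \<open>The constant is 128 = 32 * 4, where \<open>sqrt 2 + sqrt 2\<close> is rounded up
    to 4.\<close>
  also have "\<dots> \<le> 1 + (\<bar>t\<bar> * \<bar>\<Sum>j\<in>I. a j * b j\<bar> + 128 * (t\<^sup>2 * (A * B)))"
  proof -
    have "sqrt 2 \<le> 2" by (rule real_le_lsqrt) auto
    then have "32 * M\<^sup>2 * (sqrt 2 + sqrt 2) \<le> 32 * M\<^sup>2 * 4" by (intro mult_left_mono) auto
    moreover have "t * (\<Sum>j\<in>I. a j * b j) \<le> \<bar>t\<bar> * \<bar>\<Sum>j\<in>I. a j * b j\<bar>"
      using abs_ge_self[of "t * (\<Sum>j\<in>I. a j * b j)"] by (simp only: abs_mult)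
    ultimately show ?thesis unfolding M2[symmetric] by linarith
  qed
  also have "\<dots> \<le> exp (\<bar>t\<bar> * \<bar>\<Sum>j\<in>I. a j * b j\<bar> + 128 * (t\<^sup>2 * (A * B)))"
    by (rule exp_ge_add_one_self)
  finally show "(\<integral>z. exp (t * (lin I a z * lin I b z)) \<partial>std_gauss I)
           \<le> exp (\<bar>t\<bar> * \<bar>\<Sum>j\<in>I. a j * b j\<bar> + 128 * (t\<^sup>2 * (A * B)))" .
qed

subsection \<open>The law of one observation\<close>

definition obs_idx :: "nat \<Rightarrow> nat option set" where
  "obs_idx p = insert None (Some ` {..<p})"

definition obs_coord :: "real \<times> (nat \<Rightarrow> real) \<Rightarrow> nat option \<Rightarrow> real" where
  "obs_coord x o' = (case o' of None \<Rightarrow> fst x | Some j \<Rightarrow> snd x j)"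

definition obs_algebra :: "nat \<Rightarrow> (real \<times> (nat \<Rightarrow> real)) measure" where
  "obs_algebra p = borel \<Otimes>\<^sub>M (\<Pi>\<^sub>M j\<in>{..<p}. borel)"

text \<open>The choice in \<open>cov_root\<close> says nothing unless some root exists, so every
  covariance whose moments are computed needs an explicit one.\<close>

definition has_root :: "nat \<Rightarrow> (nat \<times> nat \<Rightarrow> real) \<Rightarrow> bool" where
  "has_root p S \<longleftrightarrow> (\<exists>A. \<forall>i<p. \<forall>j<p. (\<Sum>l<p. A (i, l) * A (j, l)) = (S (i, j) :: real))"

lemma finite_obs_idx [simp]: "finite (obs_idx p)"
  by (simp add: obs_idx_def)

lemma obs_idx_simps [simp]: "None \<in> obs_idx p" "Some j \<in> obs_idx p \<longleftrightarrow> j < p"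
  by (auto simp: obs_idx_def)

lemma sum_obs_idx: "(\<Sum>c\<in>obs_idx p. f c) = f None + (\<Sum>j<p. f (Some j))"
  unfolding obs_idx_def by (subst sum.insert) (auto simp: sum.reindex)

lemma cov_root:
  assumes "has_root p S" "i < p" "j < p"
  shows "(\<Sum>l<p. cov_root p S (i, l) * cov_root p S (j, l)) = S (i, j)"
  using someI_ex[OF assms(1)[unfolded has_root_def]] assms(2,3) by (auto simp: cov_root_def)

definition lin_cov :: "nat \<Rightarrow> (nat \<times> nat \<Rightarrow> real) \<Rightarrow> (nat \<Rightarrow> real) \<Rightarrow> nat \<Rightarrow> real" where
  "lin_cov p S g = (\<lambda>i\<in>{..<p}. \<Sum>l<p. cov_root p S (i, l) * g l)"

text \<open>Both domains occur: the covariates read the first p coordinates of a Gaussian vector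
  with p + 1 coordinates, the last of which is the noise.\<close>

lemma measurable_lin_cov [measurable]:
  "lin_cov p S \<in> measurable (std_gauss {..<p}) (\<Pi>\<^sub>M j\<in>{..<p}. borel)"
  "lin_cov p S \<in> measurable (std_gauss {..<Suc p}) (\<Pi>\<^sub>M j\<in>{..<p}. borel)"
  unfolding lin_cov_def[abs_def]
  by (auto intro!: measurable_restrict borel_measurable_sum borel_measurable_times measurable_coord)

lemma measurable_inner_on [measurable]:
  "(\<lambda>x. inner_on p x \<beta>) \<in> borel_measurable (\<Pi>\<^sub>M j\<in>{..<p}. borel)"
  unfolding inner_on_def by measurable

lemma normal_scale:
  assumes "\<sigma> > 0"
  shows "density lborel (normal_density 0 \<sigma>) = distr gN borel (\<lambda>y. \<sigma> * y)"
proof -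
  interpret prob_space gN by (rule prob_space_gN)
  have "distributed gN lborel (\<lambda>x. x) std_normal_density"
    unfolding distributed_def by (auto simp: distr_id2)
  from normal_density_affine[OF this, of \<sigma> 0]
  have "distributed gN lborel (\<lambda>x. \<sigma> * x) (normal_density 0 \<sigma>)"
    using assms by simp
  then have "distr gN lborel (\<lambda>x. \<sigma> * x) = density lborel (normal_density 0 \<sigma>)"
    by (rule distributed_distr_eq_density)
  then show ?thesis by (simp add: distr_cong[OF refl, of borel lborel])
qed

text \<open>One observation as a function of a single standard Gaussian vector, so that one Wick
  recursion covers response and covariates together. Coordinate \<open>p\<close> drives the
  noise.\<close>

definition obs_map :: "nat \<Rightarrow> param \<Rightarrow> (nat \<Rightarrow> real) \<Rightarrow> real \<times> (nat \<Rightarrow> real)" where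
  "obs_map p = (\<lambda>(\<beta>, S, \<sigma>) g. (inner_on p (lin_cov p S g) \<beta> + \<sigma> * g p, lin_cov p S g))"

lemma measurable_obs_map: "obs_map p \<theta> \<in> measurable (std_gauss {..<Suc p}) (obs_algebra p)"
proof -
  obtain \<beta> S \<sigma> where \<theta>: "\<theta> = (\<beta>, S, \<sigma>)" by (cases \<theta>) auto
  have [measurable]: "(\<lambda>g. g p) \<in> borel_measurable (std_gauss {..<Suc p})"
    by (rule measurable_coord) simp
  show ?thesis unfolding obs_algebra_def obs_map_def \<theta> by simp
qed

lemma obs_law_eq:
  assumes "\<sigma> > 0"
  shows "obs_law p (\<beta>, S, \<sigma>) = distr (std_gauss {..<Suc p}) (obs_algebra p) (obs_map p (\<beta>, S, \<sigma>))"
proof -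
  let ?N = "std_gauss {..<p}" and ?B = "\<Pi>\<^sub>M j\<in>{..<p}. (borel :: real measure)"
  interpret G: prob_space gN by (rule prob_space_gN)
  interpret N: prob_space ?N by (rule prob_space_std_gauss)
  interpret P: pair_sigma_finite gN ?N by unfold_locales
  have dG: "prob_space (distr gN borel (\<lambda>y. \<sigma> * y))" by (rule G.prob_space_distr) simp
  have pair: "gaussian p S \<Otimes>\<^sub>M density lborel (normal_density 0 \<sigma>)
      = distr (?N \<Otimes>\<^sub>M gN) (?B \<Otimes>\<^sub>M borel) (\<lambda>(g, y). (lin_cov p S g, \<sigma> * y))"
    unfolding gaussian_def normal_scale[OF assms] lin_cov_def[symmetric, abs_def]
    by (rule pair_measure_distr)
      (use dG prob_space_imp_sigma_finite in \<open>auto simp: lin_cov_def[symmetric, abs_def]\<close>)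
  \<comment> \<open>Inserting a coordinate into a product measure takes the new coordinate as first
    component of the pair, whereas the model has the noise as second component.\<close>
  have swap: "?N \<Otimes>\<^sub>M gN = distr (gN \<Otimes>\<^sub>M ?N) (?N \<Otimes>\<^sub>M gN) (\<lambda>(x, y). (y, x))"
  proof -
    interpret P': pair_sigma_finite ?N gN by unfold_locales
    show ?thesis by (rule P'.distr_pair_swap)
  qed
  have ins: "{..<Suc p} = insert p {..<p}" by auto
  have big: "std_gauss {..<Suc p} = distr (gN \<Otimes>\<^sub>M ?N) (std_gauss {..<Suc p}) (\<lambda>(x, X). X(p := x))"
    unfolding ins by (rule distr_pair_PiM_eq_PiM[symmetric]) (auto intro: prob_space_gN)
  have upd [measurable]: "(\<lambda>(x, X). X(p := x)) \<in> measurable (gN \<Otimes>\<^sub>M ?N) (std_gauss {..<Suc p})"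
    unfolding ins split_beta' by (rule measurable_fun_upd[where J = "{..<p}"]) auto
  have [measurable]: "obs_map p (\<beta>, S, \<sigma>) \<in> measurable (std_gauss {..<Suc p}) (obs_algebra p)"
    by (rule measurable_obs_map)
  have "obs_law p (\<beta>, S, \<sigma>)
      = distr (gN \<Otimes>\<^sub>M ?N) (obs_algebra p)
          ((\<lambda>(x, e). (inner_on p x \<beta> + e, x)) \<circ> ((\<lambda>(g, y). (lin_cov p S g, \<sigma> * y)) \<circ> (\<lambda>(x, y). (y, x))))"
    unfolding obs_law_def obs_algebra_def prod.case pair
    by (subst swap, subst distr_distr, measurable, subst distr_distr, measurable)
  also have "\<dots> = distr (gN \<Otimes>\<^sub>M ?N) (obs_algebra p) (obs_map p (\<beta>, S, \<sigma>) \<circ> (\<lambda>(x, X). X(p := x)))"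
  proof (rule distr_cong)
    fix z assume "z \<in> space (gN \<Otimes>\<^sub>M ?N)"
    have "lin_cov p S ((snd z)(p := fst z)) = lin_cov p S (snd z)"
      by (auto simp: lin_cov_def fun_eq_iff intro!: sum.cong)
    then show "((\<lambda>(x, e). (inner_on p x \<beta> + e, x)) \<circ> ((\<lambda>(g, y). (lin_cov p S g, \<sigma> * y)) \<circ> (\<lambda>(x, y). (y, x)))) z
        = (obs_map p (\<beta>, S, \<sigma>) \<circ> (\<lambda>(x, X). X(p := x))) z"
      by (cases z) (simp add: obs_map_def)
  qed auto
  also have "\<dots> = distr (std_gauss {..<Suc p}) (obs_algebra p) (obs_map p (\<beta>, S, \<sigma>))"
  proof -
    have "distr (std_gauss {..<Suc p}) (obs_algebra p) (obs_map p (\<beta>, S, \<sigma>))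
        = distr (distr (gN \<Otimes>\<^sub>M ?N) (std_gauss {..<Suc p}) (\<lambda>(x, X). X(p := x))) (obs_algebra p) (obs_map p (\<beta>, S, \<sigma>))"
      by (rule arg_cong[OF big, where f = "\<lambda>M. distr M (obs_algebra p) (obs_map p (\<beta>, S, \<sigma>))"])
    then show ?thesis by (subst (asm) distr_distr) auto
  qed
  finally show ?thesis .
qed

definition obs_cov :: "nat \<Rightarrow> param \<Rightarrow> nat option \<Rightarrow> nat option \<Rightarrow> real" where
  "obs_cov p = (\<lambda>(\<beta>, S, \<sigma>) a b. case (a, b) of
     (Some i, Some j) \<Rightarrow> S (i, j)
   | (Some i, None) \<Rightarrow> (\<Sum>l<p. \<beta> l * S (i, l))
   | (None, Some j) \<Rightarrow> (\<Sum>l<p. \<beta> l * S (l, j))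
   | (None, None) \<Rightarrow> (\<Sum>k<p. \<Sum>l<p. \<beta> k * \<beta> l * S (k, l)) + \<sigma>\<^sup>2)"

definition obs_row :: "nat \<Rightarrow> param \<Rightarrow> nat option \<Rightarrow> nat \<Rightarrow> real" where
  "obs_row p = (\<lambda>(\<beta>, S, \<sigma>) a c. case a of
     Some i \<Rightarrow> (if c < p then cov_root p S (i, c) else 0)
   | None \<Rightarrow> (if c < p then \<Sum>i<p. \<beta> i * cov_root p S (i, c) else \<sigma>))"

lemma obs_coord_obs_map:
  assumes "a \<in> obs_idx p"
  shows "obs_coord (obs_map p \<theta> g) a = lin {..<Suc p} (obs_row p \<theta> a) g"
proof -
  obtain \<beta> S \<sigma> where \<theta>: "\<theta> = (\<beta>, S, \<sigma>)" by (cases \<theta>) auto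
  show ?thesis
  proof (cases a)
    case None
    have "(\<Sum>i<p. (\<Sum>l<p. cov_root p S (i, l) * g l) * \<beta> i) = (\<Sum>l<p. (\<Sum>i<p. \<beta> i * cov_root p S (i, l)) * g l)"
      unfolding sum_distrib_right by (subst sum.swap) (simp add: mult_ac)
    then show ?thesis
      by (simp add: None \<theta> obs_coord_def obs_map_def lin_def obs_row_def inner_on_def lin_cov_def)
  next
    case (Some i)
    then show ?thesis using assms
      by (simp add: \<theta> obs_coord_def obs_map_def lin_def obs_row_def lin_cov_def)
  qed
qed

lemma obs_row_gram:
  assumes "has_root p (fst (snd \<theta>))" "a \<in> obs_idx p" "b \<in> obs_idx p"
  shows "(\<Sum>c<Suc p. obs_row p \<theta> a c * obs_row p \<theta> b c) = obs_cov p \<theta> a b"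
proof -
  obtain \<beta> S \<sigma> where \<theta>: "\<theta> = (\<beta>, S, \<sigma>)" by (cases \<theta>) auto
  let ?A = "cov_root p S"
  note root = cov_root[OF assms(1)[unfolded \<theta> fst_conv snd_conv]]
  have *: "(\<Sum>c<p. (\<Sum>i<p. \<beta> i * ?A (i, c)) * ?A (j, c)) = (\<Sum>i<p. \<beta> i * S (i, j))" if "j < p" for j
  proof -
    have "(\<Sum>c<p. (\<Sum>i<p. \<beta> i * ?A (i, c)) * ?A (j, c)) = (\<Sum>i<p. \<beta> i * (\<Sum>c<p. ?A (i, c) * ?A (j, c)))"
      unfolding sum_distrib_right sum_distrib_left by (subst sum.swap) (simp add: mult_ac)
    then show ?thesis using that by (simp add: root)
  qed
  have **: "(\<Sum>c<p. ?A (j, c) * (\<Sum>i<p. \<beta> i * ?A (i, c))) = (\<Sum>i<p. \<beta> i * S (j, i))" if "j < p" for j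
  proof -
    have "(\<Sum>c<p. ?A (j, c) * (\<Sum>i<p. \<beta> i * ?A (i, c))) = (\<Sum>i<p. \<beta> i * (\<Sum>c<p. ?A (j, c) * ?A (i, c)))"
      unfolding sum_distrib_right sum_distrib_left by (subst sum.swap) (simp add: mult_ac)
    then show ?thesis using that by (simp add: root)
  qed
  have ***: "(\<Sum>c<p. (\<Sum>i<p. \<beta> i * ?A (i, c)) * (\<Sum>i<p. \<beta> i * ?A (i, c))) = (\<Sum>k<p. \<Sum>l<p. \<beta> k * \<beta> l * S (k, l))"
  proof -
    have "(\<Sum>c<p. (\<Sum>i<p. \<beta> i * ?A (i, c)) * B c) = (\<Sum>k<p. \<beta> k * (\<Sum>c<p. ?A (k, c) * B c))" for B
      unfolding sum_distrib_right sum_distrib_left by (subst sum.swap) (simp add: mult_ac)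
    then have "(\<Sum>c<p. (\<Sum>i<p. \<beta> i * ?A (i, c)) * (\<Sum>i<p. \<beta> i * ?A (i, c)))
        = (\<Sum>k<p. \<beta> k * (\<Sum>c<p. ?A (k, c) * (\<Sum>i<p. \<beta> i * ?A (i, c))))" .
    also have "\<dots> = (\<Sum>k<p. \<beta> k * (\<Sum>i<p. \<beta> i * S (k, i)))"
      by (intro sum.cong) (auto simp: **)
    finally show ?thesis by (simp add: sum_distrib_left mult.assoc)
  qed
  show ?thesis
    using assms(2,3) by (cases a; cases b)
      (simp_all add: \<theta> obs_row_def obs_cov_def root * ** *** power2_eq_square)
qed

lemma prob_space_obs_law:
  assumes "snd (snd \<theta>) > 0"
  shows "prob_space (obs_law p \<theta>)"
proof -
  interpret prob_space "std_gauss {..<Suc p}" by (rule prob_space_std_gauss)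
  have "obs_law p \<theta> = distr (std_gauss {..<Suc p}) (obs_algebra p) (obs_map p \<theta>)"
    using assms obs_law_eq by (cases \<theta>) auto
  then show ?thesis using prob_space_distr[OF measurable_obs_map] by simp
qed

lemma sets_obs_law: "sets (obs_law p \<theta>) = sets (obs_algebra p)"
  by (cases \<theta>) (simp add: obs_law_def obs_algebra_def)

lemma measurable_obs_coord: "a \<in> obs_idx p \<Longrightarrow> (\<lambda>x. obs_coord x a) \<in> borel_measurable (obs_algebra p)"
  unfolding obs_coord_def[abs_def] obs_algebra_def by (cases a) auto

lemma all_moments_obs_coord:
  assumes "snd (snd \<theta>) > 0" "a \<in> obs_idx p"
  shows "all_moments (obs_law p \<theta>) (\<lambda>x. obs_coord x a)"
proof -
  have "obs_law p \<theta> = distr (std_gauss {..<Suc p}) (obs_algebra p) (obs_map p \<theta>)"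
    using assms obs_law_eq by (cases \<theta>) auto
  then show ?thesis
    using all_moments_lin[of "{..<Suc p}" "obs_row p \<theta> a"]
    by (simp add: all_moments_distr measurable_obs_map measurable_obs_coord assms(2) obs_coord_obs_map)
qed

lemma wick_obs_law:
  assumes "has_root p (fst (snd \<theta>))" "snd (snd \<theta>) > 0"
  shows "wick (obs_idx p) (obs_cov p \<theta>) (\<lambda>m. \<integral>x. (\<Prod>a\<in>#m. obs_coord x a) \<partial>obs_law p \<theta>)"
proof -
  have eq: "obs_law p \<theta> = distr (std_gauss {..<Suc p}) (obs_algebra p) (obs_map p \<theta>)"
    using assms obs_law_eq by (cases \<theta>) auto
  have E: "(\<integral>x. (\<Prod>a\<in>#m. obs_coord x a) \<partial>obs_law p \<theta>)
      = (\<integral>z. (\<Prod>a\<in>#m. lin {..<Suc p} (obs_row p \<theta> a) z) \<partial>std_gauss {..<Suc p})"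
    if m: "set_mset m \<subseteq> obs_idx p" for m
  proof -
    have "(\<lambda>x. \<Prod>a\<in>#m. obs_coord x a) \<in> borel_measurable (obs_algebra p)"
      using m by (induction m) (auto intro!: borel_measurable_times measurable_obs_coord)
    moreover have "(\<Prod>a\<in>#m. obs_coord (obs_map p \<theta> z) a) = (\<Prod>a\<in>#m. lin {..<Suc p} (obs_row p \<theta> a) z)" for z
      using m by (intro arg_cong[where f = prod_mset] image_mset_cong obs_coord_obs_map) auto
    ultimately show ?thesis
      by (simp add: eq integral_distr measurable_obs_map)
  qed
  note w = wick_lin[of "{..<Suc p}" "obs_idx p" "obs_row p \<theta>", simplified]
  show ?thesis
    unfolding wick_def
  proof (intro conjI ballI allI impI)
    show "(\<integral>x. (\<Prod>a\<in>#{#}. obs_coord x a) \<partial>obs_law p \<theta>) = 1"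
      using E[of "{#}"] w by (simp add: wick_def)
    fix a m assume a: "a \<in> obs_idx p" "set_mset m \<subseteq> obs_idx p"
    have sub: "set_mset (m - {#r#}) \<subseteq> obs_idx p" for r using a(2) by (meson in_diffD subset_iff)
    have "(\<integral>x. (\<Prod>a\<in>#add_mset a m. obs_coord x a) \<partial>obs_law p \<theta>)
        = (\<Sum>r\<in>#m. (\<Sum>j<Suc p. obs_row p \<theta> a j * obs_row p \<theta> r j)
            * (\<integral>z. (\<Prod>a\<in>#m - {#r#}. lin {..<Suc p} (obs_row p \<theta> a) z) \<partial>std_gauss {..<Suc p}))"
      using wick_lin[of "{..<Suc p}" "obs_idx p" "obs_row p \<theta>"] a
      by (subst E) (simp_all add: wick_def del: sum.lessThan_Suc)
    also have "\<dots> = (\<Sum>r\<in>#m. obs_cov p \<theta> a r * (\<integral>x. (\<Prod>a\<in>#m - {#r#}. obs_coord x a) \<partial>obs_law p \<theta>))"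
      using a by (intro arg_cong[where f = sum_mset] image_mset_cong)
        (subst obs_row_gram[OF assms(1)], auto simp: E[OF sub])
    finally show "(\<integral>x. (\<Prod>a\<in>#add_mset a m. obs_coord x a) \<partial>obs_law p \<theta>)
        = (\<Sum>r\<in>#m. obs_cov p \<theta> a r * (\<integral>x. (\<Prod>a\<in>#m - {#r#}. obs_coord x a) \<partial>obs_law p \<theta>))" .
  qed
qed

subsection \<open>The hidden factor model\<close>

text \<open>
  With \<open>z\<close> standard Gaussian, the hidden factor is \<open>h = \<rho> (z\<^sub>Y + \<langle>w, z\<^sub>X\<rangle>)\<close>; the data are
  \<open>X = z\<^sub>X + h s\<close> and \<open>Y = a X\<^sub>0 + \<sigma>\<^sub>0 z\<^sub>Y\<close>. The factor is hidden because neither \<open>Y\<close> nor the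
  covariates on which \<open>w\<close> lives reveal it without the covariates on which \<open>s\<close> lives.
\<close>

definition hid_coeff :: "real \<Rightarrow> (nat \<Rightarrow> real) \<Rightarrow> nat option \<Rightarrow> real" where
  "hid_coeff \<rho> w = case_option \<rho> (\<lambda>j. \<rho> * w j)"

definition base_obs :: "real \<Rightarrow> real \<Rightarrow> (nat option \<Rightarrow> real) \<Rightarrow> nat option \<Rightarrow> real" where
  "base_obs a \<sigma>0 z = case_option (a * z (Some 0) + \<sigma>0 * z None) (\<lambda>j. z (Some j))"

text \<open>The hidden factor model in regression form, for N = |s|^2 and s orthogonal to w. There
  Cov(X, z_Y) = \<rho> s, and the covariance S of X satisfies S (s - N \<rho> w) = (1 + N \<rho>^2)
  s. So z_Y has regression coefficients \<rho> (s - N \<rho> w) / (1 + N \<rho>^2) on X and residual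
  variance 1 / (1 + N \<rho>^2); both are scaled by \<open>\<sigma>0\<close> and
  \<sigma>0^2.\<close>

definition hid_param :: "nat \<Rightarrow> real \<Rightarrow> real \<Rightarrow> real \<Rightarrow> real \<Rightarrow> (nat \<Rightarrow> real) \<Rightarrow> (nat \<Rightarrow> real) \<Rightarrow> param" where
  "hid_param p a \<sigma>0 \<rho> N s w =
     ((\<lambda>j\<in>{..<p}. (if j = 0 then a else 0) + \<sigma>0 * \<rho> / (1 + N * \<rho>\<^sup>2) * (s j - N * \<rho> * w j)),
      (\<lambda>(i, j)\<in>{..<p} \<times> {..<p}. (if i = j then 1 else 0) + \<rho> * (s i * w j + s j * w i)
          + s i * s j * (\<rho>\<^sup>2 * (1 + (\<Sum>l<p. (w l)\<^sup>2)))),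
      \<sigma>0 / sqrt (1 + N * \<rho>\<^sup>2))"

text \<open>Coefficients of the observed variables as linear forms in z. The response row uses the
  coordinate 0 of z in place of the covariate with index 0; the two coincide when
  \<open>s 0 = 0\<close>.\<close>

definition hid_row :: "real \<Rightarrow> real \<Rightarrow> real \<Rightarrow> (nat \<Rightarrow> real) \<Rightarrow> (nat \<Rightarrow> real) \<Rightarrow> nat option \<Rightarrow> nat option \<Rightarrow> real" where
  "hid_row a \<sigma>0 \<rho> s w b c = (case b of
     None \<Rightarrow> (case c of None \<Rightarrow> \<sigma>0 | Some j \<Rightarrow> if j = 0 then a else 0)
   | Some j \<Rightarrow> (if c = Some j then 1 else 0) + s j * hid_coeff \<rho> w c)"

lemma base_obs_shift:
  assumes "0 < p" "s 0 = 0" "b \<in> obs_idx p" and S: "\<And>j. s j \<noteq> 0 \<Longrightarrow> j \<in> S"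
  shows "base_obs a \<sigma>0 (shift (obs_idx p) (Some ` S) (hid_coeff \<rho> w) (case_option 0 s) z) b
    = lin (obs_idx p) (hid_row a \<sigma>0 \<rho> s w b) z"
proof (cases b)
  case None
  have "(\<Sum>j<p. (if j = 0 then a else 0) * z (Some j)) = (\<Sum>j<p. if j = 0 then a * z (Some j) else 0)"
    by (intro sum.cong) auto
  also have "\<dots> = a * z (Some 0)" using assms(1) by (subst sum.delta) auto
  finally show ?thesis
    using assms by (simp add: None base_obs_def shift_def lin_def hid_row_def sum_obs_idx)
next
  case (Some j)
  then have j: "j < p" using assms(3) by simp
  have "lin (obs_idx p) (hid_row a \<sigma>0 \<rho> s w b) z
      = (\<Sum>c\<in>obs_idx p. (if c = Some j then 1 else 0) * z c) + s j * lin (obs_idx p) (hid_coeff \<rho> w) z"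
    by (simp add: lin_def hid_row_def Some distrib_right sum.distrib sum_distrib_left mult.assoc)
  also have "(\<Sum>c\<in>obs_idx p. (if c = Some j then 1 else 0) * z c) = (\<Sum>c\<in>obs_idx p. if c = Some j then z c else 0)"
    by (intro sum.cong) auto
  also have "\<dots> = z (Some j)" using j by (subst sum.delta) auto
  finally show ?thesis
    using S[of j] j by (auto simp: Some base_obs_def shift_def)
qed

text \<open>A check of the regression formulas: \<open>S\<close> is applied to s, to w and hence to
  \<beta>, where s orthogonal to w removes the mixed sums.\<close>

lemma hid_model:
  fixes s w :: "nat \<Rightarrow> real"
  assumes p: "0 < p" and s0: "s 0 = 0" and sw: "\<And>j. s j * w j = 0" and N: "(\<Sum>j<p. (s j)\<^sup>2) = N" and "\<sigma>0 > 0"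
    and b: "b \<in> obs_idx p" "c \<in> obs_idx p"
  shows "(\<Sum>j\<in>obs_idx p. hid_row a \<sigma>0 \<rho> s w b j * hid_row a \<sigma>0 \<rho> s w c j) = obs_cov p (hid_param p a \<sigma>0 \<rho> N s w) b c"
proof -
  define W where "W = (\<Sum>l<p. (w l)\<^sup>2)"
  define \<kappa> where "\<kappa> = \<sigma>0 * \<rho> / (1 + N * \<rho>\<^sup>2)"
  define S where "S i j = (if i = j then 1 else 0) + \<rho> * (s i * w j + s j * w i) + s i * s j * (\<rho>\<^sup>2 * (1 + W))" for i j :: nat
  define \<beta> where "\<beta> j = (if j = 0 then a else 0) + \<kappa> * (s j - N * \<rho> * w j)" for j :: nat
  have N0: "0 \<le> N" unfolding N[symmetric] by (intro sum_nonneg) auto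
  then have pos: "1 + N * \<rho>\<^sup>2 > 0" by (simp add: add_pos_nonneg)
  have sw': "(\<Sum>l<p. s l * w l) = 0" by (simp add: sw)
  have S_sym: "S i j = S j i" for i j by (simp add: S_def algebra_simps)
  have Ss: "(\<Sum>l<p. S j l * s l) = s j * (1 + N * (\<rho>\<^sup>2 * (1 + W))) + \<rho> * N * w j" if "j < p" for j
  proof -
    have "(\<Sum>l<p. S j l * s l) = (\<Sum>l<p. (if l = j then s l else 0) + \<rho> * s j * (s l * w l) + \<rho> * w j * (s l)\<^sup>2
        + s j * (\<rho>\<^sup>2 * (1 + W)) * (s l)\<^sup>2)"
      by (intro sum.cong) (auto simp: S_def algebra_simps power2_eq_square)
    also have "\<dots> = s j + \<rho> * s j * 0 + \<rho> * w j * N + s j * (\<rho>\<^sup>2 * (1 + W)) * N"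
      using that by (simp add: sum.distrib sum_distrib_left[symmetric] N sw')
    finally show ?thesis by (simp add: algebra_simps)
  qed
  have Sw: "(\<Sum>l<p. S j l * w l) = w j + \<rho> * W * s j" if "j < p" for j
  proof -
    have "(\<Sum>l<p. S j l * w l) = (\<Sum>l<p. (if l = j then w l else 0) + \<rho> * s j * (w l)\<^sup>2 + \<rho> * w j * (s l * w l)
        + s j * (\<rho>\<^sup>2 * (1 + W)) * (s l * w l))"
      by (intro sum.cong) (auto simp: S_def algebra_simps power2_eq_square)
    also have "\<dots> = w j + \<rho> * s j * W + \<rho> * w j * 0 + s j * (\<rho>\<^sup>2 * (1 + W)) * 0"
      using that by (simp only: sum.distrib sum_distrib_left[symmetric] W_def[symmetric] sw' sum.delta finite_lessThan lessThan_iff if_True)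
    finally show ?thesis by simp
  qed
  have Sb: "(\<Sum>l<p. \<beta> l * S j l) = a * S j 0 + \<sigma>0 * \<rho> * s j" if "j < p" for j
  proof -
    have "(\<Sum>l<p. \<beta> l * S j l) = (\<Sum>l<p. (if l = 0 then a * S j l else 0) + \<kappa> * (S j l * s l) - \<kappa> * N * \<rho> * (S j l * w l))"
      by (intro sum.cong) (auto simp: \<beta>_def algebra_simps)
    also have "\<dots> = a * S j 0 + \<kappa> * (s j * (1 + N * (\<rho>\<^sup>2 * (1 + W))) + \<rho> * N * w j) - \<kappa> * N * \<rho> * (w j + \<rho> * W * s j)"
      using p that by (simp add: sum.distrib sum_subtractf sum_distrib_left[symmetric] Ss Sw)
    \<comment> \<open>The terms with \<open>W\<close> and those with \<open>w j\<close> cancel; this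
      is the purpose of the component along w in \<beta>.\<close>
    also have "\<dots> = a * S j 0 + \<kappa> * (1 + N * \<rho>\<^sup>2) * s j"
      by (simp add: algebra_simps power2_eq_square)
    also have "\<kappa> * (1 + N * \<rho>\<^sup>2) = \<sigma>0 * \<rho>" using pos by (simp add: \<kappa>_def)
    finally show ?thesis .
  qed
  have bs: "(\<Sum>l<p. \<beta> l * s l) = \<kappa> * N"
  proof -
    have "(\<Sum>l<p. \<beta> l * s l) = (\<Sum>l<p. \<kappa> * (s l)\<^sup>2 - \<kappa> * N * \<rho> * (s l * w l))"
      by (intro sum.cong) (auto simp: \<beta>_def s0 algebra_simps power2_eq_square)
    then show ?thesis by (simp add: sum_subtractf sum_distrib_left[symmetric] N sw')
  qed
  have bb: "(\<Sum>k<p. \<Sum>l<p. \<beta> k * \<beta> l * S k l) = a\<^sup>2 + \<sigma>0 * \<rho> * (\<kappa> * N)"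
  proof -
    have "(\<Sum>k<p. \<Sum>l<p. \<beta> k * \<beta> l * S k l) = (\<Sum>k<p. \<beta> k * (\<Sum>l<p. \<beta> l * S k l))"
      by (simp add: sum_distrib_left mult.assoc)
    also have "\<dots> = (\<Sum>k<p. a * (\<beta> k * S 0 k) + \<sigma>0 * \<rho> * (\<beta> k * s k))"
      by (intro sum.cong) (auto simp: Sb S_sym[of _ 0] algebra_simps)
    also have "\<dots> = a * (a * S 0 0 + \<sigma>0 * \<rho> * s 0) + \<sigma>0 * \<rho> * (\<kappa> * N)"
      using p by (simp add: sum.distrib sum_distrib_left[symmetric] Sb bs)
    finally show ?thesis by (simp add: s0 S_def power2_eq_square)
  qed
  have sq: "(\<sigma>0 / sqrt (1 + N * \<rho>\<^sup>2))\<^sup>2 = \<sigma>0\<^sup>2 / (1 + N * \<rho>\<^sup>2)"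
    using pos by (simp add: power_divide)
  \<comment> \<open>Explained and residual variance of the noise term add up to \<sigma>0^2, so the
    variance of the response does not reveal the factor.\<close>
  have fin: "\<sigma>0 * \<rho> * (\<kappa> * N) + \<sigma>0\<^sup>2 / (1 + N * \<rho>\<^sup>2) = \<sigma>0\<^sup>2"
  proof -
    have "\<sigma>0 * \<rho> * (\<kappa> * N) + \<sigma>0\<^sup>2 / (1 + N * \<rho>\<^sup>2) = \<sigma>0\<^sup>2 * (1 + N * \<rho>\<^sup>2) / (1 + N * \<rho>\<^sup>2)"
      by (simp add: \<kappa>_def add_divide_distrib[symmetric] algebra_simps power2_eq_square)
    then show ?thesis using pos by simp
  qed
  have S': "fst (snd (hid_param p a \<sigma>0 \<rho> N s w)) (i, j) = S i j" if "i < p" "j < p" for i j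
    using that by (simp add: hid_param_def S_def W_def)
  have \<beta>': "fst (hid_param p a \<sigma>0 \<rho> N s w) j = \<beta> j" if "j < p" for j
    using that by (simp add: hid_param_def \<beta>_def \<kappa>_def)
  have delta: "(\<Sum>l<p. (if l = j then 1 else 0) * f l) = f j" if "j < p" for j and f :: "nat \<Rightarrow> real"
  proof -
    have "(\<Sum>l<p. (if l = j then 1 else 0) * f l) = (\<Sum>l<p. if l = j then f l else 0)" by (intro sum.cong) auto
    then show ?thesis using that by simp
  qed
  have delta0: "(\<Sum>l<p. (if l = 0 then a else 0) * f l) = a * f 0" for f :: "nat \<Rightarrow> real"
  proof -
    have "(\<Sum>l<p. (if l = 0 then a else 0) * f l) = (\<Sum>l<p. if l = 0 then a * f l else 0)" by (intro sum.cong) auto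
    then show ?thesis using p by simp
  qed
  have ij: "(\<Sum>l<p. ((if l = i then 1 else 0) + s i * (\<rho> * w l)) * ((if l = j then 1 else 0) + s j * (\<rho> * w l)))
      = (if i = j then 1 else 0) + \<rho> * (s i * w j + s j * w i) + s i * s j * (\<rho>\<^sup>2 * W)"
    if "i < p" "j < p" for i j
  proof -
    have "(\<Sum>l<p. ((if l = i then 1 else 0) + s i * (\<rho> * w l)) * ((if l = j then 1 else 0) + s j * (\<rho> * w l)))
        = (\<Sum>l<p. (if l = i then 1 else 0) * (if l = j then 1 else 0)) + (\<Sum>l<p. (if l = i then 1 else 0) * (s j * (\<rho> * w l)))
          + (\<Sum>l<p. (if l = j then 1 else 0) * (s i * (\<rho> * w l))) + s i * s j * \<rho>\<^sup>2 * W"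
      unfolding W_def sum_distrib_left sum.distrib[symmetric]
      by (intro sum.cong) (auto simp: algebra_simps power2_eq_square)
    also have "\<dots> = (if i = j then 1 else 0) + s j * (\<rho> * w i) + s i * (\<rho> * w j) + s i * s j * \<rho>\<^sup>2 * W"
      by (simp only: delta that)
    finally show ?thesis by (simp add: algebra_simps)
  qed
  consider i j where "b = Some i" "c = Some j" "i < p" "j < p" | i where "b = Some i" "c = None" "i < p"
    | j where "b = None" "c = Some j" "j < p" | "b = None" "c = None"
    using b by (cases b; cases c) auto
  then show ?thesis
  proof cases
    case (1 i j)
    then show ?thesis
      using S'[of i j] ij[of i j]
      by (simp add: sum_obs_idx hid_row_def hid_coeff_def obs_cov_def split_beta S_def algebra_simps power2_eq_square)
  next
    case (2 i)
    have "(\<Sum>l<p. fst (hid_param p a \<sigma>0 \<rho> N s w) l * fst (snd (hid_param p a \<sigma>0 \<rho> N s w)) (i, l)) = (\<Sum>l<p. \<beta> l * S i l)"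
      using 2 by (intro sum.cong) (auto simp: S' \<beta>')
    moreover have "(\<Sum>l<p. ((if l = i then 1 else 0) + s i * (\<rho> * w l)) * (if l = 0 then a else 0)) = a * ((if 0 = i then 1 else 0) + s i * (\<rho> * w 0))"
      using delta0[of "\<lambda>l. (if l = i then 1 else 0) + s i * (\<rho> * w l)"] by (simp only: mult.commute)
    ultimately show ?thesis using 2 Sb[of i]
      by (cases "i = 0") (simp_all add: sum_obs_idx hid_row_def hid_coeff_def obs_cov_def split_beta S_def s0 algebra_simps)
  next
    case (3 i)
    have "(\<Sum>l<p. fst (hid_param p a \<sigma>0 \<rho> N s w) l * fst (snd (hid_param p a \<sigma>0 \<rho> N s w)) (l, i)) = (\<Sum>l<p. \<beta> l * S i l)"
      using 3 by (intro sum.cong) (auto simp: S' \<beta>' S_sym[of i])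
    moreover have "(\<Sum>l<p. (if l = 0 then a else 0) * ((if l = i then 1 else 0) + s i * (\<rho> * w l))) = a * ((if 0 = i then 1 else 0) + s i * (\<rho> * w 0))"
      by (rule delta0)
    ultimately show ?thesis using 3 Sb[of i]
      by (cases "i = 0") (simp_all add: sum_obs_idx hid_row_def hid_coeff_def obs_cov_def split_beta S_def s0 algebra_simps)
  next
    case 4
    have "(\<Sum>k<p. \<Sum>l<p. fst (hid_param p a \<sigma>0 \<rho> N s w) k * fst (hid_param p a \<sigma>0 \<rho> N s w) l
        * fst (snd (hid_param p a \<sigma>0 \<rho> N s w)) (k, l)) = (\<Sum>k<p. \<Sum>l<p. \<beta> k * \<beta> l * S k l)"
      by (intro sum.cong) (auto simp: S' \<beta>')
    moreover have "snd (snd (hid_param p a \<sigma>0 \<rho> N s w)) = \<sigma>0 / sqrt (1 + N * \<rho>\<^sup>2)"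
      by (simp add: hid_param_def)
    moreover have "(\<Sum>l<p. (if l = 0 then a else 0) * (if l = 0 then a else 0)) = a * a"
      using delta0[of "\<lambda>l. if l = 0 then a else 0"] by simp
    moreover have "(\<Sum>j\<in>obs_idx p. hid_row a \<sigma>0 \<rho> s w b j * hid_row a \<sigma>0 \<rho> s w c j)
        = \<sigma>0 * \<sigma>0 + (\<Sum>l<p. (if l = 0 then a else 0) * (if l = 0 then a else 0))"
      using 4 by (simp add: sum_obs_idx hid_row_def)
    moreover have "obs_cov p (hid_param p a \<sigma>0 \<rho> N s w) b c
        = (\<Sum>k<p. \<Sum>l<p. fst (hid_param p a \<sigma>0 \<rho> N s w) k * fst (hid_param p a \<sigma>0 \<rho> N s w) l
             * fst (snd (hid_param p a \<sigma>0 \<rho> N s w)) (k, l)) + (snd (snd (hid_param p a \<sigma>0 \<rho> N s w)))\<^sup>2"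
      using 4 by (simp add: obs_cov_def split_beta)
    ultimately have "(\<Sum>j\<in>obs_idx p. hid_row a \<sigma>0 \<rho> s w b j * hid_row a \<sigma>0 \<rho> s w c j) = \<sigma>0 * \<sigma>0 + a * a"
      and "obs_cov p (hid_param p a \<sigma>0 \<rho> N s w) b c = a\<^sup>2 + (\<sigma>0 * \<rho> * (\<kappa> * N) + \<sigma>0\<^sup>2 / (1 + N * \<rho>\<^sup>2))"
      by (simp_all only: bb sq add.assoc)
    then show ?thesis unfolding fin by (simp add: power2_eq_square)
  qed
qed

text \<open>The root is sought in the form A = I + s u^T. The part of A A^T that mixes s and w
  forces u = \<rho> w + k s, and comparing multiples of s s^T leaves 2 k + k^2 N = \<rho>^2, which
  determines \<open>k\<close>.\<close>

lemma hid_param_root: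
  fixes s w :: "nat \<Rightarrow> real"
  assumes sw: "\<And>j. s j * w j = 0" and N: "(\<Sum>j<p. (s j)\<^sup>2) = N"
  shows "has_root p (fst (snd (hid_param p a \<sigma>0 \<rho> N s w)))"
proof -
  define W where "W = (\<Sum>l<p. (w l)\<^sup>2)"
  define k where "k = (sqrt (1 + N * \<rho>\<^sup>2) - 1) / N"
  have N0: "0 \<le> N" unfolding N[symmetric] by (intro sum_nonneg) auto
  have k: "s i * s j * (2 * k + k\<^sup>2 * N) = s i * s j * \<rho>\<^sup>2" if "i < p" for i j
  proof (cases "N = 0")
    \<comment> \<open>Division by 0 gives \<open>k = 0\<close> here, and the equation survives
      because s vanishes on the first p coordinates.\<close>
    case True
    then have "(s i)\<^sup>2 = 0"
      using N that sum_nonneg_eq_0_iff[of "{..<p}" "\<lambda>j. (s j)\<^sup>2"] by auto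
    then show ?thesis by simp
  next
    case False
    then have "k * N + 1 = sqrt (1 + N * \<rho>\<^sup>2)" by (simp add: k_def)
    then have "(k * N + 1)\<^sup>2 = 1 + N * \<rho>\<^sup>2" using N0 by simp
    then have "N * (2 * k + k\<^sup>2 * N) = N * \<rho>\<^sup>2" by (simp add: power2_eq_square algebra_simps)
    then show ?thesis using False by simp
  qed
  define u where "u l = \<rho> * w l + k * s l" for l
  define A where "A = (\<lambda>(i, l). (if l = i then 1 else 0) + s i * u l)"
  have delta: "(\<Sum>l<p. (if l = j then 1 else 0) * f l) = f j" if "j < p" for j and f :: "nat \<Rightarrow> real"
  proof -
    have "(\<Sum>l<p. (if l = j then 1 else 0) * f l) = (\<Sum>l<p. if l = j then f l else 0)" by (intro sum.cong) auto
    then show ?thesis using that by simp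
  qed
  have uu: "(\<Sum>l<p. (u l)\<^sup>2) = \<rho>\<^sup>2 * W + k\<^sup>2 * N"
  proof -
    have "(\<Sum>l<p. (u l)\<^sup>2) = (\<Sum>l<p. \<rho>\<^sup>2 * (w l)\<^sup>2 + k\<^sup>2 * (s l)\<^sup>2 + 2 * \<rho> * k * (s l * w l))"
      by (intro sum.cong) (auto simp: u_def power2_eq_square algebra_simps)
    then show ?thesis by (simp add: sw sum.distrib sum_distrib_left[symmetric] N W_def)
  qed
  have "(\<Sum>l<p. A (i, l) * A (j, l)) = fst (snd (hid_param p a \<sigma>0 \<rho> N s w)) (i, j)" if ij: "i < p" "j < p" for i j
  proof -
    have "(\<Sum>l<p. A (i, l) * A (j, l))
        = (\<Sum>l<p. (if l = i then 1 else 0) * (if l = j then 1 else 0)) + (\<Sum>l<p. (if l = i then 1 else 0) * (s j * u l))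
          + (\<Sum>l<p. (if l = j then 1 else 0) * (s i * u l)) + s i * s j * (\<Sum>l<p. (u l)\<^sup>2)"
      unfolding sum_distrib_left sum.distrib[symmetric] A_def prod.case
      by (intro sum.cong) (auto simp: algebra_simps power2_eq_square)
    also have "\<dots> = (if i = j then 1 else 0) + s j * u i + s i * u j + s i * s j * (\<rho>\<^sup>2 * W + k\<^sup>2 * N)"
      by (simp only: delta ij uu)
    also have "\<dots> = (if i = j then 1 else 0) + \<rho> * (s i * w j + s j * w i) + s i * s j * (\<rho>\<^sup>2 * W) + s i * s j * (2 * k + k\<^sup>2 * N)"
      by (simp add: u_def algebra_simps)
    also have "\<dots> = fst (snd (hid_param p a \<sigma>0 \<rho> N s w)) (i, j)"
      unfolding k[OF ij(1)] using ij by (simp add: hid_param_def W_def[symmetric] algebra_simps)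
    finally show ?thesis .
  qed
  then show ?thesis unfolding has_root_def by blast
qed

lemma hid_param_noise_pos:
  assumes "\<sigma>0 > 0" "N \<ge> 0"
  shows "snd (snd (hid_param p a \<sigma>0 \<rho> N s w)) > 0"
  using assms by (simp add: hid_param_def add_pos_nonneg)

lemma hid_moments:
  fixes s w :: "nat \<Rightarrow> real"
  assumes p: "0 < p" and s0: "s 0 = 0" and sw: "\<And>j. s j * w j = 0" and N: "(\<Sum>j<p. (s j)\<^sup>2) = N"
    and "\<sigma>0 > 0" and S: "\<And>j. s j \<noteq> 0 \<Longrightarrow> j \<in> S" and m: "set_mset m \<subseteq> obs_idx p"
  shows "(\<integral>x. (\<Prod>b\<in>#m. obs_coord x b) \<partial>obs_law p (hid_param p a \<sigma>0 \<rho> N s w))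
    = (\<integral>z. (\<Prod>b\<in>#m. base_obs a \<sigma>0 (shift (obs_idx p) (Some ` S) (hid_coeff \<rho> w) (case_option 0 s) z) b)
         \<partial>std_gauss (obs_idx p))"
proof -
  have N0: "0 \<le> N" unfolding N[symmetric] by (intro sum_nonneg) auto
  note 1 = wick_obs_law[OF hid_param_root[OF sw N] hid_param_noise_pos[OF \<open>\<sigma>0 > 0\<close> N0]]
  note 2 = wick_lin[of "obs_idx p" "obs_idx p" "hid_row a \<sigma>0 \<rho> s w"]
  have "(\<integral>x. (\<Prod>b\<in>#m. obs_coord x b) \<partial>obs_law p (hid_param p a \<sigma>0 \<rho> N s w))
      = (\<integral>z. (\<Prod>b\<in>#m. lin (obs_idx p) (hid_row a \<sigma>0 \<rho> s w b) z) \<partial>std_gauss (obs_idx p))"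
    by (rule wick_unique[OF 1 2 _ m]) (simp_all add: hid_model[OF p s0 sw N \<open>\<sigma>0 > 0\<close>])
  also have "\<dots> = (\<integral>z. (\<Prod>b\<in>#m. base_obs a \<sigma>0 (shift (obs_idx p) (Some ` S) (hid_coeff \<rho> w) (case_option 0 s) z) b)
         \<partial>std_gauss (obs_idx p))"
    using m p s0 S by (intro Bochner_Integration.integral_cong refl arg_cong[where f = prod_mset] image_mset_cong)
      (subst base_obs_shift, auto)
  finally show ?thesis .
qed

subsection \<open>Alternating sums over subsets\<close>

text \<open>The Moebius transform on the lattice of subsets: the component of \<open>e\<close> that
  involves every element of \<open>U\<close>.\<close>

definition mob :: "('a set \<Rightarrow> real) \<Rightarrow> 'a set \<Rightarrow> real" where
  "mob e U = (\<Sum>V\<in>Pow U. (-1) ^ card (U - V) * e V)"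

lemma mob_cong: "(\<And>V. V \<subseteq> U \<Longrightarrow> e V = e' V) \<Longrightarrow> mob e U = mob e' U"
  unfolding mob_def by (intro sum.cong) auto

lemma mob_insert:
  assumes "finite U" "x \<notin> U"
  shows "mob e (insert x U) = mob (\<lambda>V. e (insert x V)) U - mob e U"
proof -
  have "mob e (insert x U) = (\<Sum>V\<in>Pow U. (-1) ^ card (insert x U - V) * e V)
      + (\<Sum>V\<in>insert x ` Pow U. (-1) ^ card (insert x U - V) * e V)"
    unfolding mob_def Pow_insert using assms by (intro sum.union_disjoint) auto
  also have "(\<Sum>V\<in>insert x ` Pow U. (-1) ^ card (insert x U - V) * e V)
      = (\<Sum>V\<in>Pow U. (-1) ^ card (insert x U - insert x V) * e (insert x V))"
  proof (subst sum.reindex)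
    show "inj_on (insert x) (Pow U)" using assms(2) by (auto simp: inj_on_def)
  qed simp
  also have "\<dots> = mob (\<lambda>V. e (insert x V)) U"
  proof -
    have "insert x U - insert x V = U - V" for V using assms(2) by auto
    then show ?thesis by (simp add: mob_def)
  qed
  also have "(\<Sum>V\<in>Pow U. (-1) ^ card (insert x U - V) * e V) = - mob e U"
    unfolding mob_def sum_negf[symmetric]
  proof (intro sum.cong refl)
    fix V assume "V \<in> Pow U"
    then have "insert x U - V = insert x (U - V)" using assms(2) by auto
    then show "(-1) ^ card (insert x U - V) * e V = - ((-1) ^ card (U - V) * e V)"
      using assms by simp
  qed
  finally show ?thesis by simp
qed

text \<open>The terms of V and \<open>insert x V\<close> have opposite signs and cancel.\<close>

lemma mob_vanish:
  assumes "finite U" "x \<in> U" "\<And>V. V \<subseteq> U - {x} \<Longrightarrow> e (insert x V) = e V"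
  shows "mob e U = 0"
proof -
  have "mob e (insert x (U - {x})) = mob (\<lambda>V. e (insert x V)) (U - {x}) - mob e (U - {x})"
    using assms(1) by (intro mob_insert) auto
  also have "mob (\<lambda>V. e (insert x V)) (U - {x}) = mob e (U - {x})"
    by (rule mob_cong) (use assms(3) in auto)
  finally show ?thesis using assms(2) by (simp add: insert_absorb)
qed

lemma sum_mob: "finite W \<Longrightarrow> (\<Sum>U\<in>Pow W. mob e U) = e W"
proof (induction W arbitrary: e rule: finite_induct)
  case empty
  then show ?case by (simp add: mob_def)
next
  case (insert x W)
  have "(\<Sum>U\<in>Pow (insert x W). mob e U) = (\<Sum>U\<in>Pow W. mob e U) + (\<Sum>U\<in>insert x ` Pow W. mob e U)"
    unfolding Pow_insert using insert.hyps by (intro sum.union_disjoint) auto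
  also have "(\<Sum>U\<in>insert x ` Pow W. mob e U) = (\<Sum>U\<in>Pow W. mob e (insert x U))"
  proof (subst sum.reindex)
    show "inj_on (insert x) (Pow W)" using insert.hyps by (auto simp: inj_on_def)
  qed simp
  also have "\<dots> = (\<Sum>U\<in>Pow W. mob (\<lambda>V. e (insert x V)) U - mob e U)"
  proof (intro sum.cong refl mob_insert)
    fix U assume "U \<in> Pow W"
    then show "finite U" "x \<notin> U" using finite_subset[OF _ insert.hyps(1)] insert.hyps(2) by auto
  qed
  finally show ?case using insert.IH by (simp add: sum_subtractf)
qed

section \<open>Truncation to subsets of bounded size\<close>

definition small :: "'a set \<Rightarrow> nat \<Rightarrow> 'a set set" where
  "small S D = {U. U \<subseteq> S \<and> card U \<le> D}"

lemma finite_small: "finite S \<Longrightarrow> finite (small S D)"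
  unfolding small_def by (rule finite_subset[of _ "Pow S"]) auto

text \<open>Components that involve an element outside \<open>J\<close> vanish, and all subsets of
  \<open>S \<inter> J\<close> are small, so truncation at size D loses nothing. It is applied with
  \<open>J\<close> the set of columns occurring in a monomial.\<close>

lemma sum_small_mob:
  assumes S: "finite S" and J: "finite J" "card J \<le> D" and e: "\<And>V. V \<subseteq> S \<Longrightarrow> e V = e (V \<inter> J)"
  shows "(\<Sum>U\<in>small S D. mob e U) = e S"
proof -
  have "(\<Sum>U\<in>small S D. mob e U) = (\<Sum>U\<in>Pow (S \<inter> J). mob e U)"
  proof (rule sum.mono_neutral_right)
    show "Pow (S \<inter> J) \<subseteq> small S D"
    proof
      fix U assume "U \<in> Pow (S \<inter> J)"
      then have "U \<subseteq> S" "card U \<le> card J" using card_mono[OF J(1), of U] by auto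
      then show "U \<in> small S D" using J(2) by (simp add: small_def)
    qed
    show "\<forall>U\<in>small S D - Pow (S \<inter> J). mob e U = 0"
    proof
      fix U assume "U \<in> small S D - Pow (S \<inter> J)"
      then obtain x where x: "x \<in> U" "x \<notin> J" and U: "U \<subseteq> S" by (auto simp: small_def)
      show "mob e U = 0"
      proof (rule mob_vanish[OF _ x(1)])
        show "finite U" using U S finite_subset by blast
        fix V assume V: "V \<subseteq> U - {x}"
        have "e (insert x V) = e (insert x V \<inter> J)" by (rule e) (use V x U in auto)
        also have "insert x V \<inter> J = V \<inter> J" using x by auto
        also have "e (V \<inter> J) = e V" by (rule e[symmetric]) (use V U in auto)
        finally show "e (insert x V) = e V" .
      qed
    qed
  qed (rule finite_small[OF S])
  also have "\<dots> = e (S \<inter> J)" by (rule sum_mob) (use S in auto)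
  also have "\<dots> = e S" by (rule e[symmetric]) auto
  finally show ?thesis .
qed

lemma mob_prod:
  assumes "finite U"
  shows "mob (\<lambda>V. \<Prod>l\<in>V. c l) U = (\<Prod>l\<in>U. c l - 1)"
  using assms
proof (induction U)
  case (insert x U)
  have "mob (\<lambda>V. \<Prod>l\<in>insert x V. c l) U = mob (\<lambda>V. c x * (\<Prod>l\<in>V. c l)) U"
  proof (rule mob_cong)
    fix V assume V: "V \<subseteq> U"
    have "finite V" by (rule finite_subset[OF V insert.hyps(1)])
    moreover have "x \<notin> V" using V insert.hyps by auto
    ultimately show "(\<Prod>l\<in>insert x V. c l) = c x * (\<Prod>l\<in>V. c l)" by (rule prod.insert)
  qed
  also have "\<dots> = c x * mob (\<lambda>V. \<Prod>l\<in>V. c l) U"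
    by (simp add: mob_def sum_distrib_left mult_ac)
  finally show ?case using insert by (simp add: mob_insert algebra_simps)
qed (simp add: mob_def)

text \<open>Orthogonality of Moebius components. Second moments of the likelihood ratios have a
  kernel that is a product over \<open>V \<inter> V'\<close>; when U and U' differ, an element of
  just one of them does not influence the kernel, so the double transform is diagonal.\<close>

lemma mob_mob_prod:
  assumes U: "finite U" "finite U'"
  shows "mob (\<lambda>V. mob (\<lambda>V'. \<Prod>l\<in>V \<inter> V'. E l) U') U = (if U = U' then \<Prod>l\<in>U. E l - 1 else 0)"
proof -
  have inner: "mob (\<lambda>V'. \<Prod>l\<in>V \<inter> V'. E l) U' = (if U' \<subseteq> V then \<Prod>l\<in>U'. E l - 1 else 0)" for V
  proof -
    have "mob (\<lambda>V'. \<Prod>l\<in>V \<inter> V'. E l) U' = mob (\<lambda>V'. \<Prod>l\<in>V'. if l \<in> V then E l else 1) U'"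
    proof (rule mob_cong)
      fix V' assume V': "V' \<subseteq> U'"
      have "finite V'" by (rule finite_subset[OF V' U(2)])
      then show "(\<Prod>l\<in>V \<inter> V'. E l) = (\<Prod>l\<in>V'. if l \<in> V then E l else 1)"
        by (subst Int_commute) (rule prod.inter_restrict)
    qed
    also have "\<dots> = (\<Prod>l\<in>U'. (if l \<in> V then E l else 1) - 1)" by (rule mob_prod[OF U(2)])
    also have "\<dots> = (if U' \<subseteq> V then \<Prod>l\<in>U'. E l - 1 else 0)"
    proof (cases "U' \<subseteq> V")
      case True
      then show ?thesis by (auto intro!: prod.cong)
    next
      case False
      then obtain x where "x \<in> U'" "x \<notin> V" by auto
      then have "(\<Prod>l\<in>U'. (if l \<in> V then E l else 1) - 1) = 0"
        by (intro prod_zero[OF U(2)] bexI[of _ x]) auto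
      then show ?thesis using False by simp
    qed
    finally show ?thesis .
  qed
  consider "\<not> U' \<subseteq> U" | x where "U' \<subseteq> U" "x \<in> U" "x \<notin> U'" | "U = U'" by auto
  then show ?thesis
  proof cases
    case 1
    then have "mob (\<lambda>V. if U' \<subseteq> V then \<Prod>l\<in>U'. E l - 1 else 0) U = mob (\<lambda>_. 0) U"
      by (intro mob_cong) auto
    then have "mob (\<lambda>V. if U' \<subseteq> V then \<Prod>l\<in>U'. E l - 1 else 0) U = 0"
      by (simp add: mob_def[of "\<lambda>_. 0"])
    then show ?thesis unfolding inner using 1 by auto
  next
    case 2
    then have "mob (\<lambda>V. if U' \<subseteq> V then \<Prod>l\<in>U'. E l - 1 else 0) U = 0"
      by (intro mob_vanish[OF U(1), of x]) auto
    then show ?thesis unfolding inner using 2 by auto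
  next
    case 3
    have "mob (\<lambda>V. if U \<subseteq> V then \<Prod>l\<in>U. E l - 1 else 0) U
        = (\<Sum>V\<in>{U}. (-1) ^ card (U - V) * (if U \<subseteq> V then \<Prod>l\<in>U. E l - 1 else 0))"
      unfolding mob_def using U(1) by (intro sum.mono_neutral_right) auto
    then show ?thesis unfolding inner unfolding 3[symmetric] by simp
  qed
qed

subsection \<open>Square-integrable functions\<close>

definition sq_int :: "'a measure \<Rightarrow> ('a \<Rightarrow> real) \<Rightarrow> bool" where
  "sq_int M f \<longleftrightarrow> f \<in> borel_measurable M \<and> integrable M (\<lambda>x. (f x)\<^sup>2)"

lemma sq_int_mult:
  assumes "sq_int M f" "sq_int M g"
  shows "integrable M (\<lambda>x. f x * g x)"
proof -
  have [measurable]: "f \<in> borel_measurable M" "g \<in> borel_measurable M"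
    using assms by (auto simp: sq_int_def)
  have int: "integrable M (\<lambda>x. (f x)\<^sup>2 + (g x)\<^sup>2)"
    using assms unfolding sq_int_def by (intro Bochner_Integration.integrable_add) auto
  have "\<bar>f x * g x\<bar> \<le> (f x)\<^sup>2 + (g x)\<^sup>2" for x
  proof -
    have "2 * \<bar>f x\<bar> * \<bar>g x\<bar> \<le> \<bar>f x\<bar>\<^sup>2 + \<bar>g x\<bar>\<^sup>2" by (rule sum_squares_bound)
    moreover have "0 \<le> \<bar>f x\<bar> * \<bar>g x\<bar>" by simp
    moreover have "\<bar>f x * g x\<bar> = \<bar>f x\<bar> * \<bar>g x\<bar>" by (rule abs_mult)
    ultimately show ?thesis by (simp only: power2_abs)
  qed
  then show ?thesis
    by (intro Bochner_Integration.integrable_bound[OF int]) auto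
qed

lemma sq_int_scale: "sq_int M f \<Longrightarrow> sq_int M (\<lambda>x. c * f x)"
  by (auto simp: sq_int_def power_mult_distrib)

lemma sq_int_add:
  assumes "sq_int M f" "sq_int M g"
  shows "sq_int M (\<lambda>x. f x + g x)"
proof -
  have "integrable M (\<lambda>x. (f x)\<^sup>2 + (g x)\<^sup>2 + 2 * (f x * g x))"
    using assms sq_int_mult[OF assms] unfolding sq_int_def
    by (intro Bochner_Integration.integrable_add integrable_mult_right) auto
  then show ?thesis using assms by (auto simp: sq_int_def power2_sum algebra_simps)
qed

lemma sq_int_zero: "sq_int M (\<lambda>x. 0)"
  by (simp add: sq_int_def)

lemma sq_int_sum: "(\<And>i. i \<in> A \<Longrightarrow> sq_int M (f i)) \<Longrightarrow> sq_int M (\<lambda>x. \<Sum>i\<in>A. f i x)"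
  by (induction A rule: infinite_finite_induct) (auto simp: sq_int_zero intro: sq_int_add)

lemma sq_int_all_moments: "all_moments M f \<Longrightarrow> sq_int M f"
  using all_moments_integrable[OF all_moments_mult[of M f f]]
  by (auto simp: sq_int_def power2_eq_square)

lemma Cauchy_Schwarz_sq_int:
  assumes "sq_int M f" "sq_int M g"
  shows "(\<integral>x. f x * g x \<partial>M)\<^sup>2 \<le> (\<integral>x. (f x)\<^sup>2 \<partial>M) * (\<integral>x. (g x)\<^sup>2 \<partial>M)"
proof -
  define a b c where "a = (\<integral>x. (f x)\<^sup>2 \<partial>M)" and "b = (\<integral>x. f x * g x \<partial>M)" and "c = (\<integral>x. (g x)\<^sup>2 \<partial>M)"
  have int: "integrable M (\<lambda>x. (f x)\<^sup>2)" "integrable M (\<lambda>x. (g x)\<^sup>2)" "integrable M (\<lambda>x. f x * g x)"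
    using assms sq_int_mult by (auto simp: sq_int_def)
  have quad: "0 \<le> c * t\<^sup>2 + 2 * b * t + a" for t
  proof -
    have "0 \<le> (\<integral>x. (t * g x + f x)\<^sup>2 \<partial>M)" by simp
    also have "(\<integral>x. (t * g x + f x)\<^sup>2 \<partial>M) = (\<integral>x. t\<^sup>2 * (g x)\<^sup>2 + 2 * t * (f x * g x) + (f x)\<^sup>2 \<partial>M)"
      by (intro Bochner_Integration.integral_cong) (auto simp: power2_eq_square algebra_simps)
    also have "\<dots> = t\<^sup>2 * c + 2 * t * b + a"
      using int by (simp add: a_def b_def c_def)
    finally show ?thesis by (simp add: algebra_simps)
  qed
  have a0: "0 \<le> a" and c0: "0 \<le> c" by (simp_all add: a_def c_def)
  show ?thesis
  proof (cases "c = 0")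
    case True
    have "b = 0"
    proof (rule ccontr)
      \<comment> \<open>With c = 0 the quadratic is affine in t, and the t below is where it takes
        the value -1.\<close>
      assume "b \<noteq> 0"
      then have "c * (- (a + 1) / (2 * b))\<^sup>2 + 2 * b * (- (a + 1) / (2 * b)) + a = -1" using True by simp
      then show False using quad[of "- (a + 1) / (2 * b)"] by simp
    qed
    then show ?thesis using a0 c0 by (simp add: a_def[symmetric] b_def[symmetric] c_def[symmetric])
  next
    case False
    then have c: "0 < c" using c0 by simp
    have "0 \<le> c * (c * (- b / c)\<^sup>2 + 2 * b * (- b / c) + a)" by (rule mult_nonneg_nonneg[OF c0 quad])
    also have "\<dots> = a * c - b\<^sup>2" using c by (simp add: power2_eq_square field_simps)
    finally show ?thesis by (simp add: a_def[symmetric] b_def[symmetric] c_def[symmetric])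
  qed
qed

lemma PiM_prod:
  fixes f :: "'i \<Rightarrow> 'a \<Rightarrow> real"
  assumes "prob_space M" "finite I" "\<And>i. i \<in> I \<Longrightarrow> integrable M (f i)"
  shows "integrable (\<Pi>\<^sub>M i\<in>I. M) (\<lambda>z. \<Prod>i\<in>I. f i (z i))"
    and "(\<integral>z. (\<Prod>i\<in>I. f i (z i)) \<partial>(\<Pi>\<^sub>M i\<in>I. M)) = (\<Prod>i\<in>I. \<integral>x. f i x \<partial>M)"
proof -
  interpret product_sigma_finite "\<lambda>_. M"
    by (rule product_sigma_finite.intro) (rule prob_space_imp_sigma_finite[OF assms(1)])
  show "integrable (\<Pi>\<^sub>M i\<in>I. M) (\<lambda>z. \<Prod>i\<in>I. f i (z i))"
    by (rule product_integrable_prod[OF assms(2,3)])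
  show "(\<integral>z. (\<Prod>i\<in>I. f i (z i)) \<partial>(\<Pi>\<^sub>M i\<in>I. M)) = (\<Prod>i\<in>I. \<integral>x. f i x \<partial>M)"
    by (rule product_integral_prod[OF assms(2,3)])
qed

subsection \<open>Polynomials of the data\<close>

lemma coord_eq: "coord z v = obs_coord (z (fst v)) (snd v)"
  by (cases v; cases "snd v") (auto simp: obs_coord_def)

lemma coord_set_eq: "coord_set n p = {..<n} \<times> obs_idx p"
  by (simp add: coord_set_def obs_idx_def)

text \<open>The factors of a monomial that belong to observation \<open>i\<close>. Independence of
  the observations splits the expectation of a monomial along these parts.\<close>

definition part :: "(nat \<times> 'o) multiset \<Rightarrow> nat \<Rightarrow> 'o multiset" where
  "part m i = image_mset snd (filter_mset (\<lambda>v. fst v = i) m)"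

lemma set_part: "set_mset m \<subseteq> {..<n} \<times> B \<Longrightarrow> set_mset (part m i) \<subseteq> B"
  by (auto simp: part_def)

lemma prod_mset_part:
  assumes "set_mset m \<subseteq> {..<n} \<times> B"
  shows "(\<Prod>v\<in>#m. g (fst v) (snd v)) = (\<Prod>i<n. \<Prod>b\<in>#part m i. (g i b :: 'c :: comm_monoid_mult))"
  using assms
proof (induction m)
  case (add v m)
  have "(\<Prod>b\<in>#part (add_mset v m) i. g i b) = (if i = fst v then g i (snd v) else 1) * (\<Prod>b\<in>#part m i. g i b)" for i
    by (auto simp: part_def)
  then have "(\<Prod>i<n. \<Prod>b\<in>#part (add_mset v m) i. g i b)
      = (\<Prod>i<n. if i = fst v then g i (snd v) else 1) * (\<Prod>i<n. \<Prod>b\<in>#part m i. g i b)"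
    by (simp add: prod.distrib)
  also have "(\<Prod>i<n. if i = fst v then g i (snd v) else 1) = g (fst v) (snd v)"
    using add.prems by (subst prod.delta) auto
  finally show ?case using add by simp
qed (simp add: part_def)

lemma all_moments_coord:
  assumes "snd (snd \<theta>) > 0" "v \<in> coord_set n p"
  shows "all_moments (data_law n p \<theta>) (\<lambda>z. coord z v)"
  unfolding coord_eq data_law_def
  using assms by (intro all_moments_PiM_component prob_space_obs_law all_moments_obs_coord) (auto simp: coord_set_eq)

lemma prob_space_data_law: "snd (snd \<theta>) > 0 \<Longrightarrow> prob_space (data_law n p \<theta>)"
  unfolding data_law_def by (intro prob_space_PiM prob_space_obs_law)

lemma all_moments_monomial:
  assumes "snd (snd \<theta>) > 0" "set_mset m \<subseteq> coord_set n p"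
  shows "all_moments (data_law n p \<theta>) (\<lambda>z. \<Prod>v\<in>#m. coord z v)"
  using assms by (intro all_moments_prod_mset all_moments_coord prob_space.finite_measure prob_space_data_law) auto

lemma all_moments_polynomial:
  assumes "snd (snd \<theta>) > 0" "f \<in> polynomials n p D"
  shows "all_moments (data_law n p \<theta>) f"
proof -
  obtain M c where f: "finite M" "\<forall>m\<in>M. set_mset m \<subseteq> coord_set n p \<and> size m \<le> D"
    "f = (\<lambda>z. \<Sum>m\<in>M. c m * (\<Prod>v\<in>#m. coord z v))"
    using assms(2) by (auto simp: polynomials_def)
  have fin: "finite_measure (data_law n p \<theta>)"
    using assms by (intro prob_space.finite_measure prob_space_data_law)
  show ?thesis unfolding f(3)
    using f(2) by (intro all_moments_sum all_moments_mult all_moments_const all_moments_monomial fin assms) auto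
qed

section \<open>Likelihood ratios of the hidden factor model\<close>

abbreviation noise_space :: "nat \<Rightarrow> nat \<Rightarrow> (nat \<Rightarrow> nat option \<Rightarrow> real) measure" where
  "noise_space n p \<equiv> (\<Pi>\<^sub>M i\<in>{..<n}. std_gauss (obs_idx p))"

definition base_monomial :: "real \<Rightarrow> real \<Rightarrow> (nat \<times> nat option) multiset \<Rightarrow> (nat \<Rightarrow> nat option \<Rightarrow> real) \<Rightarrow> real" where
  "base_monomial a \<sigma>0 m z = (\<Prod>v\<in>#m. base_obs a \<sigma>0 (z (fst v)) (snd v))"

text \<open>Likelihood ratio, on the noise space, of the model whose factor acts only on the columns
  in \<open>V\<close> against the model without factor. Proper subsets \<open>V\<close> of the
  carrying columns are wanted for Moebius inversion.\<close>

definition Lam :: "nat \<Rightarrow> nat \<Rightarrow> real \<Rightarrow> (nat \<Rightarrow> real) \<Rightarrow> (nat \<Rightarrow> real) \<Rightarrow> nat set \<Rightarrow> (nat \<Rightarrow> nat option \<Rightarrow> real) \<Rightarrow> real" where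
  "Lam n p \<rho> s w V z = (\<Prod>i<n. tilt (obs_idx p) (Some ` V) (hid_coeff \<rho> w) (case_option 0 s) (z i))"

lemma prob_space_noise: "prob_space (noise_space n p)"
  by (intro prob_space_PiM prob_space_std_gauss)

lemma all_moments_base_obs:
  assumes "0 < p" "b \<in> obs_idx p"
  shows "all_moments (std_gauss (obs_idx p)) (\<lambda>z. base_obs a \<sigma>0 z b)"
  unfolding base_obs_def using assms
  by (cases b) (auto intro!: all_moments_add all_moments_mult all_moments_const all_moments_std_gauss
      prob_space.finite_measure prob_space_std_gauss)

lemma all_moments_base_monomial:
  assumes "0 < p" "set_mset m \<subseteq> coord_set n p"
  shows "all_moments (noise_space n p) (base_monomial a \<sigma>0 m)"
  unfolding base_monomial_def[abs_def]
proof (rule all_moments_prod_mset)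
  show "finite_measure (noise_space n p)" by (intro prob_space.finite_measure prob_space_noise)
  fix v assume "v \<in># m"
  then have v: "fst v \<in> {..<n}" "snd v \<in> obs_idx p" using assms(2) by (auto simp: coord_set_eq)
  show "all_moments (noise_space n p) (\<lambda>z. base_obs a \<sigma>0 (z (fst v)) (snd v))"
    by (rule all_moments_PiM_component[OF prob_space_std_gauss v(1)]) (rule all_moments_base_obs[OF assms(1) v(2)])
qed

lemma hid_coeff_sq: "(\<Sum>c\<in>obs_idx p. hid_coeff \<rho> w c * hid_coeff \<rho> w' c) = \<rho>\<^sup>2 * (1 + inner_on p w w')"
  by (simp add: sum_obs_idx hid_coeff_def inner_on_def sum_distrib_left algebra_simps power2_eq_square)

text \<open>Column 0 is left out of \<open>S\<close> so that the response, built on it, is not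
  shifted; w vanishes on \<open>S\<close> so that the factor is a function of unshifted coordinates;
  the bound 1 on the weights bounds overlaps by numbers of columns.\<close>

definition hid_ok :: "nat \<Rightarrow> nat set \<Rightarrow> (nat \<Rightarrow> real) \<Rightarrow> (nat \<Rightarrow> real) \<Rightarrow> bool" where
  "hid_ok p S s w \<longleftrightarrow> 0 < p \<and> 0 \<notin> S \<and> S \<subseteq> {..<p} \<and> (\<forall>j. j \<notin> S \<longrightarrow> s j = 0) \<and> (\<forall>j\<in>S. w j = 0 \<and> \<bar>s j\<bar> \<le> 1)"

lemma hid_ok_finite: "hid_ok p S s w \<Longrightarrow> finite S"
  unfolding hid_ok_def using finite_subset by auto

lemma measurable_Lam:
  assumes "V \<subseteq> {..<p}"
  shows "Lam n p \<rho> s w V \<in> borel_measurable (noise_space n p)"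
  unfolding Lam_def[abs_def]
proof (rule borel_measurable_prod)
  fix i assume "i \<in> {..<n}"
  moreover have "tilt (obs_idx p) (Some ` V) (hid_coeff \<rho> w) (case_option 0 s) \<in> borel_measurable (std_gauss (obs_idx p))"
    using assms by (intro measurable_tilt) (auto simp: obs_idx_def)
  ultimately show "(\<lambda>z. tilt (obs_idx p) (Some ` V) (hid_coeff \<rho> w) (case_option 0 s) (z i)) \<in> borel_measurable (noise_space n p)"
    by (intro measurable_compose[OF measurable_component_singleton])
qed

text \<open>The product of the two hidden factors summed over the observations. It is the only
  random quantity that survives in second moments of likelihood ratios.\<close>

definition hid_cross :: "nat \<Rightarrow> nat \<Rightarrow> real \<Rightarrow> (nat \<Rightarrow> real) \<Rightarrow> (nat \<Rightarrow> real) \<Rightarrow> (nat \<Rightarrow> nat option \<Rightarrow> real) \<Rightarrow> real" where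
  "hid_cross n p \<rho> w w' z = (\<Sum>i<n. lin (obs_idx p) (hid_coeff \<rho> w) (z i) * lin (obs_idx p) (hid_coeff \<rho> w') (z i))"

lemma exp_hid_cross:
  assumes \<rho>: "\<rho> \<noteq> 0"
    and c: "c\<^sup>2 * (\<rho>\<^sup>2 * (1 + inner_on p w w) * (\<rho>\<^sup>2 * (1 + inner_on p w' w'))) \<le> 1 / 64"
  shows "integrable (noise_space n p) (\<lambda>z. exp (c * hid_cross n p \<rho> w w' z))"
    and "(\<integral>z. exp (c * hid_cross n p \<rho> w w' z) \<partial>noise_space n p)
          = (\<integral>z. exp (c * (lin (obs_idx p) (hid_coeff \<rho> w) z * lin (obs_idx p) (hid_coeff \<rho> w') z)) \<partial>std_gauss (obs_idx p)) ^ n"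
    and "(\<integral>z. exp (c * hid_cross n p \<rho> w w' z) \<partial>noise_space n p)
          \<le> exp (real n * (\<bar>c\<bar> * (\<rho>\<^sup>2 * \<bar>1 + inner_on p w w'\<bar>)
                + 128 * (c\<^sup>2 * (\<rho>\<^sup>2 * (1 + inner_on p w w) * (\<rho>\<^sup>2 * (1 + inner_on p w' w'))))))"
    and "integrable (std_gauss (obs_idx p)) (\<lambda>z. exp (c * (lin (obs_idx p) (hid_coeff \<rho> w) z * lin (obs_idx p) (hid_coeff \<rho> w') z)))"
proof -
  have sq: "\<rho>\<^sup>2 * (1 + inner_on p w w) = (\<Sum>c\<in>obs_idx p. (hid_coeff \<rho> w c)\<^sup>2)" for w
    unfolding power2_eq_square[of "hid_coeff _ _ _"] hid_coeff_sq ..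
  have "0 \<le> inner_on p w w" for w by (auto simp: inner_on_def intro!: sum_nonneg)
  then have pos: "0 < \<rho>\<^sup>2 * (1 + inner_on p w w)" for w using \<rho> by (simp add: add_pos_nonneg)
  note 1 = lin_lin_exp[OF finite_obs_idx sq pos sq pos c]
  show i1: "integrable (std_gauss (obs_idx p)) (\<lambda>z. exp (c * (lin (obs_idx p) (hid_coeff \<rho> w) z * lin (obs_idx p) (hid_coeff \<rho> w') z)))"
    by (rule 1(1))
  have eq: "exp (c * hid_cross n p \<rho> w w' z)
      = (\<Prod>i<n. exp (c * (lin (obs_idx p) (hid_coeff \<rho> w) (z i) * lin (obs_idx p) (hid_coeff \<rho> w') (z i))))" for z
    by (simp add: hid_cross_def sum_distrib_left exp_sum)
  show "integrable (noise_space n p) (\<lambda>z. exp (c * hid_cross n p \<rho> w w' z))"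
    unfolding eq by (rule PiM_prod(1)[OF prob_space_std_gauss finite_lessThan i1])
  show e: "(\<integral>z. exp (c * hid_cross n p \<rho> w w' z) \<partial>noise_space n p)
          = (\<integral>z. exp (c * (lin (obs_idx p) (hid_coeff \<rho> w) z * lin (obs_idx p) (hid_coeff \<rho> w') z)) \<partial>std_gauss (obs_idx p)) ^ n"
    unfolding eq PiM_prod(2)[OF prob_space_std_gauss finite_lessThan i1] by simp
  have "(\<integral>z. exp (c * hid_cross n p \<rho> w w' z) \<partial>noise_space n p)
      \<le> exp (\<bar>c\<bar> * \<bar>\<Sum>j\<in>obs_idx p. hid_coeff \<rho> w j * hid_coeff \<rho> w' j\<bar>
          + 128 * (c\<^sup>2 * (\<rho>\<^sup>2 * (1 + inner_on p w w) * (\<rho>\<^sup>2 * (1 + inner_on p w' w'))))) ^ n"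
    unfolding e by (intro power_mono 1(2)) auto
  then show "(\<integral>z. exp (c * hid_cross n p \<rho> w w' z) \<partial>noise_space n p)
          \<le> exp (real n * (\<bar>c\<bar> * (\<rho>\<^sup>2 * \<bar>1 + inner_on p w w'\<bar>)
                + 128 * (c\<^sup>2 * (\<rho>\<^sup>2 * (1 + inner_on p w w) * (\<rho>\<^sup>2 * (1 + inner_on p w' w'))))))"
    by (simp add: hid_coeff_sq exp_of_nat_mult abs_mult)
qed

text \<open>Every overlap of two hidden directions has squared exponent at most this bound, so that all the
  likelihood ratios below are square-integrable.\<close>

definition hid_small :: "nat \<Rightarrow> real \<Rightarrow> nat \<Rightarrow> (nat \<Rightarrow> real) \<Rightarrow> (nat \<Rightarrow> real) \<Rightarrow> bool" where
  "hid_small p \<rho> L w w' \<longleftrightarrow> \<rho> \<noteq> 0 \<and>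
     (real L)\<^sup>2 * (\<rho>\<^sup>2 * (1 + inner_on p w w) * (\<rho>\<^sup>2 * (1 + inner_on p w' w'))) \<le> 1 / 64"

lemma hid_small_mono:
  assumes "hid_small p \<rho> L w w'" "\<bar>c\<bar> \<le> real L"
  shows "c\<^sup>2 * (\<rho>\<^sup>2 * (1 + inner_on p w w) * (\<rho>\<^sup>2 * (1 + inner_on p w' w'))) \<le> 1 / 64"
proof -
  have "0 \<le> inner_on p w w" for w by (auto simp: inner_on_def intro!: sum_nonneg)
  then have "0 \<le> \<rho>\<^sup>2 * (1 + inner_on p w w) * (\<rho>\<^sup>2 * (1 + inner_on p w' w'))" by simp
  moreover have "c\<^sup>2 \<le> (real L)\<^sup>2" using assms(2) by (simp add: abs_le_square_iff[symmetric])
  ultimately have "c\<^sup>2 * (\<rho>\<^sup>2 * (1 + inner_on p w w) * (\<rho>\<^sup>2 * (1 + inner_on p w' w')))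
      \<le> (real L)\<^sup>2 * (\<rho>\<^sup>2 * (1 + inner_on p w w) * (\<rho>\<^sup>2 * (1 + inner_on p w' w')))"
    by (intro mult_right_mono)
  also have "\<dots> \<le> 1 / 64" using assms(1) by (simp only: hid_small_def)
  finally show ?thesis .
qed

lemma overlap_bound:
  assumes ok: "hid_ok p S s w" "hid_ok p S' s' w'" and T: "T \<subseteq> S \<inter> S'" and "card S \<le> L"
  shows "\<bar>\<Sum>l\<in>T. s l * s' l\<bar> \<le> real L"
proof -
  have "\<bar>\<Sum>l\<in>T. s l * s' l\<bar> \<le> (\<Sum>l\<in>T. \<bar>s l * s' l\<bar>)" by (rule sum_abs)
  also have "\<dots> \<le> (\<Sum>l\<in>T. 1)"
  proof (rule sum_mono)
    fix l assume "l \<in> T"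
    then have "\<bar>s l\<bar> \<le> 1" "\<bar>s' l\<bar> \<le> 1" using ok T by (auto simp: hid_ok_def)
    then show "\<bar>s l * s' l\<bar> \<le> 1" by (simp add: abs_mult mult_le_one)
  qed
  also have "\<dots> \<le> real L"
    using card_mono[OF hid_ok_finite[OF ok(1)], of T] T assms(4) by auto
  finally show ?thesis .
qed

lemma Lam_Lam:
  assumes ok: "hid_ok p S s w" "hid_ok p S' s' w'" and ww: "\<forall>j\<in>S. w' j = 0" "\<forall>j\<in>S'. w j = 0"
    and small: "hid_small p \<rho> L w w'" "card S \<le> L" and V: "V \<subseteq> S" "V' \<subseteq> S'"
  shows "integrable (noise_space n p) (\<lambda>z. Lam n p \<rho> s w V z * Lam n p \<rho> s' w' V' z)"
    and "(\<integral>z. Lam n p \<rho> s w V z * Lam n p \<rho> s' w' V' z \<partial>noise_space n p)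
      = (\<integral>z. exp ((\<Sum>l\<in>V \<inter> V'. s l * s' l) * hid_cross n p \<rho> w w' z) \<partial>noise_space n p)"
proof -
  let ?I = "obs_idx p" and ?s = "case_option 0 s" and ?s' = "case_option 0 s'"
  let ?c = "\<Sum>l\<in>V \<inter> V'. s l * s' l"
  have c: "?c\<^sup>2 * (\<rho>\<^sup>2 * (1 + inner_on p w w) * (\<rho>\<^sup>2 * (1 + inner_on p w' w'))) \<le> 1 / 64"
    by (rule hid_small_mono[OF small(1) overlap_bound[OF ok _ small(2)]]) (use V in auto)
  have \<rho>: "\<rho> \<noteq> 0" using small by (simp add: hid_small_def)
  have VI: "Some ` V \<subseteq> ?I" "Some ` V' \<subseteq> ?I" using V ok by (auto simp: hid_ok_def)
  have v: "\<forall>l\<in>Some ` V \<union> Some ` V'. hid_coeff \<rho> w l = 0" "\<forall>l\<in>Some ` V \<union> Some ` V'. hid_coeff \<rho> w' l = 0"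
    using V ok ww by (auto simp: hid_coeff_def hid_ok_def)
  have sum_eq: "(\<Sum>l\<in>Some ` V \<inter> Some ` V'. ?s l * ?s' l) = ?c"
    by (subst image_Int[symmetric], simp, subst sum.reindex) auto
  note tt = tilt_tilt[OF finite_obs_idx VI v, of ?s ?s', unfolded sum_eq]
  have int1: "integrable (std_gauss ?I) (\<lambda>z. tilt ?I (Some ` V) (hid_coeff \<rho> w) ?s z * tilt ?I (Some ` V') (hid_coeff \<rho> w') ?s' z)"
    unfolding tt(2) by (rule exp_hid_cross(4)[OF \<rho> c])
  have eq: "Lam n p \<rho> s w V z * Lam n p \<rho> s' w' V' z
      = (\<Prod>i<n. tilt ?I (Some ` V) (hid_coeff \<rho> w) ?s (z i) * tilt ?I (Some ` V') (hid_coeff \<rho> w') ?s' (z i))" for z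
    by (simp add: Lam_def prod.distrib)
  show "integrable (noise_space n p) (\<lambda>z. Lam n p \<rho> s w V z * Lam n p \<rho> s' w' V' z)"
    unfolding eq by (rule PiM_prod(1)[OF prob_space_std_gauss finite_lessThan int1])
  show "(\<integral>z. Lam n p \<rho> s w V z * Lam n p \<rho> s' w' V' z \<partial>noise_space n p)
      = (\<integral>z. exp (?c * hid_cross n p \<rho> w w' z) \<partial>noise_space n p)"
    unfolding eq PiM_prod(2)[OF prob_space_std_gauss finite_lessThan int1] tt(1) exp_hid_cross(2)[OF \<rho> c] by simp
qed

lemma sq_int_Lam:
  assumes "hid_ok p S s w" "hid_small p \<rho> L w w" "card S \<le> L" "V \<subseteq> S"
  shows "sq_int (noise_space n p) (Lam n p \<rho> s w V)"
  unfolding sq_int_def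
  using Lam_Lam(1)[OF assms(1,1) _ _ assms(2,3,4,4)] measurable_Lam[of V p n \<rho> s w] assms(1,4)
  by (auto simp: power2_eq_square hid_ok_def)

definition cols :: "(nat \<times> nat option) multiset \<Rightarrow> nat set" where
  "cols m = {j. \<exists>i. (i, Some j) \<in># m}"

lemma cols: "finite (cols m)" "card (cols m) \<le> size m"
proof -
  have sub: "cols m \<subseteq> (\<lambda>v. the (snd v)) ` set_mset m" by (force simp: cols_def)
  then show "finite (cols m)" by (rule finite_subset) auto
  have "card (cols m) \<le> card ((\<lambda>v. the (snd v)) ` set_mset m)" by (rule card_mono[OF _ sub]) auto
  also have "\<dots> \<le> card (set_mset m)" by (rule card_image_le) auto
  also have "\<dots> \<le> size m" by (induction m) (auto simp: card_insert_if)
  finally show "card (cols m) \<le> size m" .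
qed

lemma base_Lam:
  assumes ok: "hid_ok p S s w" and V: "V \<subseteq> S" and m: "set_mset m \<subseteq> coord_set n p"
  shows "(\<integral>z. base_monomial a \<sigma>0 m z * Lam n p \<rho> s w V z \<partial>noise_space n p)
    = (\<Prod>i<n. \<integral>z. (\<Prod>b\<in>#part m i. base_obs a \<sigma>0
        (shift (obs_idx p) (Some ` V) (hid_coeff \<rho> w) (case_option 0 s) z) b) \<partial>std_gauss (obs_idx p))"
proof -
  let ?I = "obs_idx p" and ?s = "case_option 0 s"
  let ?t = "tilt ?I (Some ` V) (hid_coeff \<rho> w) ?s" and ?sh = "shift ?I (Some ` V) (hid_coeff \<rho> w) ?s"
  have p: "0 < p" using ok by (simp add: hid_ok_def)
  have VI: "Some ` V \<subseteq> ?I" and v: "\<forall>l\<in>Some ` V. hid_coeff \<rho> w l = 0"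
    using V ok by (auto simp: hid_ok_def hid_coeff_def)
  have m': "set_mset m \<subseteq> {..<n} \<times> ?I" using m by (simp add: coord_set_eq)
  have am: "all_moments (std_gauss ?I) (\<lambda>z. \<Prod>b\<in>#part m i. base_obs a \<sigma>0 z b)" for i
    using set_part[OF m'] p
    by (intro all_moments_prod_mset all_moments_base_obs prob_space.finite_measure prob_space_std_gauss) auto
  have shr: "base_obs a \<sigma>0 (?sh z) b = lin ?I (hid_row a \<sigma>0 \<rho> (\<lambda>j. if j \<in> V then s j else 0) w b) z"
    if "b \<in> ?I" for b z
  proof -
    have s0: "(if 0 \<in> V then s 0 else 0) = 0" using ok V by (auto simp: hid_ok_def)
    have "shift ?I (Some ` V) (hid_coeff \<rho> w) ?s z
        = shift ?I (Some ` V) (hid_coeff \<rho> w) (case_option 0 (\<lambda>j. if j \<in> V then s j else 0)) z"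
      by (auto simp: shift_def fun_eq_iff)
    then show ?thesis
      using base_obs_shift[OF p, of "\<lambda>j. if j \<in> V then s j else 0" b V a \<sigma>0 \<rho> w z] s0 that by (auto split: if_splits)
  qed
  have am_sh: "all_moments (std_gauss ?I) (\<lambda>z. \<Prod>b\<in>#part m i. base_obs a \<sigma>0 (?sh z) b)" for i
  proof -
    have "(\<lambda>z. \<Prod>b\<in>#part m i. base_obs a \<sigma>0 (?sh z) b)
        = (\<lambda>z. \<Prod>b\<in>#part m i. lin ?I (hid_row a \<sigma>0 \<rho> (\<lambda>j. if j \<in> V then s j else 0) w b) z)"
      using set_part[OF m'] by (intro ext arg_cong[where f = prod_mset] image_mset_cong shr) auto
    then show ?thesis using all_moments_prod_lin by simp
  qed
  note tilt_int = tilt_integral[OF finite_obs_idx VI v all_moments_measurable[OF am], of ?s]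
  have int: "integrable (std_gauss ?I) (\<lambda>z. ?t z * (\<Prod>b\<in>#part m i. base_obs a \<sigma>0 z b))" for i
    unfolding tilt_int(2) by (rule all_moments_integrable[OF am_sh])
  have eq: "base_monomial a \<sigma>0 m z * Lam n p \<rho> s w V z
      = (\<Prod>i<n. ?t (z i) * (\<Prod>b\<in>#part m i. base_obs a \<sigma>0 (z i) b))" for z
    using prod_mset_part[OF m', of "\<lambda>i b. base_obs a \<sigma>0 (z i) b"]
    by (simp add: base_monomial_def Lam_def prod.distrib mult.commute)
  have "(\<integral>z. base_monomial a \<sigma>0 m z * Lam n p \<rho> s w V z \<partial>noise_space n p)
      = (\<Prod>i<n. \<integral>z. ?t z * (\<Prod>b\<in>#part m i. base_obs a \<sigma>0 z b) \<partial>std_gauss ?I)"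
    unfolding eq by (rule PiM_prod(2)[OF prob_space_std_gauss finite_lessThan int])
  then show ?thesis unfolding tilt_int(1) .
qed

text \<open>The shift of a column shows only in those factors of the monomial that read this column.
  The response is no exception, since it is built on column 0 and the noise, and neither is
  shifted.\<close>

lemma base_Lam_cols:
  assumes ok: "hid_ok p S s w" and V: "V \<subseteq> S" and m: "set_mset m \<subseteq> coord_set n p"
  shows "(\<integral>z. base_monomial a \<sigma>0 m z * Lam n p \<rho> s w V z \<partial>noise_space n p)
    = (\<integral>z. base_monomial a \<sigma>0 m z * Lam n p \<rho> s w (V \<inter> cols m) z \<partial>noise_space n p)"
proof -
  have V': "V \<inter> cols m \<subseteq> S" using V by auto
  have "base_obs a \<sigma>0 (shift (obs_idx p) (Some ` V) v s' z) b
      = base_obs a \<sigma>0 (shift (obs_idx p) (Some ` (V \<inter> cols m)) v s' z) b"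
    if "b \<in># part m i" for b i v s' z
  proof (cases b)
    case None
    have "0 \<notin> V" using ok V by (auto simp: hid_ok_def)
    then show ?thesis by (auto simp: None base_obs_def shift_def image_iff)
  next
    case (Some j)
    then have "j \<in> cols m" using that by (force simp: part_def cols_def)
    then show ?thesis by (auto simp: Some base_obs_def shift_def image_iff)
  qed
  then show ?thesis
    unfolding base_Lam[OF ok V m] base_Lam[OF ok V' m]
    by (intro prod.cong refl Bochner_Integration.integral_cong arg_cong[where f = prod_mset] image_mset_cong) auto
qed

text \<open>Valid in every degree, so that it also applies to products of two monomials when second
  moments under the point prior are computed.\<close>

lemma data_moments:
  assumes ok: "hid_ok p S s w" and N: "(\<Sum>j<p. (s j)\<^sup>2) = N" and "\<sigma>0 > 0" and m: "set_mset m \<subseteq> coord_set n p"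
  shows "(\<integral>z. (\<Prod>v\<in>#m. coord z v) \<partial>data_law n p (hid_param p a \<sigma>0 \<rho> N s w))
    = (\<integral>z. base_monomial a \<sigma>0 m z * Lam n p \<rho> s w S z \<partial>noise_space n p)"
proof -
  let ?\<theta> = "hid_param p a \<sigma>0 \<rho> N s w"
  have m': "set_mset m \<subseteq> {..<n} \<times> obs_idx p" using m by (simp add: coord_set_eq)
  have N0: "0 \<le> N" unfolding N[symmetric] by (intro sum_nonneg) auto
  note \<sigma> = hid_param_noise_pos[OF \<open>\<sigma>0 > 0\<close> N0, of p a \<rho> s w]
  have am: "all_moments (obs_law p ?\<theta>) (\<lambda>x. \<Prod>b\<in>#part m i. obs_coord x b)" for i
    using set_part[OF m'] \<sigma>
    by (intro all_moments_prod_mset all_moments_obs_coord prob_space.finite_measure prob_space_obs_law) auto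
  have p: "0 < p" and s0: "s 0 = 0" and sw: "s j * w j = 0" and S: "s j \<noteq> 0 \<Longrightarrow> j \<in> S" for j
    using ok by (auto simp: hid_ok_def)
  have "(\<integral>z. (\<Prod>v\<in>#m. coord z v) \<partial>data_law n p ?\<theta>)
      = (\<integral>z. (\<Prod>i<n. \<Prod>b\<in>#part m i. obs_coord (z i) b) \<partial>data_law n p ?\<theta>)"
    unfolding coord_eq prod_mset_part[OF m', of "\<lambda>i b. obs_coord (_ i) b"] ..
  also have "\<dots> = (\<Prod>i<n. \<integral>x. (\<Prod>b\<in>#part m i. obs_coord x b) \<partial>obs_law p ?\<theta>)"
    unfolding data_law_def
    by (rule PiM_prod(2)[OF prob_space_obs_law[OF \<sigma>] finite_lessThan all_moments_integrable[OF am]])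
  also have "\<dots> = (\<integral>z. base_monomial a \<sigma>0 m z * Lam n p \<rho> s w S z \<partial>noise_space n p)"
    unfolding base_Lam[OF ok subset_refl m]
    by (intro prod.cong refl hid_moments p s0 sw N S set_part[OF m'] \<open>\<sigma>0 > 0\<close>)
  finally show ?thesis .
qed

subsection \<open>Truncated likelihood ratios\<close>

text \<open>A polynomial of degree \<open>D\<close> sees at most \<open>D\<close> columns of the design, so only the part of the
  likelihood ratio that depends on at most \<open>D\<close> of the columns in \<open>S\<close> matters.\<close>

definition Gfun :: "nat \<Rightarrow> nat \<Rightarrow> real \<Rightarrow> nat \<Rightarrow> nat set \<Rightarrow> (nat \<Rightarrow> real) \<Rightarrow> (nat \<Rightarrow> real) \<Rightarrow> (nat \<Rightarrow> nat option \<Rightarrow> real) \<Rightarrow> real" where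
  "Gfun n p \<rho> D S s w z = (\<Sum>U\<in>small S D. mob (\<lambda>V. Lam n p \<rho> s w V z) U)"

lemma integral_mob:
  assumes "\<And>V. V \<subseteq> U \<Longrightarrow> integrable M (f V)"
  shows "integrable M (\<lambda>z. mob (\<lambda>V. f V z) U)"
    and "(\<integral>z. mob (\<lambda>V. f V z) U \<partial>M) = mob (\<lambda>V. \<integral>z. f V z \<partial>M) U"
  unfolding mob_def using assms
  by (auto intro!: Bochner_Integration.integral_sum)

lemma mult_mob: "c * mob e U = mob (\<lambda>V. c * e V) U"
  by (simp add: mob_def sum_distrib_left mult_ac)

lemma mob_mult: "mob e U * c = mob (\<lambda>V. e V * c) U"
  by (simp only: mob_def sum_distrib_right mult.assoc)

lemma small_subset: "U \<in> small S D \<Longrightarrow> U \<subseteq> S"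
  by (simp add: small_def)

lemma sq_int_Gfun:
  assumes "hid_ok p S s w" "hid_small p \<rho> L w w" "card S \<le> L"
  shows "sq_int (noise_space n p) (Gfun n p \<rho> D S s w)"
  unfolding Gfun_def[abs_def] mob_def
  using small_subset by (intro sq_int_sum sq_int_scale sq_int_Lam[OF assms]) blast

text \<open>Against a fixed monomial the ratio of \<open>V\<close> counts only through
  \<open>V \<inter> cols m\<close>, a set of at most D columns, and \<open>sum_small_mob\<close>
  says that the truncation is then invisible.\<close>

lemma base_Gfun:
  assumes ok: "hid_ok p S s w" and small: "hid_small p \<rho> L w w" "card S \<le> L" and N: "(\<Sum>j<p. (s j)\<^sup>2) = N"
    and "\<sigma>0 > 0" and m: "set_mset m \<subseteq> coord_set n p" "size m \<le> D"
  shows "(\<integral>z. base_monomial a \<sigma>0 m z * Gfun n p \<rho> D S s w z \<partial>noise_space n p)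
    = (\<integral>z. (\<Prod>v\<in>#m. coord z v) \<partial>data_law n p (hid_param p a \<sigma>0 \<rho> N s w))"
proof -
  have p: "0 < p" using ok by (simp add: hid_ok_def)
  have fin: "finite S" by (rule hid_ok_finite[OF ok])
  have int: "integrable (noise_space n p) (\<lambda>z. base_monomial a \<sigma>0 m z * Lam n p \<rho> s w V z)" if "V \<subseteq> S" for V
    by (rule sq_int_mult[OF sq_int_all_moments[OF all_moments_base_monomial[OF p m(1)]] sq_int_Lam[OF ok small that]])
  let ?e = "\<lambda>V. \<integral>z. base_monomial a \<sigma>0 m z * Lam n p \<rho> s w V z \<partial>noise_space n p"
  have U: "integrable (noise_space n p) (\<lambda>z. mob (\<lambda>V. base_monomial a \<sigma>0 m z * Lam n p \<rho> s w V z) U)"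
    "(\<integral>z. mob (\<lambda>V. base_monomial a \<sigma>0 m z * Lam n p \<rho> s w V z) U \<partial>noise_space n p) = mob ?e U"
    if "U \<in> small S D" for U
    using integral_mob[of U "noise_space n p" "\<lambda>V z. base_monomial a \<sigma>0 m z * Lam n p \<rho> s w V z"]
      int small_subset[OF that] by auto
  have "(\<integral>z. base_monomial a \<sigma>0 m z * Gfun n p \<rho> D S s w z \<partial>noise_space n p) = (\<Sum>U\<in>small S D. mob ?e U)"
    unfolding Gfun_def sum_distrib_left mult_mob
    by (subst Bochner_Integration.integral_sum) (auto simp: U)
  also have "\<dots> = ?e S"
    by (rule sum_small_mob[OF fin cols(1)[of m]]) (use cols(2)[of m] m base_Lam_cols[OF ok _ m(1)] in auto)
  also have "\<dots> = (\<integral>z. (\<Prod>v\<in>#m. coord z v) \<partial>data_law n p (hid_param p a \<sigma>0 \<rho> N s w))"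
    by (rule data_moments[OF ok N \<open>\<sigma>0 > 0\<close> m(1), symmetric])
  finally show ?thesis .
qed

lemma small_Int: "small S D \<inter> small S' D = small (S \<inter> S') D"
  by (auto simp: small_def)

text \<open>Both truncations are expanded. The second moment for V and V' is the integral of a
  product over \<open>V \<inter> V'\<close>, so the two Moebius transforms, exchanged with the
  integral, leave only the diagonal terms U = U'.\<close>

lemma Gfun_Gfun:
  assumes ok: "hid_ok p S s w" "hid_ok p S' s' w'" and ww: "\<forall>j\<in>S. w' j = 0" "\<forall>j\<in>S'. w j = 0"
    and small: "hid_small p \<rho> L w w'" "card S \<le> L"
  shows "integrable (noise_space n p) (\<lambda>z. \<Sum>U\<in>small (S \<inter> S') D. \<Prod>l\<in>U. exp (s l * s' l * hid_cross n p \<rho> w w' z) - 1)"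
    and "(\<integral>z. Gfun n p \<rho> D S s w z * Gfun n p \<rho> D S' s' w' z \<partial>noise_space n p)
      = (\<integral>z. (\<Sum>U\<in>small (S \<inter> S') D. \<Prod>l\<in>U. exp (s l * s' l * hid_cross n p \<rho> w w' z) - 1) \<partial>noise_space n p)"
proof -
  let ?M = "noise_space n p" and ?X = "hid_cross n p \<rho> w w'"
  let ?L = "\<lambda>V V' z. Lam n p \<rho> s w V z * Lam n p \<rho> s' w' V' z"
  let ?E = "\<lambda>V V' z. \<Prod>l\<in>V \<inter> V'. exp (s l * s' l * ?X z)"
  have fin: "finite S" "finite S'" by (rule hid_ok_finite[OF ok(1)], rule hid_ok_finite[OF ok(2)])
  note LL = Lam_Lam[OF ok ww small, of _ _ n]
  have E: "integrable ?M (?E V V')" "(\<integral>z. ?L V V' z \<partial>?M) = (\<integral>z. ?E V V' z \<partial>?M)"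
    if "V \<subseteq> S" "V' \<subseteq> S'" for V V'
  proof -
    have eq: "?E V V' z = exp ((\<Sum>l\<in>V \<inter> V'. s l * s' l) * ?X z)" for z
    proof -
      have "finite (V \<inter> V')" using that fin finite_subset by blast
      then show ?thesis by (simp add: exp_sum sum_distrib_right)
    qed
    have c: "(\<Sum>l\<in>V \<inter> V'. s l * s' l)\<^sup>2 * (\<rho>\<^sup>2 * (1 + inner_on p w w) * (\<rho>\<^sup>2 * (1 + inner_on p w' w'))) \<le> 1 / 64"
      by (rule hid_small_mono[OF small(1) overlap_bound[OF ok _ small(2)]]) (use that in auto)
    have "\<rho> \<noteq> 0" using small by (simp add: hid_small_def)
    from exp_hid_cross(1)[OF this c] show "integrable ?M (?E V V')" unfolding eq .
    show "(\<integral>z. ?L V V' z \<partial>?M) = (\<integral>z. ?E V V' z \<partial>?M)" unfolding eq by (rule LL(2)[OF that])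
  qed
  have int: "integrable ?M (\<lambda>z. mob (\<lambda>V. mob (\<lambda>V'. f V V' z) U') U)"
    "(\<integral>z. mob (\<lambda>V. mob (\<lambda>V'. f V V' z) U') U \<partial>?M) = mob (\<lambda>V. mob (\<lambda>V'. \<integral>z. f V V' z \<partial>?M) U') U"
    if "U \<in> small S D" "U' \<in> small S' D" and f: "\<And>V V'. V \<subseteq> S \<Longrightarrow> V' \<subseteq> S' \<Longrightarrow> integrable ?M (f V V')" for U U' f
  proof -
    have U: "U \<subseteq> S" "U' \<subseteq> S'" using small_subset[OF that(1)] small_subset[OF that(2)] .
    have 1: "integrable ?M (\<lambda>z. mob (\<lambda>V'. f V V' z) U')"
      "(\<integral>z. mob (\<lambda>V'. f V V' z) U' \<partial>?M) = mob (\<lambda>V'. \<integral>z. f V V' z \<partial>?M) U'" if "V \<subseteq> U" for V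
      using integral_mob[of U' ?M "f V"] f that U by (meson order_trans)+
    show "integrable ?M (\<lambda>z. mob (\<lambda>V. mob (\<lambda>V'. f V V' z) U') U)"
      by (rule integral_mob(1)) (rule 1(1))
    have "(\<integral>z. mob (\<lambda>V. mob (\<lambda>V'. f V V' z) U') U \<partial>?M) = mob (\<lambda>V. \<integral>z. mob (\<lambda>V'. f V V' z) U' \<partial>?M) U"
      by (rule integral_mob(2)) (rule 1(1))
    also have "\<dots> = mob (\<lambda>V. mob (\<lambda>V'. \<integral>z. f V V' z \<partial>?M) U') U"
      by (rule mob_cong) (rule 1(2))
    finally show "(\<integral>z. mob (\<lambda>V. mob (\<lambda>V'. f V V' z) U') U \<partial>?M) = mob (\<lambda>V. mob (\<lambda>V'. \<integral>z. f V V' z \<partial>?M) U') U" .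
  qed
  have GG: "Gfun n p \<rho> D S s w z * Gfun n p \<rho> D S' s' w' z
      = (\<Sum>U\<in>small S D. \<Sum>U'\<in>small S' D. mob (\<lambda>V. mob (\<lambda>V'. ?L V V' z) U') U)" for z
  proof -
    have "mob (\<lambda>V. Lam n p \<rho> s w V z) U * mob (\<lambda>V'. Lam n p \<rho> s' w' V' z) U'
        = mob (\<lambda>V. mob (\<lambda>V'. ?L V V' z) U') U" for U U'
      unfolding mob_mult unfolding mult_mob ..
    then show ?thesis by (simp add: Gfun_def sum_product)
  qed
  have EE: "(\<Sum>U\<in>small S D. \<Sum>U'\<in>small S' D. mob (\<lambda>V. mob (\<lambda>V'. ?E V V' z) U') U)
      = (\<Sum>U\<in>small (S \<inter> S') D. \<Prod>l\<in>U. exp (s l * s' l * ?X z) - 1)" for z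
  proof -
    have "(\<Sum>U\<in>small S D. \<Sum>U'\<in>small S' D. mob (\<lambda>V. mob (\<lambda>V'. ?E V V' z) U') U)
        = (\<Sum>U\<in>small S D. \<Sum>U'\<in>small S' D. if U = U' then \<Prod>l\<in>U. exp (s l * s' l * ?X z) - 1 else 0)"
    proof (intro sum.cong refl mob_mob_prod)
      fix U U' assume "U \<in> small S D" "U' \<in> small S' D"
      then show "finite U" "finite U'" using small_subset fin finite_subset by metis+
    qed
    also have "\<dots> = (\<Sum>U\<in>small S D. if U \<in> small S' D then \<Prod>l\<in>U. exp (s l * s' l * ?X z) - 1 else 0)"
      by (intro sum.cong refl) (simp add: finite_small[OF fin(2)])
    also have "\<dots> = (\<Sum>U\<in>small S D \<inter> small S' D. \<Prod>l\<in>U. exp (s l * s' l * ?X z) - 1)"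
      by (rule sum.inter_restrict[OF finite_small[OF fin(1)], symmetric])
    finally show ?thesis by (simp only: small_Int)
  qed
  have "integrable ?M (\<lambda>z. \<Sum>U\<in>small S D. \<Sum>U'\<in>small S' D. mob (\<lambda>V. mob (\<lambda>V'. ?E V V' z) U') U)"
    by (intro Bochner_Integration.integrable_sum int(1) E(1))
  then show "integrable ?M (\<lambda>z. \<Sum>U\<in>small (S \<inter> S') D. \<Prod>l\<in>U. exp (s l * s' l * ?X z) - 1)"
    unfolding EE .
  have "(\<integral>z. Gfun n p \<rho> D S s w z * Gfun n p \<rho> D S' s' w' z \<partial>?M)
      = (\<Sum>U\<in>small S D. \<Sum>U'\<in>small S' D. \<integral>z. mob (\<lambda>V. mob (\<lambda>V'. ?L V V' z) U') U \<partial>?M)"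
    unfolding GG
    by (subst Bochner_Integration.integral_sum, intro Bochner_Integration.integrable_sum int(1) LL(1), assumption+,
        intro sum.cong refl, subst Bochner_Integration.integral_sum, intro int(1) LL(1), assumption+, rule refl)
  \<comment> \<open>The integrands before and after differ pointwise; only their integrals agree for
    each pair V, V', which the finite alternating sums preserve.\<close>
  also have "\<dots> = (\<Sum>U\<in>small S D. \<Sum>U'\<in>small S' D. \<integral>z. mob (\<lambda>V. mob (\<lambda>V'. ?E V V' z) U') U \<partial>?M)"
  proof (intro sum.cong refl)
    fix U U' assume U: "U \<in> small S D" "U' \<in> small S' D"
    have "(\<integral>z. mob (\<lambda>V. mob (\<lambda>V'. ?L V V' z) U') U \<partial>?M) = mob (\<lambda>V. mob (\<lambda>V'. \<integral>z. ?L V V' z \<partial>?M) U') U"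
      by (rule int(2)[OF U]) (rule LL(1))
    moreover have "(\<integral>z. mob (\<lambda>V. mob (\<lambda>V'. ?E V V' z) U') U \<partial>?M) = mob (\<lambda>V. mob (\<lambda>V'. \<integral>z. ?E V V' z \<partial>?M) U') U"
      by (rule int(2)[OF U]) (rule E(1))
    moreover have "mob (\<lambda>V. mob (\<lambda>V'. \<integral>z. ?L V V' z \<partial>?M) U') U = mob (\<lambda>V. mob (\<lambda>V'. \<integral>z. ?E V V' z \<partial>?M) U') U"
    proof (intro mob_cong E(2))
      fix V V' assume "V \<subseteq> U" "V' \<subseteq> U'"
      then show "V \<subseteq> S" "V' \<subseteq> S'" using small_subset U by blast+
    qed
    ultimately show "(\<integral>z. mob (\<lambda>V. mob (\<lambda>V'. ?L V V' z) U') U \<partial>?M) = (\<integral>z. mob (\<lambda>V. mob (\<lambda>V'. ?E V V' z) U') U \<partial>?M)"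
      by simp
  qed
  also have "\<dots> = (\<integral>z. (\<Sum>U\<in>small S D. \<Sum>U'\<in>small S' D. mob (\<lambda>V. mob (\<lambda>V'. ?E V V' z) U') U) \<partial>?M)"
    by (subst Bochner_Integration.integral_sum, intro Bochner_Integration.integrable_sum int(1) E(1), assumption+,
        intro sum.cong refl, subst Bochner_Integration.integral_sum, intro int(1) E(1), assumption+, rule refl)
  finally show "(\<integral>z. Gfun n p \<rho> D S s w z * Gfun n p \<rho> D S' s' w' z \<partial>?M)
      = (\<integral>z. (\<Sum>U\<in>small (S \<inter> S') D. \<Prod>l\<in>U. exp (s l * s' l * ?X z) - 1) \<partial>?M)"
    unfolding EE .
qed

lemma Gfun_disjoint:
  assumes ok: "hid_ok p S s w" "hid_ok p S' s' w'" and ww: "\<forall>j\<in>S. w' j = 0" "\<forall>j\<in>S'. w j = 0"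
    and small: "hid_small p \<rho> L w w'" "card S \<le> L" and "S \<inter> S' = {}"
  shows "(\<integral>z. Gfun n p \<rho> D S s w z * Gfun n p \<rho> D S' s' w' z \<partial>noise_space n p) = 1"
proof -
  have *: "small {} D = {{}}" by (auto simp: small_def)
  show ?thesis
    unfolding Gfun_Gfun(2)[OF ok ww small] assms(7) * by (simp add: prob_space.prob_space[OF prob_space_noise])
qed

text \<open>There are at most \<open>2 ^ card T\<close> sets, and each product has at most
  \<open>min (card T) D\<close> factors of modulus below \<open>exp x\<close>. The gain from
  truncation is this minimum.\<close>

lemma small_sum_le:
  assumes "finite T" "0 \<le> x" "\<And>l. l \<in> T \<Longrightarrow> \<bar>E l - 1\<bar> \<le> exp x - 1"
  shows "(\<Sum>U\<in>small T D. \<Prod>l\<in>U. E l - 1) \<le> 2 ^ card T * exp (real (min (card T) D) * x)"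
proof -
  have "(\<Sum>U\<in>small T D. \<Prod>l\<in>U. E l - 1) \<le> (\<Sum>U\<in>small T D. exp (real (min (card T) D) * x))"
  proof (rule sum_mono)
    fix U assume U: "U \<in> small T D"
    then have sub: "U \<subseteq> T" and D: "card U \<le> D" by (auto simp: small_def)
    have "(\<Prod>l\<in>U. E l - 1) \<le> \<bar>\<Prod>l\<in>U. E l - 1\<bar>" by simp
    also have "\<dots> = (\<Prod>l\<in>U. \<bar>E l - 1\<bar>)" by (rule abs_prod)
    also have "\<dots> \<le> (\<Prod>l\<in>U. exp x)"
    proof (intro prod_mono conjI)
      fix l assume "l \<in> U"
      then have "\<bar>E l - 1\<bar> \<le> exp x - 1" using assms(3) sub by blast
      then show "\<bar>E l - 1\<bar> \<le> exp x" by linarith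
    qed simp
    also have "\<dots> = exp (real (card U) * x)" by (simp add: exp_of_nat_mult)
    also have "\<dots> \<le> exp (real (min (card T) D) * x)"
      using D card_mono[OF assms(1) sub] assms(2) by (auto intro!: mult_right_mono)
    finally show "(\<Prod>l\<in>U. E l - 1) \<le> exp (real (min (card T) D) * x)" .
  qed
  also have "\<dots> = real (card (small T D)) * exp (real (min (card T) D) * x)" by simp
  also have "\<dots> \<le> 2 ^ card T * exp (real (min (card T) D) * x)"
  proof (rule mult_right_mono)
    have "card (small T D) \<le> card (Pow T)"
      using assms(1) by (intro card_mono) (auto simp: small_def)
    then show "real (card (small T D)) \<le> 2 ^ card T" using assms(1) by (simp add: card_Pow)
  qed simp
  finally show ?thesis .
qed

lemma Gfun_bound:
  fixes D
  assumes ok: "hid_ok p S s w" "hid_ok p S' s' w'" and ww: "\<forall>j\<in>S. w' j = 0" "\<forall>j\<in>S'. w j = 0"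
    and small: "hid_small p \<rho> L w w'" "card S \<le> L"
  defines "m \<equiv> real (min (card (S \<inter> S')) D)"
  shows "(\<integral>z. Gfun n p \<rho> D S s w z * Gfun n p \<rho> D S' s' w' z \<partial>noise_space n p)
    \<le> 2 ^ card (S \<inter> S') * (2 * exp (real n * (m * (\<rho>\<^sup>2 * \<bar>1 + inner_on p w w'\<bar>)
          + 128 * (m\<^sup>2 * (\<rho>\<^sup>2 * (1 + inner_on p w w) * (\<rho>\<^sup>2 * (1 + inner_on p w' w')))))))"
proof -
  let ?M = "noise_space n p" and ?X = "hid_cross n p \<rho> w w'"
  have fin: "finite S" by (rule hid_ok_finite[OF ok(1)])
  have m: "\<bar>m\<bar> \<le> real L" "\<bar>- m\<bar> \<le> real L" "0 \<le> m"
    using card_mono[OF fin, of "S \<inter> S'"] small(2) by (auto simp: m_def)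
  have \<rho>: "\<rho> \<noteq> 0" using small by (simp add: hid_small_def)
  note e1 = exp_hid_cross(1,3)[OF \<rho> hid_small_mono[OF small(1) m(1)], where n = n]
  note e2 = exp_hid_cross(1,3)[OF \<rho> hid_small_mono[OF small(1) m(2)], where n = n]
  have "(\<Sum>U\<in>small (S \<inter> S') D. \<Prod>l\<in>U. exp (s l * s' l * ?X z) - 1)
      \<le> 2 ^ card (S \<inter> S') * (exp (m * ?X z) + exp (- m * ?X z))" for z
  proof -
    have "(\<Sum>U\<in>small (S \<inter> S') D. \<Prod>l\<in>U. exp (s l * s' l * ?X z) - 1)
        \<le> 2 ^ card (S \<inter> S') * exp (m * \<bar>?X z\<bar>)"
      unfolding m_def
    proof (rule small_sum_le)
      fix l assume l: "l \<in> S \<inter> S'"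
      then have "\<bar>s l\<bar> \<le> 1" "\<bar>s' l\<bar> \<le> 1" using ok by (auto simp: hid_ok_def)
      then have "\<bar>s l * s' l\<bar> \<le> 1" by (simp add: abs_mult mult_le_one)
      then have "\<bar>s l * s' l\<bar> * \<bar>?X z\<bar> \<le> 1 * \<bar>?X z\<bar>" by (intro mult_right_mono) auto
      then have y: "\<bar>s l * s' l * ?X z\<bar> \<le> \<bar>?X z\<bar>" by (simp add: abs_mult)
      have "\<bar>exp y - 1\<bar> \<le> exp \<bar>y\<bar> - 1" for y :: real
      proof (cases "0 \<le> y")
        case False
        have "1 - exp y \<le> - y" using exp_ge_add_one_self[of y] by linarith
        also have "- y \<le> exp (- y) - 1" using exp_ge_add_one_self[of "- y"] by linarith
        finally show ?thesis using False by simp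
      qed simp
      from this[of "s l * s' l * ?X z"] y show "\<bar>exp (s l * s' l * ?X z) - 1\<bar> \<le> exp \<bar>?X z\<bar> - 1"
        using order_trans[of "\<bar>exp (s l * s' l * ?X z) - 1\<bar>"] by fastforce
    qed (use fin in auto)
    \<comment> \<open>Keeping both signs replaces the modulus in the exponent by two exponential
      moments that \<open>exp_hid_cross\<close> controls.\<close>
    also have "\<dots> \<le> 2 ^ card (S \<inter> S') * (exp (m * ?X z) + exp (- m * ?X z))"
      by (intro mult_left_mono) (auto simp: abs_if)
    finally show ?thesis .
  qed
  then have "(\<integral>z. Gfun n p \<rho> D S s w z * Gfun n p \<rho> D S' s' w' z \<partial>?M)
      \<le> (\<integral>z. 2 ^ card (S \<inter> S') * (exp (m * ?X z) + exp (- m * ?X z)) \<partial>?M)"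
    unfolding Gfun_Gfun(2)[OF ok ww small]
    by (intro integral_mono Gfun_Gfun(1)[OF ok ww small] integrable_mult_right Bochner_Integration.integrable_add e1(1) e2(1))
  also have "\<dots> = 2 ^ card (S \<inter> S') * ((\<integral>z. exp (m * ?X z) \<partial>?M) + (\<integral>z. exp (- m * ?X z) \<partial>?M))"
    using e1(1) e2(1) by (simp only: integral_mult_right_zero Bochner_Integration.integral_add)
  also have "\<dots> \<le> 2 ^ card (S \<inter> S') * (2 * exp (real n * (m * (\<rho>\<^sup>2 * \<bar>1 + inner_on p w w'\<bar>)
          + 128 * (m\<^sup>2 * (\<rho>\<^sup>2 * (1 + inner_on p w w) * (\<rho>\<^sup>2 * (1 + inner_on p w' w')))))))"
    using add_mono[OF e1(2) e2(2)] m(3) by (intro mult_left_mono) auto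
  finally show ?thesis .
qed

subsection \<open>Finite mixtures\<close>

lemma sets_data_law: "sets (data_law n p \<theta>) = sets (data_algebra n p)"
  unfolding data_law_def data_algebra_def obs_algebra_def[symmetric]
  by (intro sets_PiM_cong refl sets_obs_law)

lemma singleton_param:
  assumes "\<theta> \<in> space (param_algebra p)"
  shows "{\<theta>} \<in> sets (param_algebra p)"
proof -
  obtain \<beta> S \<sigma> where \<theta>: "\<theta> = (\<beta>, S, \<sigma>)" by (cases \<theta>) auto
  have sp: "\<beta> \<in> {..<p} \<rightarrow>\<^sub>E UNIV" "S \<in> {..<p} \<times> {..<p} \<rightarrow>\<^sub>E UNIV"
    using assms by (auto simp: \<theta> param_algebra_def space_pair_measure space_PiM)
  have "PiE {..<p} (\<lambda>j. {\<beta> j}) = {\<beta>}" "PiE ({..<p} \<times> {..<p}) (\<lambda>j. {S j}) = {S}"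
    using sp by (intro PiE_singleton; simp add: PiE_def)+
  then have 1: "{\<beta>} \<in> sets (\<Pi>\<^sub>M j\<in>{..<p}. (borel :: real measure))"
    and 2: "{S} \<in> sets (\<Pi>\<^sub>M ij\<in>{..<p} \<times> {..<p}. (borel :: real measure))"
    using sets_PiM_I_finite[of "{..<p}" "\<lambda>j. {\<beta> j}" "\<lambda>_. borel"]
      sets_PiM_I_finite[of "{..<p} \<times> {..<p}" "\<lambda>j. {S j}" "\<lambda>_. borel"] by auto
  have "{\<beta>} \<times> ({S} \<times> {\<sigma>}) \<in> sets (param_algebra p)"
    unfolding param_algebra_def by (intro pair_measureI 1 2) auto
  then show ?thesis by (simp add: \<theta>)
qed

text \<open>The weights sit on indices rather than on parameters, so different indices may carry the
  same parameter.\<close>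

definition finite_prior :: "nat \<Rightarrow> 'k set \<Rightarrow> ('k \<Rightarrow> real) \<Rightarrow> ('k \<Rightarrow> param) \<Rightarrow> param measure" where
  "finite_prior p I wt \<theta> = distr (point_measure I (\<lambda>k. ennreal (wt k))) (param_algebra p) \<theta>"

definition weights :: "'k set \<Rightarrow> ('k \<Rightarrow> real) \<Rightarrow> bool" where
  "weights I wt \<longleftrightarrow> finite I \<and> (\<forall>k\<in>I. 0 \<le> wt k) \<and> (\<Sum>k\<in>I. wt k) = 1"

lemma prob_space_point_measure:
  assumes "weights I wt"
  shows "prob_space (point_measure I (\<lambda>k. ennreal (wt k)))"
proof (rule prob_spaceI)
  have "emeasure (point_measure I (\<lambda>k. ennreal (wt k))) I = (\<Sum>k\<in>I. ennreal (wt k))"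
    using assms by (intro emeasure_point_measure_finite) (auto simp: weights_def)
  also have "\<dots> = ennreal (\<Sum>k\<in>I. wt k)" using assms by (intro sum_ennreal) (auto simp: weights_def)
  finally show "emeasure (point_measure I (\<lambda>k. ennreal (wt k))) (space (point_measure I (\<lambda>k. ennreal (wt k)))) = 1"
    using assms by (simp add: space_point_measure weights_def)
qed

lemma prior_on_finite_prior:
  assumes w: "weights I wt" and sp: "\<forall>k\<in>I. \<theta> k \<in> space (param_algebra p)" and T: "\<forall>k\<in>I. \<theta> k \<in> T"
  shows "prior_on p T (finite_prior p I wt \<theta>)"
  unfolding prior_on_def finite_prior_def
proof (intro conjI)
  interpret P: prob_space "point_measure I (\<lambda>k. ennreal (wt k))" by (rule prob_space_point_measure[OF w])
  have m: "\<theta> \<in> measurable (point_measure I (\<lambda>k. ennreal (wt k))) (param_algebra p)"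
    using sp by (auto simp: measurable_def space_point_measure sets_point_measure)
  show "prob_space (distr (point_measure I (\<lambda>k. ennreal (wt k))) (param_algebra p) \<theta>)"
    by (rule P.prob_space_distr[OF m])
  have fin: "finite (\<theta> ` I)" using w by (simp add: weights_def)
  have sets: "\<theta> ` I \<in> sets (param_algebra p)"
  proof -
    have "(\<Union>t\<in>\<theta> ` I. {t}) \<in> sets (param_algebra p)"
      using sp by (intro sets.finite_UN[OF fin] singleton_param) auto
    then show ?thesis by simp
  qed
  have "AE x in distr (point_measure I (\<lambda>k. ennreal (wt k))) (param_algebra p) \<theta>. x \<in> \<theta> ` I"
  proof (subst AE_distr_iff[OF m])
    show "{x \<in> space (param_algebra p). x \<in> \<theta> ` I} \<in> sets (param_algebra p)"
      using sets sets.sets_into_space[OF sets] by (simp add: Collect_conj_eq Int_absorb1)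
    show "AE x in point_measure I (\<lambda>k. ennreal (wt k)). \<theta> x \<in> \<theta> ` I"
      by (rule AE_I2) (simp add: space_point_measure)
  qed
  then show "AE x in distr (point_measure I (\<lambda>k. ennreal (wt k))) (param_algebra p) \<theta>. x \<in> T"
    by eventually_elim (use T in auto)
qed simp

text \<open>On the finite support an arbitrary \<open>h\<close> agrees with the measurable function
  \<open>h'\<close>. This allows integrands such as the probability of an event under
  \<open>data_law\<close>, which depends on the parameter through a root picked by choice.\<close>

lemma nn_integral_finite_prior:
  assumes w: "weights I wt" and sp: "\<forall>k\<in>I. \<theta> k \<in> space (param_algebra p)"
  shows "(\<integral>\<^sup>+x. h x \<partial>finite_prior p I wt \<theta>) = (\<Sum>k\<in>I. ennreal (wt k) * h (\<theta> k))"
proof -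
  define h' where "h' x = (\<Sum>t\<in>\<theta> ` I. h t * indicator {t} x)" for x
  have fin: "finite (\<theta> ` I)" using w by (simp add: weights_def)
  have h': "h' x = h x" if "x \<in> \<theta> ` I" for x
  proof -
    have "h' x = (\<Sum>t\<in>\<theta> ` I. if t = x then h t else 0)"
      unfolding h'_def by (intro sum.cong) (auto simp: indicator_def)
    then show ?thesis using that fin by simp
  qed
  have m: "\<theta> \<in> measurable (point_measure I (\<lambda>k. ennreal (wt k))) (param_algebra p)"
    using sp by (auto simp: measurable_def space_point_measure sets_point_measure)
  have hm: "h' \<in> borel_measurable (param_algebra p)"
    unfolding h'_def using sp
    by (intro borel_measurable_sum borel_measurable_times_ennreal borel_measurable_const borel_measurable_indicator singleton_param) auto
  have "prior_on p (\<theta> ` I) (finite_prior p I wt \<theta>)"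
    by (rule prior_on_finite_prior[OF w sp]) auto
  then have "AE x in finite_prior p I wt \<theta>. x \<in> \<theta> ` I" by (simp add: prior_on_def)
  then have "AE x in finite_prior p I wt \<theta>. h x = h' x" by eventually_elim (simp add: h')
  then have "(\<integral>\<^sup>+x. h x \<partial>finite_prior p I wt \<theta>) = (\<integral>\<^sup>+x. h' x \<partial>finite_prior p I wt \<theta>)"
    by (rule nn_integral_cong_AE)
  also have "\<dots> = (\<integral>\<^sup>+k. h' (\<theta> k) \<partial>point_measure I (\<lambda>k. ennreal (wt k)))"
    unfolding finite_prior_def by (rule nn_integral_distr[OF m]) (simp add: hm)
  also have "\<dots> = (\<Sum>k\<in>I. ennreal (wt k) * h' (\<theta> k))"
    using w by (subst nn_integral_point_measure_finite) (auto simp: weights_def mult.commute)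
  also have "\<dots> = (\<Sum>k\<in>I. ennreal (wt k) * h (\<theta> k))"
    by (intro sum.cong) (simp_all add: h')
  finally show ?thesis .
qed

text \<open>As a monadic bind the mixture is visibly a measure, and integrals against it become
  iterated integrals.\<close>

lemma mixture_finite_prior:
  assumes w: "weights I wt" and sp: "\<forall>k\<in>I. \<theta> k \<in> space (param_algebra p)"
    and pos: "\<forall>k\<in>I. snd (snd (\<theta> k)) > 0"
  shows "mixture n p (finite_prior p I wt \<theta>)
    = point_measure I (\<lambda>k. ennreal (wt k)) \<bind> (\<lambda>k. data_law n p (\<theta> k))" (is "_ = ?B")
    and "(\<lambda>k. data_law n p (\<theta> k)) \<in> measurable (point_measure I (\<lambda>k. ennreal (wt k))) (subprob_algebra (data_algebra n p))"
proof -
  let ?P = "point_measure I (\<lambda>k. ennreal (wt k))"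
  interpret P: prob_space ?P by (rule prob_space_point_measure[OF w])
  show m: "(\<lambda>k. data_law n p (\<theta> k)) \<in> measurable ?P (subprob_algebra (data_algebra n p))"
  proof -
    have "data_law n p (\<theta> k) \<in> space (subprob_algebra (data_algebra n p))" if "k \<in> I" for k
      using prob_space_data_law[OF pos[rule_format, OF that], of n p] prob_space_imp_subprob_space
      by (auto simp: space_subprob_algebra sets_data_law)
    then show ?thesis by (auto simp: measurable_def space_point_measure sets_point_measure)
  qed
  have ne: "space ?P \<noteq> {}" by (rule P.not_empty)
  have sets: "sets ?B = sets (data_algebra n p)" by (rule sets_bind[OF _ ne]) (simp add: sets_data_law)
  have "mixture n p (finite_prior p I wt \<theta>) = measure_of (space ?B) (sets ?B) (emeasure ?B)"
    unfolding mixture_def sets sets_eq_imp_space_eq[OF sets]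
  proof (rule measure_of_eq)
    show "sets (data_algebra n p) \<subseteq> Pow (space (data_algebra n p))" by (rule sets.space_closed)
    fix A assume "A \<in> sigma_sets (space (data_algebra n p)) (sets (data_algebra n p))"
    then have A: "A \<in> sets (data_algebra n p)" by (simp add: sets.sigma_sets_eq)
    show "(\<integral>\<^sup>+ t. emeasure (data_law n p t) A \<partial>finite_prior p I wt \<theta>) = emeasure ?B A"
      unfolding nn_integral_finite_prior[OF w sp] emeasure_bind[OF ne m A]
      using w by (subst nn_integral_point_measure_finite) (auto simp: weights_def mult.commute)
  qed
  also have "\<dots> = ?B" by (rule measure_of_of_measure)
  finally show "mixture n p (finite_prior p I wt \<theta>) = ?B" .
qed

lemma mixture_integral:
  fixes f :: "data \<Rightarrow> real"
  assumes w: "weights I wt" and sp: "\<forall>k\<in>I. \<theta> k \<in> space (param_algebra p)"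
    and pos: "\<forall>k\<in>I. snd (snd (\<theta> k)) > 0"
    and fm: "f \<in> borel_measurable (data_algebra n p)" and f: "\<And>k. k \<in> I \<Longrightarrow> integrable (data_law n p (\<theta> k)) f"
  shows "integrable (mixture n p (finite_prior p I wt \<theta>)) f"
    and "(\<integral>z. f z \<partial>mixture n p (finite_prior p I wt \<theta>)) = (\<Sum>k\<in>I. wt k * (\<integral>z. f z \<partial>data_law n p (\<theta> k)))"
proof -
  let ?P = "point_measure I (\<lambda>k. ennreal (wt k))"
  interpret P: prob_space ?P by (rule prob_space_point_measure[OF w])
  define B where "B = mixture n p (finite_prior p I wt \<theta>)"
  note B = B_def[unfolded mixture_finite_prior(1)[OF w sp pos]]
  note m = mixture_finite_prior(2)[OF w sp pos, where n = n]
  have sets: "sets B = sets (data_algebra n p)"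
    unfolding B by (rule sets_bind[OF _ P.not_empty]) (simp add: sets_data_law)
  \<comment> \<open>For nonnegative functions the iterated integral needs no prior integrability. A
    general f is the difference of the nonnegative \<open>f z + \<bar>f z\<bar>\<close> and
    \<open>\<bar>f z\<bar>\<close>.\<close>
  have main: "integrable B g \<and> (\<integral>z. g z \<partial>B) = (\<Sum>k\<in>I. wt k * (\<integral>z. g z \<partial>data_law n p (\<theta> k)))"
    if g: "g \<in> borel_measurable (data_algebra n p)" "\<And>z. 0 \<le> g z" "\<And>k. k \<in> I \<Longrightarrow> integrable (data_law n p (\<theta> k)) g"
    for g :: "data \<Rightarrow> real"
  proof -
    have gB: "g \<in> borel_measurable B" using g(1) measurable_cong_sets[OF sets refl] by blast
    have nn: "0 \<le> wt k * (\<integral>z. g z \<partial>data_law n p (\<theta> k))" if "k \<in> I" for k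
      using w g(2) that by (auto simp: weights_def)
    have "(\<integral>\<^sup>+z. ennreal (g z) \<partial>B) = (\<integral>\<^sup>+k. (\<integral>\<^sup>+z. ennreal (g z) \<partial>data_law n p (\<theta> k)) \<partial>?P)"
      unfolding B using g(1) by (intro nn_integral_bind[OF _ m]) auto
    also have "\<dots> = (\<Sum>k\<in>I. ennreal (wt k) * (\<integral>\<^sup>+z. ennreal (g z) \<partial>data_law n p (\<theta> k)))"
      using w by (subst nn_integral_point_measure_finite) (auto simp: weights_def mult.commute)
    also have "\<dots> = (\<Sum>k\<in>I. ennreal (wt k * (\<integral>z. g z \<partial>data_law n p (\<theta> k))))"
      using w g by (intro sum.cong refl) (simp add: nn_integral_eq_integral ennreal_mult weights_def)
    also have "\<dots> = ennreal (\<Sum>k\<in>I. wt k * (\<integral>z. g z \<partial>data_law n p (\<theta> k)))"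
      using nn by (rule sum_ennreal)
    finally have eq: "(\<integral>\<^sup>+z. ennreal (g z) \<partial>B) = ennreal (\<Sum>k\<in>I. wt k * (\<integral>z. g z \<partial>data_law n p (\<theta> k)))" .
    have "integrable B g" using gB g(2) eq by (intro integrableI_nonneg) auto
    moreover have "(\<integral>z. g z \<partial>B) = (\<Sum>k\<in>I. wt k * (\<integral>z. g z \<partial>data_law n p (\<theta> k)))"
    proof -
      have "0 \<le> (\<Sum>k\<in>I. wt k * (\<integral>z. g z \<partial>data_law n p (\<theta> k)))" by (rule sum_nonneg) (rule nn)
      then show ?thesis using gB g(2) eq by (subst integral_eq_nn_integral) auto
    qed
    ultimately show ?thesis ..
  qed
  have 1: "integrable B (\<lambda>z. f z + \<bar>f z\<bar>) \<and> (\<integral>z. f z + \<bar>f z\<bar> \<partial>B) = (\<Sum>k\<in>I. wt k * (\<integral>z. f z + \<bar>f z\<bar> \<partial>data_law n p (\<theta> k)))"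
    using fm f by (intro main) auto
  have 2: "integrable B (\<lambda>z. \<bar>f z\<bar>) \<and> (\<integral>z. \<bar>f z\<bar> \<partial>B) = (\<Sum>k\<in>I. wt k * (\<integral>z. \<bar>f z\<bar> \<partial>data_law n p (\<theta> k)))"
    using fm f by (intro main) auto
  have 3: "f = (\<lambda>z. (f z + \<bar>f z\<bar>) - \<bar>f z\<bar>)" by simp
  have int: "integrable B f"
    by (subst 3) (intro Bochner_Integration.integrable_diff; use 1 2 in blast)
  then show "integrable (mixture n p (finite_prior p I wt \<theta>)) f" by (simp add: B_def)
  have "(\<integral>z. f z \<partial>B) = (\<integral>z. f z + \<bar>f z\<bar> \<partial>B) - (\<integral>z. \<bar>f z\<bar> \<partial>B)"
    using int 2 by simp
  also have "\<dots> = (\<Sum>k\<in>I. wt k * (\<integral>z. f z + \<bar>f z\<bar> \<partial>data_law n p (\<theta> k)) - wt k * (\<integral>z. \<bar>f z\<bar> \<partial>data_law n p (\<theta> k)))"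
    using 1 2 by (simp add: sum_subtractf)
  also have "\<dots> = (\<Sum>k\<in>I. wt k * (\<integral>z. f z \<partial>data_law n p (\<theta> k)))"
    using f by (intro sum.cong refl) (simp add: right_diff_distrib[symmetric])
  finally show "(\<integral>z. f z \<partial>mixture n p (finite_prior p I wt \<theta>)) = (\<Sum>k\<in>I. wt k * (\<integral>z. f z \<partial>data_law n p (\<theta> k)))"
    by (simp add: B_def)
qed

subsection \<open>The low-degree second moment bound\<close>

lemma Lam_empty: "Lam n p \<rho> s w {} z = 1"
  by (simp add: Lam_def tilt_def)

lemma base_monomial_union: "base_monomial a \<sigma>0 (m + m') z = base_monomial a \<sigma>0 m z * base_monomial a \<sigma>0 m' z"
  by (simp add: base_monomial_def)

text \<open>Carried over to the noise space, f becomes a polynomial F whose integral is the mean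
  under the point prior, and whose integral against the averaged truncated ratio GG is the mean
  under the mixture. As GG has mean 1, the gap is the integral of (F - \<mu>) (GG - 1), and
  Cauchy-Schwarz applies.\<close>

lemma low_degree_bound:
  fixes s w :: "'k \<Rightarrow> nat \<Rightarrow> real" and a :: real
  assumes wI: "weights I wt" and ok: "\<forall>k\<in>I. hid_ok p (S k) (s k) (w k)"
    and small: "\<forall>k\<in>I. \<forall>k'\<in>I. hid_small p \<rho> L (w k) (w k')" and card: "\<forall>k\<in>I. card (S k) \<le> L"
    and N: "\<forall>k\<in>I. (\<Sum>j<p. (s k j)\<^sup>2) = N" and \<sigma>0: "\<sigma>0 > 0" and f: "f \<in> polynomials n p D"
  defines "P2 \<equiv> data_law n p (hid_param p a \<sigma>0 \<rho> 0 (\<lambda>_. 0) (\<lambda>_. 0))"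
  shows "((\<Sum>k\<in>I. wt k * (\<integral>z. f z \<partial>data_law n p (hid_param p a \<sigma>0 \<rho> N (s k) (w k)))) - (\<integral>z. f z \<partial>P2))\<^sup>2
    \<le> (\<integral>z. (f z - (\<integral>z. f z \<partial>P2))\<^sup>2 \<partial>P2)
      * ((\<Sum>k\<in>I. \<Sum>k'\<in>I. wt k * wt k' * (\<integral>z. Gfun n p \<rho> D (S k) (s k) (w k) z * Gfun n p \<rho> D (S k') (s k') (w k') z \<partial>noise_space n p)) - 1)"
proof -
  let ?M = "noise_space n p"
  let ?P = "\<lambda>k. data_law n p (hid_param p a \<sigma>0 \<rho> N (s k) (w k))"
  let ?G = "\<lambda>k. Gfun n p \<rho> D (S k) (s k) (w k)"
  interpret M: prob_space ?M by (rule prob_space_noise)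
  have finI: "finite I" and I: "I \<noteq> {}" using wI by (auto simp: weights_def)
  then obtain k0 where k0: "k0 \<in> I" by auto
  have p: "0 < p" using ok k0 by (auto simp: hid_ok_def)
  have N0: "0 \<le> N" using N k0 sum_nonneg[of "{..<p}" "\<lambda>j. (s k0 j)\<^sup>2"] by auto
  obtain Ms c where Ms: "finite Ms" "\<forall>m\<in>Ms. set_mset m \<subseteq> coord_set n p \<and> size m \<le> D"
    and f_eq: "f = (\<lambda>z. \<Sum>m\<in>Ms. c m * (\<Prod>v\<in>#m. coord z v))"
    using f by (auto simp: polynomials_def)
  define F where "F z = (\<Sum>m\<in>Ms. c m * base_monomial a \<sigma>0 m z)" for z
  have \<sigma>2: "snd (snd (hid_param p a \<sigma>0 \<rho> 0 (\<lambda>_. 0) (\<lambda>_. 0))) > 0"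
    by (rule hid_param_noise_pos[OF \<sigma>0]) simp
  have \<sigma>1: "snd (snd (hid_param p a \<sigma>0 \<rho> N (s k) (w k))) > 0" for k
    by (rule hid_param_noise_pos[OF \<sigma>0 N0])
  interpret P2: prob_space P2 unfolding P2_def by (rule prob_space_data_law[OF \<sigma>2])
  have am: "all_moments ?M (base_monomial a \<sigma>0 m)" if "m \<in> Ms" for m
    using Ms that p by (intro all_moments_base_monomial) auto
  have amF: "all_moments ?M F"
    unfolding F_def by (intro all_moments_sum all_moments_mult all_moments_const am M.finite_measure_axioms)
  have amf: "all_moments P2 f" unfolding P2_def by (rule all_moments_polynomial[OF \<sigma>2 f])
  have mom2: "(\<integral>z. (\<Prod>v\<in>#m. coord z v) \<partial>P2) = (\<integral>z. base_monomial a \<sigma>0 m z \<partial>?M)"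
    if "set_mset m \<subseteq> coord_set n p" for m
  proof -
    \<comment> \<open>The point prior is the hidden factor model with no carrying column, whose
      likelihood ratio is 1.\<close>
    have "hid_ok p {} (\<lambda>_. 0) (\<lambda>_. 0)" using p by (simp add: hid_ok_def)
    from data_moments[OF this _ \<sigma>0 that, of 0 a \<rho>] show ?thesis by (simp add: P2_def Lam_empty)
  qed
  have amono: "all_moments P2 (\<lambda>z. \<Prod>v\<in>#m. coord z v)" if "set_mset m \<subseteq> coord_set n p" for m
    unfolding P2_def by (rule all_moments_monomial[OF \<sigma>2 that])
  have E2: "(\<integral>z. f z \<partial>P2) = (\<integral>z. F z \<partial>?M)"
  proof -
    have "(\<integral>z. f z \<partial>P2) = (\<Sum>m\<in>Ms. c m * (\<integral>z. (\<Prod>v\<in>#m. coord z v) \<partial>P2))"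
      unfolding f_eq using Ms
      by (subst Bochner_Integration.integral_sum) (auto intro!: all_moments_integrable amono integrable_mult_right)
    also have "\<dots> = (\<Sum>m\<in>Ms. c m * (\<integral>z. base_monomial a \<sigma>0 m z \<partial>?M))"
      using Ms by (intro sum.cong refl) (simp add: mom2)
    also have "\<dots> = (\<integral>z. F z \<partial>?M)"
      unfolding F_def
      by (subst Bochner_Integration.integral_sum) (auto intro!: all_moments_integrable am integrable_mult_right)
    finally show ?thesis .
  qed
  have E2sq: "(\<integral>z. (f z)\<^sup>2 \<partial>P2) = (\<integral>z. (F z)\<^sup>2 \<partial>?M)"
  proof -
    have "(\<integral>z. (f z)\<^sup>2 \<partial>P2) = (\<integral>z. (\<Sum>m\<in>Ms. \<Sum>m'\<in>Ms. (c m * c m') * (\<Prod>v\<in>#m + m'. coord z v)) \<partial>P2)"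
      by (intro Bochner_Integration.integral_cong) (auto simp: f_eq power2_eq_square sum_product mult_ac)
    also have "\<dots> = (\<Sum>m\<in>Ms. \<Sum>m'\<in>Ms. (c m * c m') * (\<integral>z. (\<Prod>v\<in>#m + m'. coord z v) \<partial>P2))"
    proof -
      have "integrable P2 (\<lambda>z. (c m * c m') * (\<Prod>v\<in>#m + m'. coord z v))" if "m \<in> Ms" "m' \<in> Ms" for m m'
        using Ms that by (intro integrable_mult_right all_moments_integrable amono) auto
      then show ?thesis
        by (simp add: Bochner_Integration.integral_sum Bochner_Integration.integrable_sum)
    qed
    also have "\<dots> = (\<Sum>m\<in>Ms. \<Sum>m'\<in>Ms. (c m * c m') * (\<integral>z. base_monomial a \<sigma>0 (m + m') z \<partial>?M))"
      using Ms by (intro sum.cong refl arg_cong2[where f = "(*)"] mom2) auto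
    also have "\<dots> = (\<integral>z. (\<Sum>m\<in>Ms. \<Sum>m'\<in>Ms. (c m * c m') * base_monomial a \<sigma>0 (m + m') z) \<partial>?M)"
    proof -
      have "integrable ?M (\<lambda>z. (c m * c m') * base_monomial a \<sigma>0 (m + m') z)" if "m \<in> Ms" "m' \<in> Ms" for m m'
        unfolding base_monomial_union using that
        by (intro integrable_mult_right all_moments_integrable all_moments_mult am)
      then show ?thesis
        by (simp add: Bochner_Integration.integral_sum Bochner_Integration.integrable_sum)
    qed
    also have "\<dots> = (\<integral>z. (F z)\<^sup>2 \<partial>?M)"
      by (intro Bochner_Integration.integral_cong) (auto simp: F_def power2_eq_square sum_product base_monomial_union mult_ac)
    finally show ?thesis .
  qed
  have okI: "hid_ok p (S k) (s k) (w k)" "hid_small p \<rho> L (w k) (w k)" "card (S k) \<le> L" "(\<Sum>j<p. (s k j)\<^sup>2) = N"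
    if "k \<in> I" for k using ok small card N that by auto
  have sqG: "sq_int ?M (?G k)" if "k \<in> I" for k by (rule sq_int_Gfun[OF okI(1-3)[OF that]])
  define GG where "GG z = (\<Sum>k\<in>I. wt k * ?G k z)" for z
  have sqGG: "sq_int ?M GG" unfolding GG_def by (intro sq_int_sum sq_int_scale sqG)
  have sqF: "sq_int ?M F" by (rule sq_int_all_moments[OF amF])
  have one: "sq_int ?M (\<lambda>_. c)" for c
    by (rule sq_int_all_moments[OF all_moments_const[OF M.finite_measure_axioms]])
  have intG: "integrable ?M (?G k)" if "k \<in> I" for k using sq_int_mult[OF one[of 1] sqG[OF that]] by simp
  have intGG: "integrable ?M GG" using sq_int_mult[OF one[of 1] sqGG] by simp
  have intF: "integrable ?M F" by (rule all_moments_integrable[OF amF])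
  have E1k: "(\<integral>z. f z \<partial>?P k) = (\<integral>z. F z * ?G k z \<partial>?M)" if k: "k \<in> I" for k
  proof -
    have "(\<integral>z. f z \<partial>?P k) = (\<Sum>m\<in>Ms. c m * (\<integral>z. (\<Prod>v\<in>#m. coord z v) \<partial>?P k))"
      unfolding f_eq using Ms
      by (subst Bochner_Integration.integral_sum)
        (auto intro!: all_moments_integrable all_moments_monomial[OF \<sigma>1] integrable_mult_right)
    also have "\<dots> = (\<Sum>m\<in>Ms. c m * (\<integral>z. base_monomial a \<sigma>0 m z * ?G k z \<partial>?M))"
      using Ms by (intro sum.cong refl) (simp add: base_Gfun[OF okI[OF k] \<sigma>0])
    also have "\<dots> = (\<integral>z. (\<Sum>m\<in>Ms. c m * (base_monomial a \<sigma>0 m z * ?G k z)) \<partial>?M)"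
      by (subst Bochner_Integration.integral_sum)
        (auto intro!: integrable_mult_right sq_int_mult sq_int_all_moments am sqG k)
    also have "\<dots> = (\<integral>z. F z * ?G k z \<partial>?M)" by (simp add: F_def sum_distrib_right mult.assoc)
    finally show ?thesis .
  qed
  have intG1: "(\<integral>z. ?G k z \<partial>?M) = 1" if k: "k \<in> I" for k
  proof -
    interpret Pk: prob_space "?P k" by (rule prob_space_data_law[OF \<sigma>1])
    show ?thesis using base_Gfun[OF okI[OF k] \<sigma>0, of "{#}" n D a] by (simp add: base_monomial_def Pk.prob_space)
  qed
  have GG1: "(\<integral>z. GG z \<partial>?M) = 1"
    using wI intG by (simp add: GG_def intG1 weights_def)
  have FGG: "(\<Sum>k\<in>I. wt k * (\<integral>z. f z \<partial>?P k)) = (\<integral>z. F z * GG z \<partial>?M)"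
  proof -
    have "(\<integral>z. F z * GG z \<partial>?M) = (\<integral>z. (\<Sum>k\<in>I. wt k * (F z * ?G k z)) \<partial>?M)"
      by (simp add: GG_def sum_distrib_left mult_ac)
    also have "\<dots> = (\<Sum>k\<in>I. wt k * (\<integral>z. F z * ?G k z \<partial>?M))"
      by (subst Bochner_Integration.integral_sum) (auto intro!: integrable_mult_right sq_int_mult sqF sqG)
    finally show ?thesis by (simp add: E1k)
  qed
  define \<mu> where "\<mu> = (\<integral>z. F z \<partial>?M)"
  have sqFm: "sq_int ?M (\<lambda>z. F z + (- \<mu>))" by (rule sq_int_add[OF sqF one])
  have sqGm: "sq_int ?M (\<lambda>z. GG z + (- 1))" by (rule sq_int_add[OF sqGG one])
  have prod: "(\<integral>z. (F z + (- \<mu>)) * (GG z + (- 1)) \<partial>?M) = (\<integral>z. F z * GG z \<partial>?M) - \<mu>"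
  proof -
    have "(\<integral>z. (F z + (- \<mu>)) * (GG z + (- 1)) \<partial>?M) = (\<integral>z. F z * GG z - F z - \<mu> * GG z + \<mu> \<partial>?M)"
      by (intro Bochner_Integration.integral_cong) (auto simp: algebra_simps)
    also have "\<dots> = (\<integral>z. F z * GG z \<partial>?M) - \<mu> - \<mu> * 1 + \<mu>"
      using intF intGG sq_int_mult[OF sqF sqGG] by (simp add: GG1 \<mu>_def[symmetric] M.prob_space)
    finally show ?thesis by simp
  qed
  have varF: "(\<integral>z. (F z + (- \<mu>))\<^sup>2 \<partial>?M) = (\<integral>z. (f z - (\<integral>z. f z \<partial>P2))\<^sup>2 \<partial>P2)"
  proof -
    have "(\<integral>z. (F z + (- \<mu>))\<^sup>2 \<partial>?M) = (\<integral>z. (F z)\<^sup>2 - 2 * \<mu> * F z + \<mu>\<^sup>2 \<partial>?M)"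
      by (intro Bochner_Integration.integral_cong) (auto simp: algebra_simps power2_eq_square)
    also have "\<dots> = (\<integral>z. (F z)\<^sup>2 \<partial>?M) - 2 * \<mu> * \<mu> + \<mu>\<^sup>2"
      using intF sqF by (simp add: sq_int_def \<mu>_def[symmetric] M.prob_space)
    also have "\<dots> = (\<integral>z. (f z)\<^sup>2 \<partial>P2) - 2 * \<mu> * (\<integral>z. f z \<partial>P2) + \<mu>\<^sup>2"
      by (simp add: E2sq E2 \<mu>_def)
    also have "\<dots> = (\<integral>z. (f z)\<^sup>2 - 2 * \<mu> * f z + \<mu>\<^sup>2 \<partial>P2)"
      using all_moments_integrable[OF amf] sq_int_all_moments[OF amf] by (simp add: sq_int_def P2.prob_space)
    also have "\<dots> = (\<integral>z. (f z - \<mu>)\<^sup>2 \<partial>P2)"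
      by (intro Bochner_Integration.integral_cong) (auto simp: algebra_simps power2_eq_square)
    finally show ?thesis by (simp add: \<mu>_def E2)
  qed
  have varG: "(\<integral>z. (GG z + (- 1))\<^sup>2 \<partial>?M)
      = (\<Sum>k\<in>I. \<Sum>k'\<in>I. wt k * wt k' * (\<integral>z. ?G k z * ?G k' z \<partial>?M)) - 1"
  proof -
    have "(\<integral>z. (GG z + (- 1))\<^sup>2 \<partial>?M) = (\<integral>z. (GG z)\<^sup>2 - 2 * GG z + 1 \<partial>?M)"
      by (intro Bochner_Integration.integral_cong) (auto simp: algebra_simps power2_eq_square)
    also have "\<dots> = (\<integral>z. (GG z)\<^sup>2 \<partial>?M) - 1"
      using intGG sqGG by (simp add: sq_int_def GG1 M.prob_space)
    also have "(\<integral>z. (GG z)\<^sup>2 \<partial>?M) = (\<integral>z. (\<Sum>k\<in>I. \<Sum>k'\<in>I. (wt k * wt k') * (?G k z * ?G k' z)) \<partial>?M)"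
      by (intro Bochner_Integration.integral_cong) (auto simp: GG_def power2_eq_square sum_product mult_ac)
    also have "\<dots> = (\<Sum>k\<in>I. \<Sum>k'\<in>I. wt k * wt k' * (\<integral>z. ?G k z * ?G k' z \<partial>?M))"
    proof -
      have "integrable ?M (\<lambda>z. (wt k * wt k') * (?G k z * ?G k' z))" if "k \<in> I" "k' \<in> I" for k k'
        by (intro integrable_mult_right sq_int_mult sqG that)
      then show ?thesis
        by (simp add: Bochner_Integration.integral_sum Bochner_Integration.integrable_sum)
    qed
    finally show ?thesis .
  qed
  show ?thesis
    using Cauchy_Schwarz_sq_int[OF sqFm sqGm] unfolding prod varF varG FGG by (simp add: E2 \<mu>_def)
qed

subsection \<open>Membership in the parameter space\<close>

lemma hid_param_space: "hid_param p a \<sigma>0 \<rho> N s w \<in> space (param_algebra p)"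
  by (auto simp: hid_param_def param_algebra_def space_pair_measure space_PiM)

lemma hid_param_inner:
  assumes "0 < p" "(\<Sum>j<p. \<xi> j * s j) = 0"
  shows "inner_on p \<xi> (fst (hid_param p a \<sigma>0 \<rho> N s w))
    = a * \<xi> 0 - \<sigma>0 * \<rho> / (1 + N * \<rho>\<^sup>2) * (N * \<rho>) * inner_on p \<xi> w"
proof -
  define k where "k = \<sigma>0 * \<rho> / (1 + N * \<rho>\<^sup>2)"
  have \<beta>: "fst (hid_param p a \<sigma>0 \<rho> N s w) j = (if j = 0 then a else 0) + k * (s j - N * \<rho> * w j)" if "j < p" for j
    using that by (simp add: hid_param_def k_def)
  have "inner_on p \<xi> (fst (hid_param p a \<sigma>0 \<rho> N s w))
      = (\<Sum>j<p. (if j = 0 then a * \<xi> j else 0) + k * (\<xi> j * s j) - k * (N * \<rho>) * (\<xi> j * w j))"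
    unfolding inner_on_def by (intro sum.cong) (auto simp: \<beta> algebra_simps)
  also have "\<dots> = a * \<xi> 0 + k * 0 - k * (N * \<rho>) * inner_on p \<xi> w"
    using assms(1) by (simp only: sum.distrib sum_subtractf sum_distrib_left[symmetric] assms(2) inner_on_def
        sum.delta finite_lessThan lessThan_iff if_True)
  finally show ?thesis by (simp add: k_def)
qed

lemma hid_quadratic:
  fixes u s w :: "nat \<Rightarrow> real"
  shows "(\<Sum>i<p. u i * (\<Sum>j<p. ((if i = j then 1 else 0) + \<rho> * (s i * w j + s j * w i) + s i * s j * B) * u j))
    = (\<Sum>i<p. (u i)\<^sup>2) + 2 * (\<rho> * (\<Sum>i<p. s i * u i) * (\<Sum>i<p. w i * u i)) + (\<Sum>i<p. s i * u i)\<^sup>2 * B"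
proof -
  have "(\<Sum>j<p. ((if i = j then 1 else 0) + \<rho> * (s i * w j + s j * w i) + s i * s j * B) * u j)
      = u i + \<rho> * s i * (\<Sum>j<p. w j * u j) + \<rho> * w i * (\<Sum>j<p. s j * u j) + s i * B * (\<Sum>j<p. s j * u j)"
    if "i < p" for i
  proof -
    have "(\<Sum>j<p. ((if i = j then 1 else 0) + \<rho> * (s i * w j + s j * w i) + s i * s j * B) * u j)
        = (\<Sum>j<p. (if j = i then u j else 0) + \<rho> * s i * (w j * u j) + \<rho> * w i * (s j * u j) + s i * B * (s j * u j))"
      by (intro sum.cong) (auto simp: algebra_simps)
    then show ?thesis using that by (simp add: sum.distrib sum_distrib_left[symmetric])
  qed
  then have "(\<Sum>i<p. u i * (\<Sum>j<p. ((if i = j then 1 else 0) + \<rho> * (s i * w j + s j * w i) + s i * s j * B) * u j))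
      = (\<Sum>i<p. (u i)\<^sup>2 + \<rho> * (\<Sum>j<p. w j * u j) * (s i * u i) + \<rho> * (\<Sum>j<p. s j * u j) * (w i * u i)
          + B * (\<Sum>j<p. s j * u j) * (s i * u i))"
    by (intro sum.cong refl) (simp add: algebra_simps power2_eq_square)
  then show ?thesis
    by (simp add: sum.distrib sum_distrib_left[symmetric] power2_eq_square)
qed

text \<open>On a vector u, the quadratic form differs from |u|^2 by 2 \<rho> <s, u> <w, u> + B <s,
  u>^2. By Cauchy-Schwarz and the hypothesis, both copies of the mixed term and the last term are at
  most d / 3 times |u|^2, where d = 1 - 1 / M1. The coordinate \<open>l0\<close> outside both
  supports yields the eigenvalue 1, so \<open>Min\<close> and \<open>Max\<close> range over a
  nonempty spectrum.\<close>

lemma hid_param_Theta: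
  fixes s w :: "nat \<Rightarrow> real"
  assumes M1: "M1 > 1" and \<sigma>0: "0 < \<sigma>0" "\<sigma>0 \<le> M2" and N: "(\<Sum>j<p. (s j)\<^sup>2) = N"
    and b: "N * \<rho>\<^sup>2 * (1 + inner_on p w w) \<le> ((1 - 1 / M1) / 3)\<^sup>2"
    and l0: "l0 < p" "s l0 = 0" "w l0 = 0"
    and k: "card ({0} \<union> {j. s j \<noteq> 0} \<union> {j. w j \<noteq> 0}) \<le> k" "finite {j. s j \<noteq> 0}" "finite {j. w j \<noteq> 0}"
  shows "hid_param p a \<sigma>0 \<rho> N s w \<in> Theta M1 M2 p k"
proof -
  define d where "d = 1 - 1 / M1"
  have d: "0 < d" "d < 1" using M1 by (auto simp: d_def)
  define W where "W = inner_on p w w"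
  have W: "(\<Sum>l<p. (w l)\<^sup>2) = W" by (simp add: W_def inner_on_def power2_eq_square)
  have W0: "0 \<le> W" unfolding W[symmetric] by (intro sum_nonneg) auto
  have N0: "0 \<le> N" unfolding N[symmetric] by (intro sum_nonneg) auto
  define B where "B = \<rho>\<^sup>2 * (1 + W)"
  have B: "0 \<le> B" "N * B \<le> (d / 3)\<^sup>2" using b W0 by (auto simp: B_def W_def d_def mult.assoc)
  obtain \<beta> S \<sigma> where \<theta>: "hid_param p a \<sigma>0 \<rho> N s w = (\<beta>, S, \<sigma>)" by (cases "hid_param p a \<sigma>0 \<rho> N s w") auto
  have \<beta>: "\<beta> = (\<lambda>j\<in>{..<p}. (if j = 0 then a else 0) + \<sigma>0 * \<rho> / (1 + N * \<rho>\<^sup>2) * (s j - N * \<rho> * w j))"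
    and \<sigma>: "\<sigma> = \<sigma>0 / sqrt (1 + N * \<rho>\<^sup>2)"
    and S: "S = (\<lambda>(i, j)\<in>{..<p} \<times> {..<p}. (if i = j then 1 else 0) + \<rho> * (s i * w j + s j * w i) + s i * s j * B)"
    using \<theta> by (auto simp: hid_param_def W B_def)
  let ?A = "Matrix.mat p p S"
  have A: "?A \<in> carrier_mat p p" by simp
  have ev: "1 / M1 \<le> x \<and> x \<le> M1" if x: "x \<in> spectrum ?A" for x
  proof -
    obtain v where v: "v \<in> carrier_vec p" "v \<noteq> 0\<^sub>v p" "?A *\<^sub>v v = x \<cdot>\<^sub>v v"
      using x by (auto simp: spectrum_def eigenvalue_def eigenvector_def)
    define u where "u i = v $ i" for i
    have eq: "(\<Sum>j<p. S (i, j) * u j) = x * u i" if "i < p" for i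
    proof -
      have "(?A *\<^sub>v v) $ i = (\<Sum>j<p. S (i, j) * u j)"
        using that v(1) by (simp add: scalar_prod_def u_def lessThan_atLeast0)
      then show ?thesis using that v(1) unfolding v(3) by (simp add: u_def)
    qed
    define U where "U = (\<Sum>i<p. (u i)\<^sup>2)"
    have U: "0 < U"
    proof -
      have "\<exists>i<p. u i \<noteq> 0"
      proof (rule ccontr)
        assume "\<not> (\<exists>i<p. u i \<noteq> 0)"
        then have "v = 0\<^sub>v p" using v(1) by (intro eq_vecI) (auto simp: u_def)
        then show False using v(2) by simp
      qed
      then obtain i where "i < p" "u i \<noteq> 0" by auto
      then show ?thesis unfolding U_def by (intro sum_pos2[of _ i]) auto
    qed
    define su wu where "su = (\<Sum>i<p. s i * u i)" and "wu = (\<Sum>i<p. w i * u i)"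
    have su: "su\<^sup>2 \<le> N * U" unfolding su_def U_def N[symmetric] by (rule Cauchy_Schwarz_ineq_sum)
    have wu: "wu\<^sup>2 \<le> W * U" unfolding wu_def U_def W[symmetric] by (rule Cauchy_Schwarz_ineq_sum)
    have quad: "x * U = U + 2 * (\<rho> * su * wu) + su\<^sup>2 * B"
    proof -
      have "x * U = (\<Sum>i<p. x * (u i)\<^sup>2)" by (simp add: U_def sum_distrib_left)
      also have "\<dots> = (\<Sum>i<p. u i * (\<Sum>j<p. S (i, j) * u j))"
        by (intro sum.cong refl) (simp add: eq power2_eq_square)
      also have "\<dots> = (\<Sum>i<p. u i * (\<Sum>j<p. ((if i = j then 1 else 0) + \<rho> * (s i * w j + s j * w i) + s i * s j * B) * u j))"
        by (intro sum.cong refl arg_cong2[where f = "(*)"]) (simp add: S)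
      also have "\<dots> = U + 2 * (\<rho> * su * wu) + su\<^sup>2 * B"
        unfolding hid_quadratic by (simp add: U_def su_def wu_def)
      finally show ?thesis .
    qed
    have "(\<rho> * su * wu)\<^sup>2 \<le> (d / 3 * U)\<^sup>2"
    proof -
      have "(\<rho> * su * wu)\<^sup>2 = \<rho>\<^sup>2 * (su\<^sup>2 * wu\<^sup>2)" by (simp add: power_mult_distrib)
      also have "\<dots> \<le> \<rho>\<^sup>2 * ((N * U) * (W * U))"
        using su wu N0 U by (intro mult_left_mono mult_mono) auto
      also have "\<dots> = (N * (\<rho>\<^sup>2 * W)) * U\<^sup>2" by (simp add: power2_eq_square)
      also have "\<dots> \<le> (N * B) * U\<^sup>2"
        unfolding B_def using N0 by (intro mult_right_mono mult_left_mono) auto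
      also have "\<dots> \<le> (d / 3)\<^sup>2 * U\<^sup>2" using B by (intro mult_right_mono) auto
      finally show ?thesis by (simp only: power_mult_distrib)
    qed
    then have "\<bar>\<rho> * su * wu\<bar> \<le> \<bar>d / 3 * U\<bar>" by (simp only: abs_le_square_iff)
    moreover have "\<bar>d / 3 * U\<bar> = d / 3 * U" using d U by (intro abs_of_nonneg) simp
    ultimately have c1: "\<bar>\<rho> * su * wu\<bar> \<le> d / 3 * U" by simp
    have c2: "su\<^sup>2 * B \<le> d / 3 * U"
    proof -
      have "su\<^sup>2 * B \<le> (N * U) * B" using su B by (intro mult_right_mono) auto
      also have "\<dots> = (N * B) * U" by simp
      also have "\<dots> \<le> (d / 3)\<^sup>2 * U" using B U by (intro mult_right_mono) auto
      also have "\<dots> \<le> d / 3 * U"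
      proof (rule mult_right_mono)
        have "(d / 3) * (d / 3) \<le> (d / 3) * 1" using d by (intro mult_left_mono) auto
        then show "(d / 3)\<^sup>2 \<le> d / 3" by (simp add: power2_eq_square)
      qed (use U in simp)
      finally show ?thesis .
    qed
    have c3: "0 \<le> su\<^sup>2 * B" using B by simp
    have "(1 - d) * U \<le> x * U" "x * U \<le> (1 + d) * U"
      using c1 c2 c3 unfolding quad abs_le_iff by (simp_all add: algebra_simps)
    then have "1 - d \<le> x" "x \<le> 1 + d" using U by auto
    moreover have "1 - d = 1 / M1" by (simp add: d_def)
    \<comment> \<open>This is 2 \<le> M1 + 1 / M1.\<close>
    moreover have "1 + d \<le> M1"
    proof -
      have "0 \<le> (M1 - 1)\<^sup>2 / M1" using M1 by simp
      also have "(M1 - 1)\<^sup>2 / M1 = M1 - (1 + d)" using M1 by (simp add: d_def power2_eq_square field_simps)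
      finally show ?thesis by simp
    qed
    ultimately show ?thesis by linarith
  qed
  have "1 \<in> spectrum ?A"
  proof -
    have "?A *\<^sub>v unit_vec p l0 = 1 \<cdot>\<^sub>v unit_vec p l0"
    proof (rule eq_vecI)
      fix i assume "i < dim_vec (1 \<cdot>\<^sub>v unit_vec p l0)"
      then have i: "i < p" by simp
      have "(?A *\<^sub>v unit_vec p l0) $ i = S (i, l0)"
        using i l0(1) by simp
      also have "\<dots> = (if i = l0 then 1 else 0)" using i l0 by (simp add: S)
      also have "\<dots> = (1 \<cdot>\<^sub>v unit_vec p l0) $ i" using i l0(1) by simp
      finally show "(?A *\<^sub>v unit_vec p l0) $ i = (1 \<cdot>\<^sub>v unit_vec p l0) $ i" .
    qed simp
    moreover have "unit_vec p l0 \<noteq> (0\<^sub>v p :: real Matrix.vec)"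
    proof
      assume "unit_vec p l0 = (0\<^sub>v p :: real Matrix.vec)"
      then have "unit_vec p l0 $ l0 = (0\<^sub>v p $ l0 :: real)" by simp
      then show False using l0(1) by simp
    qed
    ultimately show ?thesis
      by (auto simp: spectrum_def eigenvalue_def eigenvector_def intro!: exI[of _ "unit_vec p l0"])
  qed
  moreover have fin: "finite (spectrum ?A)" using card_finite_spectrum[OF A] by simp
  ultimately have "1 / M1 \<le> Min (spectrum ?A) \<and> Max (spectrum ?A) \<le> M1"
    using ev by (metis Max_in Min_in empty_iff)
  moreover have "card {j. j < p \<and> \<beta> j \<noteq> 0} \<le> k"
  proof -
    have "{j. j < p \<and> \<beta> j \<noteq> 0} \<subseteq> {0} \<union> {j. s j \<noteq> 0} \<union> {j. w j \<noteq> 0}" by (auto simp: \<beta> split: if_splits)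
    then have "card {j. j < p \<and> \<beta> j \<noteq> 0} \<le> card ({0} \<union> {j. s j \<noteq> 0} \<union> {j. w j \<noteq> 0})"
      using k by (intro card_mono) auto
    then show ?thesis using k(1) by simp
  qed
  moreover have "0 < \<sigma>" "\<sigma> \<le> M2"
  proof -
    have 1: "1 \<le> sqrt (1 + N * \<rho>\<^sup>2)" using N0 by simp
    then show "0 < \<sigma>" using \<sigma>0 by (simp add: \<sigma>)
    have "\<sigma>0 \<le> \<sigma>0 * sqrt (1 + N * \<rho>\<^sup>2)" using mult_left_mono[OF 1, of \<sigma>0] \<sigma>0 by simp
    then have "\<sigma> \<le> \<sigma>0" using 1 by (simp add: \<sigma> divide_le_eq)
    then show "\<sigma> \<le> M2" using \<sigma>0 by simp
  qed
  moreover have "\<forall>i<p. \<forall>j<p. S (i, j) = S (j, i)" by (auto simp: S algebra_simps)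
  moreover have "\<beta> \<in> {..<p} \<rightarrow>\<^sub>E UNIV" "S \<in> {..<p} \<times> {..<p} \<rightarrow>\<^sub>E UNIV" by (auto simp: \<beta> S)
  ultimately show ?thesis unfolding \<theta> Theta_def by simp
qed

subsection \<open>A random sparse loading\<close>

text \<open>
  The coordinate \<open>j\<close> is selected with probability \<open>\<pi> j\<close>, roughly proportional to \<open>\<bar>\<xi> j\<bar>\<close>, and gets the
  weight \<open>\<xi> j / (\<nu> \<pi> j)\<close>, so that the weights average to \<open>\<xi> / \<nu>\<close>. All selected weights
  with \<open>\<pi> j < 1\<close> have the same modulus \<open>sqrt q / K\<close>, which keeps overlaps of two independent copies small.
\<close>

definition bern :: "nat \<Rightarrow> (nat \<Rightarrow> real) \<Rightarrow> nat set \<Rightarrow> real" where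
  "bern q \<pi> T = (\<Prod>j\<in>T. \<pi> j) * (\<Prod>j\<in>{..<q} - T. 1 - \<pi> j)"

lemma bern_prod:
  "(\<Sum>T\<in>Pow {..<q}. bern q \<pi> T * (\<Prod>j\<in>T. c j)) = (\<Prod>j<q. \<pi> j * c j + (1 - \<pi> j))"
  by (subst prod_add) (auto intro!: sum.cong simp: bern_def prod.distrib mult_ac)

lemma bern_sum: "(\<Sum>T\<in>Pow {..<q}. bern q \<pi> T) = 1"
  using bern_prod[of q \<pi> "\<lambda>_. 1"] by simp

lemma bern_prod2:
  "(\<Sum>T\<in>Pow {..<q}. \<Sum>T'\<in>Pow {..<q}. bern q \<pi> T * bern q \<pi> T' * (\<Prod>j\<in>T \<inter> T'. c j))
    = (\<Prod>j<q. 1 + (\<pi> j)\<^sup>2 * (c j - 1))"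
proof -
  have "(\<Sum>T'\<in>Pow {..<q}. bern q \<pi> T * bern q \<pi> T' * (\<Prod>j\<in>T \<inter> T'. c j))
      = bern q \<pi> T * (\<Prod>j\<in>T. 1 + \<pi> j * (c j - 1))" if T: "T \<subseteq> {..<q}" for T
  proof -
    have "(\<Prod>j\<in>T \<inter> T'. c j) = (\<Prod>j\<in>T'. if j \<in> T then c j else 1)" if "T' \<in> Pow {..<q}" for T'
    proof -
      have "finite T'" using that finite_subset by auto
      then show ?thesis by (subst Int_commute) (rule prod.inter_restrict)
    qed
    then have "(\<Sum>T'\<in>Pow {..<q}. bern q \<pi> T * bern q \<pi> T' * (\<Prod>j\<in>T \<inter> T'. c j))
        = bern q \<pi> T * (\<Sum>T'\<in>Pow {..<q}. bern q \<pi> T' * (\<Prod>j\<in>T'. if j \<in> T then c j else 1))"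
      by (simp add: sum_distrib_left mult.assoc)
    also have "\<dots> = bern q \<pi> T * (\<Prod>j<q. \<pi> j * (if j \<in> T then c j else 1) + (1 - \<pi> j))"
      by (simp only: bern_prod)
    also have "(\<Prod>j<q. \<pi> j * (if j \<in> T then c j else 1) + (1 - \<pi> j)) = (\<Prod>j<q. if j \<in> T then 1 + \<pi> j * (c j - 1) else 1)"
      by (intro prod.cong) (auto simp: algebra_simps)
    also have "\<dots> = (\<Prod>j\<in>{..<q} \<inter> T. 1 + \<pi> j * (c j - 1))"
      by (rule prod.inter_restrict[symmetric]) simp
    also have "{..<q} \<inter> T = T" using T by auto
    finally show ?thesis .
  qed
  then have "(\<Sum>T\<in>Pow {..<q}. \<Sum>T'\<in>Pow {..<q}. bern q \<pi> T * bern q \<pi> T' * (\<Prod>j\<in>T \<inter> T'. c j))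
      = (\<Sum>T\<in>Pow {..<q}. bern q \<pi> T * (\<Prod>j\<in>T. 1 + \<pi> j * (c j - 1)))"
    by (intro sum.cong) auto
  also have "\<dots> = (\<Prod>j<q. 1 + (\<pi> j)\<^sup>2 * (c j - 1))"
    unfolding bern_prod by (intro prod.cong) (auto simp: algebra_simps power2_eq_square)
  finally show ?thesis .
qed

lemma bern_nonneg:
  assumes "\<And>j. 0 \<le> \<pi> j \<and> \<pi> j \<le> 1"
  shows "0 \<le> bern q \<pi> T"
  unfolding bern_def using assms by (intro mult_nonneg_nonneg prod_nonneg) auto

lemma exp_minus_le: "0 \<le> y \<Longrightarrow> exp (- y) \<le> 1 - y + y\<^sup>2 / 2" for y :: real
proof -
  assume y: "0 \<le> y"
  obtain t where t: "\<bar>t\<bar> \<le> \<bar>- y\<bar>" "exp (- y) = (\<Sum>m<3. (- y) ^ m / fact m) + exp t / fact 3 * (- y) ^ 3"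
    using Maclaurin_exp_le[of "- y" 3] by auto
  have "exp t / fact 3 * (- y) ^ 3 \<le> 0" using y by (simp add: power3_eq_cube)
  then show ?thesis unfolding t(2) by (simp add: numeral_3_eq_3 power2_eq_square)
qed

lemma exp_le_linear: "0 \<le> y \<Longrightarrow> y \<le> 1 \<Longrightarrow> exp y - 1 \<le> 2 * y" for y :: real
  using exp_bound[of y] mult_left_mono[of y 1 y] by (simp add: power2_eq_square)

lemma exp_minus_two: "exp (- 2) \<le> (1 / 4 :: real)"
proof -
  have "(2::real) ^ 2 \<le> exp 1 ^ 2" using exp_ge_add_one_self[of "1::real"] by (intro power_mono) auto
  then have "4 \<le> exp (2::real)" by (simp add: exp_of_nat_mult[symmetric])
  then show ?thesis by (simp add: exp_minus field_simps)
qed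

text \<open>What the later proof uses of the random loading, with q in the role of k_eff and K in
  that of the sparsity. The last clause is an exponential moment of the overlap of two independent
  copies; its range of l reflects that the weights of the coordinates not selected for certain have
  size about \<open>sqrt q / K\<close>.\<close>

definition sparse_family :: "nat \<Rightarrow> (nat \<Rightarrow> real) \<Rightarrow> real \<Rightarrow> real \<Rightarrow> nat set set \<Rightarrow> (nat set \<Rightarrow> real)
    \<Rightarrow> (nat set \<Rightarrow> nat \<Rightarrow> real) \<Rightarrow> bool" where
  "sparse_family q \<xi> K \<nu> I \<omega> w \<longleftrightarrow> weights I \<omega>
     \<and> (\<forall>T\<in>I. (\<forall>j. w T j \<noteq> 0 \<longrightarrow> j < q) \<and> real (card {j. w T j \<noteq> 0}) \<le> 4 * K
          \<and> (\<Sum>j<q. \<xi> j * w T j) = \<nu> \<and> (\<Sum>j<q. (w T j)\<^sup>2) \<le> 4 * (1 + 4 * real q / K)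
          \<and> (\<forall>T'\<in>I. 0 \<le> (\<Sum>j<q. w T j * w T' j)))
     \<and> (\<forall>l. 0 \<le> l \<longrightarrow> 4 * l * (real q / K\<^sup>2) \<le> 1 \<longrightarrow>
           (\<Sum>T\<in>I. \<Sum>T'\<in>I. \<omega> T * \<omega> T' * exp (l * (\<Sum>j<q. w T j * w T' j))) \<le> 4 * exp (8 * l))"

text \<open>The selection has mean size at most K, and the sum \<open>A T\<close> of \<xi> against
  the weights has mean \<nu>. Restricting to selections of size at most 4 K with A T \<ge> \<nu> / 2
  and rescaling by \<open>\<nu> / A T\<close> gives sparsity and the exact inner product at the
  price of constant factors.\<close>

lemma sparse_design:
  fixes \<xi> :: "nat \<Rightarrow> real" and K :: real
  assumes K: "1 \<le> K" and q: "0 < q" and qK: "real q / K\<^sup>2 \<le> 1 / 16"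
    and \<nu>: "0 < \<nu>" "(\<Sum>j<q. (\<xi> j)\<^sup>2) = \<nu>\<^sup>2"
  shows "\<exists>I \<omega> w. sparse_family q \<xi> K \<nu> I \<omega> w"
proof -
  define sq where "sq = sqrt (real q)"
  have sq: "0 < sq" "sq\<^sup>2 = real q" using q by (auto simp: sq_def)
  define x where "x = real q / K\<^sup>2"
  have x: "0 < x" "x \<le> 1 / 16" "(sq / K)\<^sup>2 = x" using qK q K sq by (auto simp: x_def power_divide)
  define \<pi> where "\<pi> j = min 1 (K * \<bar>\<xi> j\<bar> / (sq * \<nu>))" for j
  define r where "r j = \<xi> j / (\<nu> * \<pi> j)" for j
  have \<pi>01: "0 \<le> \<pi> j \<and> \<pi> j \<le> 1" for j using K sq \<nu> by (auto simp: \<pi>_def)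
  have \<pi>0: "\<pi> j = 0 \<longleftrightarrow> \<xi> j = 0" for j
    using K mult_pos_pos[OF sq(1) \<nu>(1)] by (auto simp: \<pi>_def min_def split: if_splits)
  have \<pi>r: "\<pi> j * r j = \<xi> j / \<nu>" for j using \<pi>0[of j] \<nu> by (cases "\<xi> j = 0") (auto simp: r_def)
  have heavy: "r j = \<xi> j / \<nu>" if "\<pi> j = 1" for j using that by (simp add: r_def)
  have light: "(r j)\<^sup>2 \<le> x" "\<bar>\<xi> j\<bar> \<le> sq * \<nu> / K" if "\<pi> j \<noteq> 1" for j
  proof -
    have p: "\<pi> j = K * \<bar>\<xi> j\<bar> / (sq * \<nu>)" and lt: "K * \<bar>\<xi> j\<bar> / (sq * \<nu>) < 1" using that by (auto simp: \<pi>_def min_def split: if_splits)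
    have "K * \<bar>\<xi> j\<bar> < sq * \<nu>" using lt sq \<nu> by (simp add: divide_less_eq)
    then show "\<bar>\<xi> j\<bar> \<le> sq * \<nu> / K" using K by (simp add: pos_le_divide_eq mult.commute)
    show "(r j)\<^sup>2 \<le> x"
    proof (cases "\<xi> j = 0")
      case True
      then show ?thesis using x by (simp add: r_def)
    next
      case False
      have "r j = (\<xi> j / \<bar>\<xi> j\<bar>) * (sq / K)" using \<nu> sq K by (simp add: r_def p field_simps)
      then have "(r j)\<^sup>2 = (\<xi> j / \<bar>\<xi> j\<bar>)\<^sup>2 * x" using x by (simp only: power_mult_distrib)
      also have "(\<xi> j / \<bar>\<xi> j\<bar>)\<^sup>2 = 1" using False by (simp add: power_divide)
      finally show ?thesis by simp
    qed
  qed
  have r_le: "(r j)\<^sup>2 \<le> x + (\<xi> j)\<^sup>2 / \<nu>\<^sup>2" for j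
  proof (cases "\<pi> j = 1")
    case True
    then show ?thesis using x by (simp add: heavy power_divide)
  next
    case False
    have "0 \<le> (\<xi> j)\<^sup>2 / \<nu>\<^sup>2" by simp
    then show ?thesis using light(1)[OF False] by linarith
  qed
  have sum\<xi>: "(\<Sum>j<q. (\<xi> j)\<^sup>2 / \<nu>\<^sup>2) = 1"
    using \<nu> by (simp add: sum_divide_distrib[symmetric])
  define A where "A T = (\<Sum>j\<in>T. \<xi> j * r j)" for T
  have a0: "0 \<le> \<xi> j * r j" for j using \<pi>01[of j] \<nu> by (simp add: r_def)
  have \<pi>a: "\<pi> j * (\<xi> j * r j) = (\<xi> j)\<^sup>2 / \<nu>" for j
    using \<pi>r[of j] by (metis mult.left_commute power2_eq_square times_divide_eq_right)
  have a_light: "\<xi> j * r j \<le> \<nu> * x" if "\<pi> j \<noteq> 1" for j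
  proof -
    have "\<bar>r j\<bar> \<le> sq / K"
    proof (rule power2_le_imp_le)
      show "\<bar>r j\<bar>\<^sup>2 \<le> (sq / K)\<^sup>2" using light(1)[OF that] x by simp
    qed (use sq K in simp)
    then have "\<bar>\<xi> j\<bar> * \<bar>r j\<bar> \<le> (sq * \<nu> / K) * (sq / K)"
      using light(2)[OF that] by (intro mult_mono) auto
    also have "\<dots> = \<nu> * (sq / K)\<^sup>2" by (simp add: power2_eq_square)
    finally show ?thesis using x abs_ge_self[of "\<xi> j * r j"] by (simp add: abs_mult)
  qed
  define G where "G = {T \<in> Pow {..<q}. real (card T) \<le> 4 * K \<and> \<nu> / 2 \<le> A T}"
  have G: "finite G" "G \<subseteq> Pow {..<q}" unfolding G_def by auto
  define Z where "Z = (\<Sum>T\<in>G. bern q \<pi> T)"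
  note b0 = bern_nonneg[OF \<pi>01, of q]
  \<comment> \<open>A Chernoff bound at exponent 1. The mean size is at most K by Cauchy-Schwarz, so
    the tail above 4 K is at most exp (2 K - 4 K) \<le> exp (-2).\<close>
  have card_tail: "(\<Sum>T\<in>Pow {..<q}. bern q \<pi> T * exp (real (card T) - 4 * K)) \<le> 1 / 4"
  proof -
    have "(\<Sum>T\<in>Pow {..<q}. bern q \<pi> T * exp (real (card T) - 4 * K))
        = exp (- (4 * K)) * (\<Sum>T\<in>Pow {..<q}. bern q \<pi> T * (\<Prod>j\<in>T. exp 1))"
    proof -
      have "exp (real (card T) - 4 * K) = exp (- (4 * K)) * (\<Prod>j\<in>T. exp 1)" for T :: "nat set"
        by (simp add: exp_of_nat_mult[of _ 1, simplified, symmetric] exp_add[symmetric])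
      then show ?thesis by (simp add: sum_distrib_left mult_ac)
    qed
    also have "\<dots> = exp (- (4 * K)) * (\<Prod>j<q. \<pi> j * exp 1 + (1 - \<pi> j))" by (simp only: bern_prod)
    also have "\<dots> \<le> exp (- (4 * K)) * (\<Prod>j<q. exp (2 * \<pi> j))"
    proof (intro mult_left_mono prod_mono conjI)
      fix j
      have e: "exp (1::real) \<le> 3" by (rule exp_le)
      have "\<pi> j * exp 1 \<le> \<pi> j * 3" using \<pi>01[of j] e by (intro mult_left_mono) auto
      then have "\<pi> j * exp 1 + (1 - \<pi> j) \<le> 1 + 2 * \<pi> j" by simp
      also have "\<dots> \<le> exp (2 * \<pi> j)" by (rule exp_ge_add_one_self)
      finally show "\<pi> j * exp 1 + (1 - \<pi> j) \<le> exp (2 * \<pi> j)" .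
      show "0 \<le> \<pi> j * exp 1 + (1 - \<pi> j)" using \<pi>01[of j] by (intro add_nonneg_nonneg) auto
    qed simp
    also have "\<dots> = exp (- (4 * K) + 2 * (\<Sum>j<q. \<pi> j))"
      by (simp add: exp_sum[symmetric] exp_add[symmetric] sum_distrib_left)
    also have "\<dots> \<le> exp (- 2)"
    proof -
      have "(\<Sum>j<q. \<pi> j) \<le> (\<Sum>j<q. K * \<bar>\<xi> j\<bar> / (sq * \<nu>))" by (intro sum_mono) (simp add: \<pi>_def)
      also have "\<dots> = K / (sq * \<nu>) * (\<Sum>j<q. \<bar>\<xi> j\<bar>)" by (simp add: sum_distrib_left)
      also have "(\<Sum>j<q. \<bar>\<xi> j\<bar>) \<le> sq * \<nu>"
      proof (rule power2_le_imp_le)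
        have "(\<Sum>j<q. 1 * \<bar>\<xi> j\<bar>)\<^sup>2 \<le> (\<Sum>j<q. 1\<^sup>2) * (\<Sum>j<q. \<bar>\<xi> j\<bar>\<^sup>2)" by (rule Cauchy_Schwarz_ineq_sum)
        then show "(\<Sum>j<q. \<bar>\<xi> j\<bar>)\<^sup>2 \<le> (sq * \<nu>)\<^sup>2" using sq \<nu> by (simp add: power_mult_distrib)
      qed (use sq \<nu> in simp)
      then have "K / (sq * \<nu>) * (\<Sum>j<q. \<bar>\<xi> j\<bar>) \<le> K / (sq * \<nu>) * (sq * \<nu>)"
        using K sq \<nu> by (intro mult_left_mono) auto
      also have "\<dots> = K" using sq \<nu> by simp
      finally show ?thesis using K by simp
    qed
    also have "\<dots> \<le> 1 / 4" by (rule exp_minus_two)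
    finally show ?thesis .
  qed
  \<comment> \<open>The lower Chernoff tail at t = 8 / \<nu>. With t \<nu> = 8 and light summands at
    most \<nu> x, the exponent is at most 4 - 8 + 32 x, which is at most -2 because x \<le>
    1/16.\<close>
  have A_tail: "(\<Sum>T\<in>Pow {..<q}. bern q \<pi> T * exp (8 / \<nu> * (\<nu> / 2 - A T))) \<le> 1 / 4"
  proof -
    define t where "t = 8 / \<nu>"
    have t: "0 < t" "t * \<nu> = 8" using \<nu> by (auto simp: t_def)
    have "(\<Sum>T\<in>Pow {..<q}. bern q \<pi> T * exp (t * (\<nu> / 2 - A T)))
        = exp 4 * (\<Sum>T\<in>Pow {..<q}. bern q \<pi> T * (\<Prod>j\<in>T. exp (- (t * (\<xi> j * r j)))))"
    proof -
      have "exp (t * (\<nu> / 2 - A T)) = exp 4 * (\<Prod>j\<in>T. exp (- (t * (\<xi> j * r j))))" if "T \<subseteq> {..<q}" for T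
      proof -
        have "finite T" using that finite_subset by auto
        moreover have "t * (\<nu> / 2 - A T) = 4 + (\<Sum>j\<in>T. - (t * (\<xi> j * r j)))"
          using t by (simp add: A_def sum_negf sum_distrib_left[symmetric] algebra_simps)
        ultimately show ?thesis by (simp add: exp_add exp_sum)
      qed
      then show ?thesis unfolding sum_distrib_left by (intro sum.cong) (auto simp: mult_ac)
    qed
    also have "\<dots> = exp 4 * (\<Prod>j<q. \<pi> j * exp (- (t * (\<xi> j * r j))) + (1 - \<pi> j))" by (simp only: bern_prod)
    also have "\<dots> \<le> exp 4 * (\<Prod>j<q. exp (- (t * ((\<xi> j)\<^sup>2 / \<nu>)) + t\<^sup>2 / 2 * x * (\<xi> j)\<^sup>2))"
    proof (intro mult_left_mono prod_mono conjI)
      fix j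
      let ?a = "\<xi> j * r j"
      show "0 \<le> \<pi> j * exp (- (t * ?a)) + (1 - \<pi> j)" using \<pi>01[of j] by (intro add_nonneg_nonneg) auto
      show "\<pi> j * exp (- (t * ?a)) + (1 - \<pi> j) \<le> exp (- (t * ((\<xi> j)\<^sup>2 / \<nu>)) + t\<^sup>2 / 2 * x * (\<xi> j)\<^sup>2)"
      proof (cases "\<pi> j = 1")
        \<comment> \<open>A coordinate that is always selected adds no fluctuation, so no quadratic
          term is spent on it.\<close>
        case True
        then have "?a = (\<xi> j)\<^sup>2 / \<nu>" using \<pi>a[of j] by simp
        moreover have "0 \<le> t\<^sup>2 / 2 * x * (\<xi> j)\<^sup>2" using x by simp
        ultimately show ?thesis using True by simp
      next
        case False
        have "0 \<le> t * ?a" using t a0[of j] by simp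
        then have "exp (- (t * ?a)) \<le> 1 - t * ?a + (t * ?a)\<^sup>2 / 2" by (rule exp_minus_le)
        then have "\<pi> j * exp (- (t * ?a)) \<le> \<pi> j * (1 - t * ?a + (t * ?a)\<^sup>2 / 2)"
          using \<pi>01[of j] by (intro mult_left_mono) auto
        also have "\<dots> = \<pi> j - t * (\<pi> j * ?a) + t\<^sup>2 / 2 * ((\<pi> j * ?a) * ?a)"
          by (simp add: algebra_simps power2_eq_square)
        also have "\<dots> \<le> \<pi> j - t * (\<pi> j * ?a) + t\<^sup>2 / 2 * ((\<pi> j * ?a) * (\<nu> * x))"
          using a_light[OF False] \<pi>01[of j] a0[of j] by (intro add_left_mono mult_left_mono) auto
        also have "\<dots> = \<pi> j - t * ((\<xi> j)\<^sup>2 / \<nu>) + t\<^sup>2 / 2 * x * (\<xi> j)\<^sup>2"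
          unfolding \<pi>a using \<nu> by (simp add: field_simps)
        finally have "\<pi> j * exp (- (t * ?a)) + (1 - \<pi> j) \<le> 1 + (- (t * ((\<xi> j)\<^sup>2 / \<nu>)) + t\<^sup>2 / 2 * x * (\<xi> j)\<^sup>2)"
          by linarith
        also have "\<dots> \<le> exp (- (t * ((\<xi> j)\<^sup>2 / \<nu>)) + t\<^sup>2 / 2 * x * (\<xi> j)\<^sup>2)" by (rule exp_ge_add_one_self)
        finally show ?thesis .
      qed
    qed simp
    also have "\<dots> = exp (4 + (- (t / \<nu>) + t\<^sup>2 / 2 * x) * (\<Sum>j<q. (\<xi> j)\<^sup>2))"
      unfolding exp_add sum_distrib_left by (subst exp_sum) (auto simp: algebra_simps exp_add[symmetric] intro!: prod.cong)
    also have "4 + (- (t / \<nu>) + t\<^sup>2 / 2 * x) * (\<Sum>j<q. (\<xi> j)\<^sup>2) = 4 - t * \<nu> + (t * \<nu>)\<^sup>2 / 2 * x"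
      unfolding \<nu>(2) using \<nu>(1) by (simp add: field_simps power2_eq_square)
    also have "exp (4 - t * \<nu> + (t * \<nu>)\<^sup>2 / 2 * x) \<le> exp (- 2)" unfolding t(2) using x(2) by simp
    also have "\<dots> \<le> 1 / 4" by (rule exp_minus_two)
    finally show ?thesis by (simp add: t_def)
  qed
  \<comment> \<open>A selection outside \<open>G\<close> is too large or has too small an A T, and
    then the corresponding exponential is at least 1. The two failures have total weight at most
    1/2.\<close>
  have Z: "1 / 2 \<le> Z"
  proof -
    have "1 = (\<Sum>T\<in>Pow {..<q}. bern q \<pi> T)" by (simp add: bern_sum)
    also have "\<dots> \<le> (\<Sum>T\<in>Pow {..<q}. (if T \<in> G then bern q \<pi> T else 0)
        + bern q \<pi> T * exp (real (card T) - 4 * K) + bern q \<pi> T * exp (8 / \<nu> * (\<nu> / 2 - A T)))"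
    proof (rule sum_mono)
      fix T assume T: "T \<in> Pow {..<q}"
      have 0: "0 \<le> bern q \<pi> T * exp (real (card T) - 4 * K)" "0 \<le> bern q \<pi> T * exp (8 / \<nu> * (\<nu> / 2 - A T))"
        using b0 by auto
      show "bern q \<pi> T \<le> (if T \<in> G then bern q \<pi> T else 0)
        + bern q \<pi> T * exp (real (card T) - 4 * K) + bern q \<pi> T * exp (8 / \<nu> * (\<nu> / 2 - A T))"
      proof (cases "T \<in> G")
        case True
        then show ?thesis using 0 by simp
      next
        case False
        then consider "4 * K < real (card T)" | "A T < \<nu> / 2" using T by (auto simp: G_def)
        then show ?thesis
        proof cases
          case 1
          then have "bern q \<pi> T * 1 \<le> bern q \<pi> T * exp (real (card T) - 4 * K)" using b0 by (intro mult_left_mono) auto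
          then show ?thesis using 0 False by simp
        next
          case 2
          then have "0 \<le> 8 / \<nu> * (\<nu> / 2 - A T)" using \<nu> by (intro mult_nonneg_nonneg) auto
          then have "1 \<le> exp (8 / \<nu> * (\<nu> / 2 - A T))" by simp
          then have "bern q \<pi> T * 1 \<le> bern q \<pi> T * exp (8 / \<nu> * (\<nu> / 2 - A T))"
            using b0 by (intro mult_left_mono) auto
          then show ?thesis using 0 False by simp
        qed
      qed
    qed
    also have "\<dots> \<le> Z + 1 / 4 + 1 / 4"
    proof -
      have "(\<Sum>T\<in>Pow {..<q}. if T \<in> G then bern q \<pi> T else 0) = (\<Sum>T\<in>Pow {..<q} \<inter> G. bern q \<pi> T)"
        by (rule sum.inter_restrict[symmetric]) simp
      also have "Pow {..<q} \<inter> G = G" using G by auto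
      finally show ?thesis using card_tail A_tail unfolding sum.distrib by (simp add: Z_def)
    qed
    finally show ?thesis by simp
  qed
  \<comment> \<open>Conditioning on G at most doubles each weight since Z \<ge> 1/2, which gives the
    factor 4 for pairs. The rescaling is at most 2 per copy, which gives the factor 4 in the
    overlaps.\<close>
  define \<omega> where "\<omega> T = bern q \<pi> T / Z" for T
  define w where "w T j = (if j \<in> T then r j * (\<nu> / A T) else 0)" for T j
  have A_pos: "0 < A T" "\<nu> / A T \<le> 2" "0 < \<nu> / A T" if "T \<in> G" for T
  proof -
    have "\<nu> / 2 \<le> A T" using that by (simp add: G_def)
    then show "0 < A T" using \<nu> by simp
    then show "\<nu> / A T \<le> 2" "0 < \<nu> / A T" using \<open>\<nu> / 2 \<le> A T\<close> \<nu> by (auto simp: divide_le_eq)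
  qed
  have T_sub: "T \<subseteq> {..<q}" "finite T" if "T \<in> G" for T
    using that G finite_subset[of T "{..<q}"] by auto
  have restr: "(\<Sum>j<q. if j \<in> T then f j else 0) = (\<Sum>j\<in>T. f j)" if "T \<in> G" for T and f :: "nat \<Rightarrow> real"
  proof -
    have "(\<Sum>j<q. if j \<in> T then f j else 0) = (\<Sum>j\<in>{..<q} \<inter> T. f j)" by (rule sum.inter_restrict[symmetric]) simp
    also have "{..<q} \<inter> T = T" using T_sub[OF that] by auto
    finally show ?thesis .
  qed
  have cross: "(\<Sum>j<q. w T j * w T' j) = (\<nu> / A T) * (\<nu> / A T') * (\<Sum>j\<in>T \<inter> T'. (r j)\<^sup>2)" if "T \<in> G" "T' \<in> G" for T T'
  proof -
    have "(\<Sum>j<q. w T j * w T' j) = (\<Sum>j<q. if j \<in> T \<inter> T' then (\<nu> / A T) * (\<nu> / A T') * (r j)\<^sup>2 else 0)"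
      by (intro sum.cong) (auto simp: w_def power2_eq_square)
    also have "\<dots> = (\<Sum>j\<in>{..<q} \<inter> (T \<inter> T'). (\<nu> / A T) * (\<nu> / A T') * (r j)\<^sup>2)"
      by (rule sum.inter_restrict[symmetric]) simp
    also have "{..<q} \<inter> (T \<inter> T') = T \<inter> T'" using T_sub that by auto
    finally show ?thesis by (simp add: sum_distrib_left)
  qed
  have cross_le: "(\<Sum>j<q. w T j * w T' j) \<le> 4 * (\<Sum>j\<in>T \<inter> T'. (r j)\<^sup>2)" "0 \<le> (\<Sum>j<q. w T j * w T' j)"
    if "T \<in> G" "T' \<in> G" for T T'
  proof -
    have s0: "0 \<le> (\<Sum>j\<in>T \<inter> T'. (r j)\<^sup>2)" by (intro sum_nonneg) auto
    have "(\<nu> / A T) * (\<nu> / A T') \<le> 2 * 2" using A_pos[OF that(1)] A_pos[OF that(2)] by (intro mult_mono) auto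
    then have "(\<nu> / A T) * (\<nu> / A T') * (\<Sum>j\<in>T \<inter> T'. (r j)\<^sup>2) \<le> 2 * 2 * (\<Sum>j\<in>T \<inter> T'. (r j)\<^sup>2)"
      by (rule mult_right_mono[OF _ s0])
    then show "(\<Sum>j<q. w T j * w T' j) \<le> 4 * (\<Sum>j\<in>T \<inter> T'. (r j)\<^sup>2)" unfolding cross[OF that] by linarith
    have "0 < (\<nu> / A T) * (\<nu> / A T')" by (rule mult_pos_pos[OF A_pos(3)[OF that(1)] A_pos(3)[OF that(2)]])
    then show "0 \<le> (\<Sum>j<q. w T j * w T' j)" unfolding cross[OF that] by (intro mult_nonneg_nonneg[OF _ s0]) linarith
  qed
  have "sparse_family q \<xi> K \<nu> G \<omega> w"
    unfolding sparse_family_def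
  proof (intro conjI ballI allI impI)
    show "weights G \<omega>"
      using Z b0 G by (auto simp: weights_def \<omega>_def sum_divide_distrib[symmetric] Z_def[symmetric])
    fix T assume T: "T \<in> G"
    show "j < q" if "w T j \<noteq> 0" for j using that T_sub[OF T] by (auto simp: w_def split: if_splits)
    have "card {j. w T j \<noteq> 0} \<le> card T" using T_sub[OF T] by (intro card_mono) (auto simp: w_def split: if_splits)
    moreover have "real (card T) \<le> 4 * K" using T by (simp add: G_def)
    ultimately show "real (card {j. w T j \<noteq> 0}) \<le> 4 * K" by linarith
    show "(\<Sum>j<q. \<xi> j * w T j) = \<nu>"
    proof -
      have "(\<Sum>j<q. \<xi> j * w T j) = (\<Sum>j<q. if j \<in> T then (\<nu> / A T) * (\<xi> j * r j) else 0)"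
        by (intro sum.cong) (auto simp: w_def)
      also have "\<dots> = (\<nu> / A T) * A T" unfolding restr[OF T] by (simp add: A_def sum_distrib_left)
      also have "\<dots> = \<nu>" using A_pos[OF T] by simp
      finally show ?thesis .
    qed
    show "(\<Sum>j<q. (w T j)\<^sup>2) \<le> 4 * (1 + 4 * real q / K)"
    proof -
      have "(\<Sum>j<q. (w T j)\<^sup>2) \<le> 4 * (\<Sum>j\<in>T. (r j)\<^sup>2)"
        using cross_le(1)[OF T T] by (simp add: power2_eq_square)
      also have "(\<Sum>j\<in>T. (r j)\<^sup>2) \<le> (\<Sum>j\<in>T. x + (\<xi> j)\<^sup>2 / \<nu>\<^sup>2)" by (intro sum_mono r_le)
      also have "\<dots> = real (card T) * x + (\<Sum>j\<in>T. (\<xi> j)\<^sup>2 / \<nu>\<^sup>2)" by (simp add: sum.distrib)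
      also have "(\<Sum>j\<in>T. (\<xi> j)\<^sup>2 / \<nu>\<^sup>2) \<le> (\<Sum>j<q. (\<xi> j)\<^sup>2 / \<nu>\<^sup>2)" using T_sub[OF T] by (intro sum_mono2) auto
      also have "real (card T) * x \<le> 4 * K * x" using T x by (intro mult_right_mono) (auto simp: G_def)
      also have "4 * K * x = 4 * real q / K" using K by (simp add: x_def power2_eq_square)
      finally show ?thesis by (simp add: sum\<xi>)
    qed
    show "0 \<le> (\<Sum>j<q. w T j * w T' j)" if "T' \<in> G" for T' by (rule cross_le(2)[OF T that])
  next
    fix l :: real assume l: "0 \<le> l" "4 * l * (real q / K\<^sup>2) \<le> 1"
    have lx: "4 * l * x \<le> 1" using l by (simp add: x_def)
    have "(\<Sum>T\<in>G. \<Sum>T'\<in>G. \<omega> T * \<omega> T' * exp (l * (\<Sum>j<q. w T j * w T' j)))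
        \<le> (\<Sum>T\<in>G. \<Sum>T'\<in>G. 4 * (bern q \<pi> T * bern q \<pi> T' * (\<Prod>j\<in>T \<inter> T'. exp (4 * l * (r j)\<^sup>2))))"
    proof (intro sum_mono)
      fix T T' assume TT: "T \<in> G" "T' \<in> G"
      have fin: "finite (T \<inter> T')" using T_sub[OF TT(1)] by auto
      have \<omega>le: "\<omega> T \<le> 2 * bern q \<pi> T" "0 \<le> \<omega> T" for T
      proof -
        have "bern q \<pi> T * 1 \<le> bern q \<pi> T * (2 * Z)" using Z b0 by (intro mult_left_mono) auto
        then show "\<omega> T \<le> 2 * bern q \<pi> T" using Z by (simp add: \<omega>_def divide_le_eq mult_ac)
        show "0 \<le> \<omega> T" using Z b0 by (simp add: \<omega>_def)
      qed
      have "\<omega> T * \<omega> T' \<le> (2 * bern q \<pi> T) * (2 * bern q \<pi> T')" using \<omega>le b0 by (intro mult_mono) auto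
      moreover have "exp (l * (\<Sum>j<q. w T j * w T' j)) \<le> (\<Prod>j\<in>T \<inter> T'. exp (4 * l * (r j)\<^sup>2))"
        using mult_left_mono[OF cross_le(1)[OF TT] l(1)] fin by (simp add: exp_sum[symmetric] sum_distrib_left mult_ac)
      ultimately have "\<omega> T * \<omega> T' * exp (l * (\<Sum>j<q. w T j * w T' j))
          \<le> ((2 * bern q \<pi> T) * (2 * bern q \<pi> T')) * (\<Prod>j\<in>T \<inter> T'. exp (4 * l * (r j)\<^sup>2))"
        using b0 \<omega>le by (intro mult_mono) auto
      then show "\<omega> T * \<omega> T' * exp (l * (\<Sum>j<q. w T j * w T' j))
          \<le> 4 * (bern q \<pi> T * bern q \<pi> T' * (\<Prod>j\<in>T \<inter> T'. exp (4 * l * (r j)\<^sup>2)))" by simp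
    qed
    also have "\<dots> \<le> (\<Sum>T\<in>Pow {..<q}. \<Sum>T'\<in>Pow {..<q}. 4 * (bern q \<pi> T * bern q \<pi> T' * (\<Prod>j\<in>T \<inter> T'. exp (4 * l * (r j)\<^sup>2))))"
    proof -
      have "(\<Sum>T\<in>G. \<Sum>T'\<in>G. 4 * (bern q \<pi> T * bern q \<pi> T' * (\<Prod>j\<in>T \<inter> T'. exp (4 * l * (r j)\<^sup>2))))
          \<le> (\<Sum>T\<in>G. \<Sum>T'\<in>Pow {..<q}. 4 * (bern q \<pi> T * bern q \<pi> T' * (\<Prod>j\<in>T \<inter> T'. exp (4 * l * (r j)\<^sup>2))))"
        using b0 G by (intro sum_mono sum_mono2) (auto intro!: mult_nonneg_nonneg prod_nonneg)
      also have "\<dots> \<le> (\<Sum>T\<in>Pow {..<q}. \<Sum>T'\<in>Pow {..<q}. 4 * (bern q \<pi> T * bern q \<pi> T' * (\<Prod>j\<in>T \<inter> T'. exp (4 * l * (r j)\<^sup>2))))"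
        using b0 G by (intro sum_mono2) (auto intro!: sum_nonneg mult_nonneg_nonneg prod_nonneg)
      finally show ?thesis .
    qed
    also have "\<dots> = 4 * (\<Prod>j<q. 1 + (\<pi> j)\<^sup>2 * (exp (4 * l * (r j)\<^sup>2) - 1))"
      unfolding bern_prod2[symmetric] by (simp add: sum_distrib_left)
    also have "\<dots> \<le> 4 * (\<Prod>j<q. exp (8 * l * ((\<xi> j)\<^sup>2 / \<nu>\<^sup>2)))"
    proof (intro mult_left_mono prod_mono conjI)
      fix j
      let ?y = "4 * l * (r j)\<^sup>2"
      have y0: "0 \<le> ?y" using l by simp
      show "0 \<le> 1 + (\<pi> j)\<^sup>2 * (exp ?y - 1)" using y0 by (intro add_nonneg_nonneg mult_nonneg_nonneg) auto
      show "1 + (\<pi> j)\<^sup>2 * (exp ?y - 1) \<le> exp (8 * l * ((\<xi> j)\<^sup>2 / \<nu>\<^sup>2))"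
      \<comment> \<open>Either way \<pi>^2 r^2 = \<xi>^2 / \<nu>^2. For light coordinates the range
        of l allows exp to be linearised at the cost of a factor 2, which turns 4 l into 8
        l.\<close>
      proof (cases "\<pi> j = 1")
        case True
        have "?y = 4 * l * ((\<xi> j)\<^sup>2 / \<nu>\<^sup>2)" by (simp add: heavy[OF True] power_divide)
        also have "\<dots> \<le> 8 * l * ((\<xi> j)\<^sup>2 / \<nu>\<^sup>2)" using l by (intro mult_right_mono) auto
        finally show ?thesis using True by simp
      next
        case False
        have "?y \<le> 4 * l * x" using light(1)[OF False] l by (intro mult_left_mono) auto
        then have "exp ?y - 1 \<le> 2 * ?y" using lx y0 by (intro exp_le_linear) auto
        then have "(\<pi> j)\<^sup>2 * (exp ?y - 1) \<le> (\<pi> j)\<^sup>2 * (2 * ?y)" by (intro mult_left_mono) auto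
        also have "\<dots> = 8 * l * (\<pi> j * r j)\<^sup>2" by (simp add: power_mult_distrib)
        also have "(\<pi> j * r j)\<^sup>2 = (\<xi> j)\<^sup>2 / \<nu>\<^sup>2" unfolding \<pi>r by (simp add: power_divide)
        finally have "1 + (\<pi> j)\<^sup>2 * (exp ?y - 1) \<le> 1 + 8 * l * ((\<xi> j)\<^sup>2 / \<nu>\<^sup>2)" by simp
        also have "\<dots> \<le> exp (8 * l * ((\<xi> j)\<^sup>2 / \<nu>\<^sup>2))" by (rule exp_ge_add_one_self)
        finally show ?thesis .
      qed
    qed simp
    also have "\<dots> = 4 * exp (8 * l)"
    proof -
      have "(\<Prod>j<q. exp (8 * l * ((\<xi> j)\<^sup>2 / \<nu>\<^sup>2))) = exp (8 * l * (\<Sum>j<q. (\<xi> j)\<^sup>2 / \<nu>\<^sup>2))"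
        by (simp only: sum_distrib_left exp_sum finite_lessThan)
      then show ?thesis by (simp only: sum\<xi> mult_1_right)
    qed
    finally show "(\<Sum>T\<in>G. \<Sum>T'\<in>G. \<omega> T * \<omega> T' * exp (l * (\<Sum>j<q. w T j * w T' j))) \<le> 4 * exp (8 * l)" .
  qed
  then show ?thesis by blast
qed

subsection \<open>A random set of column pairs\<close>

text \<open>
  The columns from \<open>q\<close> on are grouped into \<open>N\<close> blocks of \<open>B\<close> pairs, and \<open>g\<close> picks one pair in each
  block. On a pair, \<open>pair_coeff\<close> is a unit vector orthogonal to \<open>\<xi>\<close>, so the columns carrying the
  factor do not contribute to \<open>\<xi>\<^sup>T \<beta>\<close>.
\<close>

definition pair_coeff :: "nat \<Rightarrow> (nat \<Rightarrow> real) \<Rightarrow> nat \<Rightarrow> nat \<Rightarrow> real" where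
  "pair_coeff q \<xi> r b = (let x = \<xi> (q + 2 * r); y = \<xi> (q + 2 * r + 1); h = sqrt (x\<^sup>2 + y\<^sup>2) in
     if h = 0 then (if b = 0 then 1 else 0) else (if b = 0 then y / h else - x / h))"

definition pair_cols :: "nat \<Rightarrow> nat \<Rightarrow> nat \<Rightarrow> (nat \<Rightarrow> nat) \<Rightarrow> nat set" where
  "pair_cols q N B g = (\<lambda>(a, b). q + 2 * (a * B + g a) + b) ` ({..<N} \<times> {..<2})"

definition pair_dir :: "nat \<Rightarrow> nat \<Rightarrow> nat \<Rightarrow> (nat \<Rightarrow> real) \<Rightarrow> (nat \<Rightarrow> nat) \<Rightarrow> nat \<Rightarrow> real" where
  "pair_dir q N B \<xi> g l = (if l \<in> pair_cols q N B g then pair_coeff q \<xi> ((l - q) div 2) ((l - q) mod 2) else 0)"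

lemma pair_coeff_sq: "(pair_coeff q \<xi> r 0)\<^sup>2 + (pair_coeff q \<xi> r (Suc 0))\<^sup>2 = 1"
  and pair_coeff_orth: "\<xi> (q + 2 * r) * pair_coeff q \<xi> r 0 + \<xi> (q + 2 * r + 1) * pair_coeff q \<xi> r (Suc 0) = 0"
proof -
  define x y where "x = \<xi> (q + 2 * r)" and "y = \<xi> (q + 2 * r + 1)"
  define h where "h = sqrt (x\<^sup>2 + y\<^sup>2)"
  have h2: "h\<^sup>2 = x\<^sup>2 + y\<^sup>2" by (simp add: h_def)
  have c: "pair_coeff q \<xi> r 0 = (if h = 0 then 1 else y / h)" "pair_coeff q \<xi> r (Suc 0) = (if h = 0 then 0 else - x / h)"
    by (simp_all add: pair_coeff_def Let_def x_def y_def h_def)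
  show "(pair_coeff q \<xi> r 0)\<^sup>2 + (pair_coeff q \<xi> r (Suc 0))\<^sup>2 = 1"
  proof (cases "h = 0")
    case False
    have "(y / h)\<^sup>2 + (- x / h)\<^sup>2 = (x\<^sup>2 + y\<^sup>2) / h\<^sup>2" by (simp add: power_divide add_divide_distrib)
    then show ?thesis using False by (simp add: c h2[symmetric])
  qed (simp add: c)
  show "\<xi> (q + 2 * r) * pair_coeff q \<xi> r 0 + \<xi> (q + 2 * r + 1) * pair_coeff q \<xi> r (Suc 0) = 0"
  proof (cases "h = 0")
    case True
    then have "x = 0" using h2 by (simp add: sum_power2_eq_zero_iff)
    then show ?thesis unfolding x_def[symmetric] y_def[symmetric] c using True by simp
  next
    case False
    then show ?thesis unfolding x_def[symmetric] y_def[symmetric] c by simp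
  qed
qed

text \<open>Parity recovers the position in the pair, and division by \<open>B\<close> the block,
  because the offset within a block is below \<open>B\<close>.\<close>

lemma pair_index_inj:
  assumes "g a < B" "g' a' < B" "b < 2" "b' < (2::nat)"
    and eq: "q + 2 * (a * B + g a) + b = q + 2 * (a' * B + g' a') + b'"
  shows "a = a' \<and> b = b' \<and> g a = g' a'"
proof -
  have e: "2 * (a * B + g a) + b = 2 * (a' * B + g' a') + b'" using eq by simp
  have "(2 * k + c) mod 2 = c" if "c < 2" for k c :: nat using that by auto
  then have "(2 * (a * B + g a) + b) mod 2 = b" "(2 * (a' * B + g' a') + b') mod 2 = b'" using assms by blast+
  then have b: "b = b'" using e by metis
  then have r: "a * B + g a = a' * B + g' a'" using e by simp
  have "(a * B + g a) div B = a" "(a' * B + g' a') div B = a'" using assms by auto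
  then have "a = a'" using r by simp
  then show ?thesis using b r by simp
qed

lemma pair_cols_inj:
  fixes q N B :: nat
  assumes "\<And>a. a < N \<Longrightarrow> g a < B"
  shows "inj_on (\<lambda>(a, b). q + 2 * (a * B + g a) + b) ({..<N} \<times> {..<2})"
proof (rule inj_onI)
  fix u v :: "nat \<times> nat"
  assume u: "u \<in> {..<N} \<times> {..<2}" and v: "v \<in> {..<N} \<times> {..<2}"
    and "(\<lambda>(a, b). q + 2 * (a * B + g a) + b) u = (\<lambda>(a, b). q + 2 * (a * B + g a) + b) v"
  then have "q + 2 * (fst u * B + g (fst u)) + snd u = q + 2 * (fst v * B + g (fst v)) + snd v"
    by (simp only: split_beta)
  then have "fst u = fst v \<and> snd u = snd v \<and> g (fst u) = g (fst v)"
    using u v assms by (intro pair_index_inj[of g _ B g]) auto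
  then show "u = v" by (simp add: prod_eq_iff)
qed

lemma pair_dir_at:
  assumes "a < N" "b < 2"
  shows "pair_dir q N B \<xi> g (q + 2 * (a * B + g a) + b) = pair_coeff q \<xi> (a * B + g a) b"
proof -
  have "q + 2 * (a * B + g a) + b \<in> pair_cols q N B g" using assms by (force simp: pair_cols_def)
  moreover have "(q + 2 * (a * B + g a) + b - q) div 2 = a * B + g a" "(q + 2 * (a * B + g a) + b - q) mod 2 = b"
    using assms(2) by auto
  ultimately show ?thesis by (simp only: pair_dir_def if_True)
qed

lemma sum_pair_dir:
  fixes F :: "nat \<Rightarrow> real \<Rightarrow> real"
  assumes g: "\<And>a. a < N \<Longrightarrow> g a < B" and p: "q + 2 * (N * B) \<le> p" and F0: "\<And>l. F l 0 = 0"
  shows "(\<Sum>l<p. F l (pair_dir q N B \<xi> g l))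
    = (\<Sum>a<N. F (q + 2 * (a * B + g a)) (pair_coeff q \<xi> (a * B + g a) 0)
           + F (q + 2 * (a * B + g a) + 1) (pair_coeff q \<xi> (a * B + g a) (Suc 0)))"
proof -
  have sub: "pair_cols q N B g \<subseteq> {q..<p}"
  proof
    fix l assume "l \<in> pair_cols q N B g"
    then obtain a b where l: "l = q + 2 * (a * B + g a) + b" "a < N" "b < 2" by (auto simp: pair_cols_def)
    have "a * B + g a < (a + 1) * B" using g[OF l(2)] by simp
    also have "(a + 1) * B \<le> N * B" using l(2) by (intro mult_right_mono) auto
    finally show "l \<in> {q..<p}" using l p by auto
  qed
  have "(\<Sum>l<p. F l (pair_dir q N B \<xi> g l)) = (\<Sum>l\<in>pair_cols q N B g. F l (pair_dir q N B \<xi> g l))"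
    using sub by (intro sum.mono_neutral_right) (auto simp: pair_dir_def F0)
  also have "\<dots> = (\<Sum>(a, b)\<in>{..<N} \<times> {..<2}. F (q + 2 * (a * B + g a) + b) (pair_dir q N B \<xi> g (q + 2 * (a * B + g a) + b)))"
    unfolding pair_cols_def by (subst sum.reindex[OF pair_cols_inj[OF g]]) (auto intro!: sum.cong)
  also have "\<dots> = (\<Sum>(a, b)\<in>{..<N} \<times> {..<2}. F (q + 2 * (a * B + g a) + b) (pair_coeff q \<xi> (a * B + g a) b))"
  proof (rule sum.cong[OF refl])
    fix u :: "nat \<times> nat" assume "u \<in> {..<N} \<times> {..<2}"
    then show "(case u of (a, b) \<Rightarrow> F (q + 2 * (a * B + g a) + b) (pair_dir q N B \<xi> g (q + 2 * (a * B + g a) + b)))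
        = (case u of (a, b) \<Rightarrow> F (q + 2 * (a * B + g a) + b) (pair_coeff q \<xi> (a * B + g a) b))"
      by (cases u) (auto simp only: prod.case mem_Sigma_iff lessThan_iff pair_dir_at)
  qed
  also have "\<dots> = (\<Sum>a<N. \<Sum>b<2. F (q + 2 * (a * B + g a) + b) (pair_coeff q \<xi> (a * B + g a) b))"
    by (rule sum.cartesian_product[symmetric])
  finally show ?thesis by (simp add: numeral_2_eq_2)
qed

lemma pair_cols_range:
  assumes g: "\<And>a. a < N \<Longrightarrow> g a < B" and "l \<in> pair_cols q N B g"
  shows "q \<le> l \<and> l < q + 2 * (N * B)"
proof -
  obtain a b where l: "l = q + 2 * (a * B + g a) + b" "a < N" "b < 2" using assms(2) by (auto simp: pair_cols_def)
  have "a * B + g a < (a + 1) * B" using g[OF l(2)] by simp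
  also have "(a + 1) * B \<le> N * B" using l(2) by (intro mult_right_mono) auto
  finally show ?thesis using l by auto
qed

lemma pair_dir_norm:
  assumes "\<And>a. a < N \<Longrightarrow> g a < B" "q + 2 * (N * B) \<le> p"
  shows "(\<Sum>l<p. (pair_dir q N B \<xi> g l)\<^sup>2) = real N"
  by (subst sum_pair_dir[OF assms, where F = "\<lambda>_ x. x\<^sup>2"]) (simp_all add: pair_coeff_sq)

lemma pair_dir_orth:
  assumes "\<And>a. a < N \<Longrightarrow> g a < B" "q + 2 * (N * B) \<le> p"
  shows "(\<Sum>l<p. \<xi> l * pair_dir q N B \<xi> g l) = 0"
  by (subst sum_pair_dir[OF assms, where F = "\<lambda>l x. \<xi> l * x"]) (simp_all only: pair_coeff_orth sum.neutral_const mult_zero_right)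

lemma pair_dir_le_one: "\<bar>pair_dir q N B \<xi> g l\<bar> \<le> 1"
proof -
  have "\<bar>pair_coeff q \<xi> r b\<bar> \<le> 1" if "b < 2" for r b
  proof -
    have "(pair_coeff q \<xi> r b)\<^sup>2 \<le> (pair_coeff q \<xi> r 0)\<^sup>2 + (pair_coeff q \<xi> r (Suc 0))\<^sup>2"
      using that by (cases b) auto
    then show ?thesis by (simp add: pair_coeff_sq abs_square_le_1)
  qed
  then show ?thesis by (simp add: pair_dir_def)
qed

lemma card_pair_cols: "card (pair_cols q N B g) \<le> 2 * N" "finite (pair_cols q N B g)"
proof -
  show "finite (pair_cols q N B g)" by (simp add: pair_cols_def)
  have "card (pair_cols q N B g) \<le> card ({..<N} \<times> {..<(2::nat)})" unfolding pair_cols_def by (rule card_image_le) simp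
  then show "card (pair_cols q N B g) \<le> 2 * N" by simp
qed

definition agree :: "nat \<Rightarrow> (nat \<Rightarrow> nat) \<Rightarrow> (nat \<Rightarrow> nat) \<Rightarrow> nat" where
  "agree N g g' = card {a. a < N \<and> g a = g' a}"

lemma card_pair_cols_Int:
  assumes g: "\<And>a. a < N \<Longrightarrow> g a < B" "\<And>a. a < N \<Longrightarrow> g' a < B"
  shows "card (pair_cols q N B g \<inter> pair_cols q N B g') \<le> 2 * agree N g g'"
    and "agree N g g' = 0 \<Longrightarrow> pair_cols q N B g \<inter> pair_cols q N B g' = {}"
proof -
  let ?E = "{a. a < N \<and> g a = g' a}"
  have sub: "pair_cols q N B g \<inter> pair_cols q N B g' \<subseteq> (\<lambda>(a, b). q + 2 * (a * B + g a) + b) ` (?E \<times> {..<2})"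
  proof
    fix l assume "l \<in> pair_cols q N B g \<inter> pair_cols q N B g'"
    then have "l \<in> pair_cols q N B g" "l \<in> pair_cols q N B g'" by auto
    then obtain a b a' b' where l: "l = q + 2 * (a * B + g a) + b" "a < N" "b < 2"
      and l': "l = q + 2 * (a' * B + g' a') + b'" "a' < N" "b' < 2"
      unfolding pair_cols_def by (elim imageE) (auto simp only: split_beta mem_Times_iff lessThan_iff)
    have "q + 2 * (a * B + g a) + b = q + 2 * (a' * B + g' a') + b'" using l(1) l'(1) by (rule subst)
    then have "a = a' \<and> b = b' \<and> g a = g' a'" by (intro pair_index_inj[of g a B g' a' b b' q]) (use g l l' in auto)
    then show "l \<in> (\<lambda>(a, b). q + 2 * (a * B + g a) + b) ` (?E \<times> {..<2})" using l by force
  qed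
  have "card (pair_cols q N B g \<inter> pair_cols q N B g') \<le> card (?E \<times> {..<(2::nat)})"
  proof -
    have fin: "finite (?E \<times> {..<(2::nat)})" by auto
    have "card (pair_cols q N B g \<inter> pair_cols q N B g') \<le> card ((\<lambda>(a, b). q + 2 * (a * B + g a) + b) ` (?E \<times> {..<2}))"
      by (rule card_mono[OF finite_imageI[OF fin] sub])
    also have "\<dots> \<le> card (?E \<times> {..<(2::nat)})" by (rule card_image_le[OF fin])
    finally show ?thesis .
  qed
  then show "card (pair_cols q N B g \<inter> pair_cols q N B g') \<le> 2 * agree N g g'" by (simp add: agree_def)
  show "pair_cols q N B g \<inter> pair_cols q N B g' = {}" if "agree N g g' = 0"
    using sub that by (auto simp: agree_def)
qed

text \<open>For independent uniform g and g' the N blocks agree independently, each with probability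
  1 / B, so this is the generating function of a binomial variable.\<close>

lemma agree_sum:
  fixes z :: real
  assumes "0 < B"
  shows "(\<Sum>g\<in>{..<N} \<rightarrow>\<^sub>E {..<B}. \<Sum>g'\<in>{..<N} \<rightarrow>\<^sub>E {..<B}. (1 / real B ^ N) * (1 / real B ^ N) * z ^ agree N g g')
    = (1 + (z - 1) / real B) ^ N"
proof -
  have pw: "z ^ agree N g g' = (\<Prod>a<N. if g a = g' a then z else 1)" for g g'
  proof -
    have "(\<Prod>a<N. if g a = g' a then z else 1) = (\<Prod>a\<in>{..<N} \<inter> {a. g a = g' a}. z)"
      by (subst prod.inter_restrict) auto
    also have "{..<N} \<inter> {a. g a = g' a} = {a. a < N \<and> g a = g' a}" by auto
    finally show ?thesis by (simp add: agree_def)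
  qed
  have inner: "(\<Sum>g'\<in>{..<N} \<rightarrow>\<^sub>E {..<B}. z ^ agree N g g') = (z + (real B - 1)) ^ N"
    if g: "g \<in> {..<N} \<rightarrow>\<^sub>E {..<B}" for g
  proof -
    have "(\<Sum>g'\<in>{..<N} \<rightarrow>\<^sub>E {..<B}. z ^ agree N g g') = (\<Prod>a<N. \<Sum>b<B. if g a = b then z else 1)"
      unfolding pw by (rule prod_sum_PiE[symmetric]) auto
    also have "\<dots> = (\<Prod>a<N. z + (real B - 1))"
    proof (intro prod.cong refl)
      fix a assume "a \<in> {..<N}"
      then have ga: "g a \<in> {..<B}" using g by auto
      have "(\<Sum>b<B. if g a = b then z else 1) = (\<Sum>b<B. 1 + (if b = g a then z - 1 else 0))"
        by (intro sum.cong) auto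
      also have "\<dots> = real B + (z - 1)" using ga by (simp add: sum.distrib)
      finally show "(\<Sum>b<B. if g a = b then z else 1) = z + (real B - 1)" by simp
    qed
    finally show ?thesis by simp
  qed
  have "(\<Sum>g\<in>{..<N} \<rightarrow>\<^sub>E {..<B}. \<Sum>g'\<in>{..<N} \<rightarrow>\<^sub>E {..<B}. (1 / real B ^ N) * (1 / real B ^ N) * z ^ agree N g g')
      = (\<Sum>g\<in>{..<N} \<rightarrow>\<^sub>E {..<B}. (1 / real B ^ N) * (1 / real B ^ N) * (z + (real B - 1)) ^ N)"
    by (intro sum.cong refl) (simp only: sum_distrib_left[symmetric] inner)
  also have "\<dots> = real (card ({..<N} \<rightarrow>\<^sub>E {..<B})) * ((1 / real B ^ N) * (1 / real B ^ N) * (z + (real B - 1)) ^ N)"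
    by simp
  also have "card ({..<N} \<rightarrow>\<^sub>E {..<B}) = B ^ N" by (simp add: card_PiE)
  also have "real (B ^ N) * ((1 / real B ^ N) * (1 / real B ^ N) * (z + (real B - 1)) ^ N) = ((z + (real B - 1)) / real B) ^ N"
    using assms by (simp add: power_divide)
  also have "(z + (real B - 1)) / real B = 1 + (z - 1) / real B" using assms by (simp add: field_simps)
  finally show ?thesis .
qed

text \<open>Choices without agreement are left out because there the second moment is exactly 1 and
  adds nothing to the divergence. For r \<ge> 1 and z \<ge> 2 one has z^r \<le> 2 (z^r - 1), which
  reduces the sum to the generating function minus 1.\<close>

lemma agree_tail:
  fixes z :: real
  assumes B: "0 < B" and z: "2 \<le> z"
  shows "(\<Sum>g\<in>{..<N} \<rightarrow>\<^sub>E {..<B}. \<Sum>g'\<in>{..<N} \<rightarrow>\<^sub>E {..<B}. (1 / real B ^ N) * (1 / real B ^ N)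
           * (if agree N g g' = 0 then 0 else z ^ agree N g g'))
    \<le> 2 * (exp (z * real N / real B) - 1)"
proof -
  let ?G = "{..<N} \<rightarrow>\<^sub>E {..<B}"
  let ?c = "(1 / real B ^ N) * (1 / real B ^ N)"
  have "(\<Sum>g\<in>?G. \<Sum>g'\<in>?G. ?c * (if agree N g g' = 0 then 0 else z ^ agree N g g'))
      \<le> (\<Sum>g\<in>?G. \<Sum>g'\<in>?G. 2 * (?c * z ^ agree N g g') - 2 * (?c * 1 ^ agree N g g'))"
  proof (intro sum_mono)
    fix g g'
    have le: "(if agree N g g' = 0 then 0 else z ^ agree N g g') \<le> 2 * (z ^ agree N g g' - 1)"
    proof (cases "agree N g g' = 0")
      case False
      have "z ^ 1 \<le> z ^ agree N g g'" using False z by (intro power_increasing) auto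
      then show ?thesis using z False by simp
    qed simp
    have "?c * (if agree N g g' = 0 then 0 else z ^ agree N g g') \<le> ?c * (2 * (z ^ agree N g g' - 1))"
      by (rule mult_left_mono[OF le]) simp
    then show "?c * (if agree N g g' = 0 then 0 else z ^ agree N g g') \<le> 2 * (?c * z ^ agree N g g') - 2 * (?c * 1 ^ agree N g g')"
      by (simp only: right_diff_distrib power_one mult_1_right mult.left_commute)
  qed
  also have "\<dots> = 2 * (1 + (z - 1) / real B) ^ N - 2 * (1 + (1 - 1) / real B) ^ N"
  proof -
    have "(\<Sum>g\<in>?G. \<Sum>g'\<in>?G. 2 * f g g' - 2 * h g g') = 2 * (\<Sum>g\<in>?G. \<Sum>g'\<in>?G. f g g') - 2 * (\<Sum>g\<in>?G. \<Sum>g'\<in>?G. h g g')"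
      for f h :: "(nat \<Rightarrow> nat) \<Rightarrow> (nat \<Rightarrow> nat) \<Rightarrow> real"
      by (simp add: sum_subtractf sum_distrib_left)
    then show ?thesis unfolding agree_sum[OF B, symmetric] .
  qed
  also have "(1 + (z - 1) / real B) ^ N \<le> exp (z / real B) ^ N"
  proof (rule power_mono)
    have "1 + (z - 1) / real B \<le> 1 + z / real B" using B by (simp add: divide_right_mono)
    also have "\<dots> \<le> exp (z / real B)" by (rule exp_ge_add_one_self)
    finally show "1 + (z - 1) / real B \<le> exp (z / real B)" .
    show "0 \<le> 1 + (z - 1) / real B" using z by simp
  qed
  also have "exp (z / real B) ^ N = exp (z * real N / real B)" by (simp add: exp_of_nat_mult[symmetric] mult.commute)
  finally show ?thesis by simp
qed

subsection \<open>The two priors at a fixed sample size\<close>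

text \<open>The squared gap of the means is compared with the variance under the second mixture
  alone. As weak separation refers to the larger of the two variances, a small \<open>e\<close> is
  enough to refute it.\<close>

definition good_priors :: "nat \<Rightarrow> nat \<Rightarrow> nat \<Rightarrow> param set \<Rightarrow> param set \<Rightarrow> param measure \<Rightarrow> param measure \<Rightarrow> real \<Rightarrow> bool" where
  "good_priors n p D T1 T2 \<pi>1 \<pi>2 e \<longleftrightarrow> prior_on p T1 \<pi>1 \<and> prior_on p T2 \<pi>2 \<and>
     (\<forall>f\<in>polynomials n p D. \<forall>Q\<in>{mixture n p \<pi>1, mixture n p \<pi>2}. integrable Q f \<and> integrable Q (\<lambda>z. (f z)\<^sup>2)) \<and>
     (\<forall>f\<in>polynomials n p D. ((\<integral>z. f z \<partial>mixture n p \<pi>1) - (\<integral>z. f z \<partial>mixture n p \<pi>2))\<^sup>2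
        \<le> e * (\<integral>z. (f z - (\<integral>z. f z \<partial>mixture n p \<pi>2))\<^sup>2 \<partial>mixture n p \<pi>2))"

section \<open>Polynomials under finite mixtures\<close>

lemma measurable_coord_data: "v \<in> coord_set n p \<Longrightarrow> (\<lambda>z. coord z v) \<in> borel_measurable (data_algebra n p)"
proof -
  assume "v \<in> coord_set n p"
  then have v: "fst v \<in> {..<n}" "snd v \<in> obs_idx p" by (auto simp: coord_set_eq)
  have "(\<lambda>z. z (fst v)) \<in> measurable (data_algebra n p) (obs_algebra p)"
    unfolding data_algebra_def obs_algebra_def[symmetric] by (rule measurable_component_singleton[OF v(1)])
  then show ?thesis
    unfolding coord_eq by (rule measurable_compose[OF _ measurable_obs_coord[OF v(2)]])
qed

lemma measurable_polynomial:
  assumes "f \<in> polynomials n p D"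
  shows "f \<in> borel_measurable (data_algebra n p)"
proof -
  obtain M c where f: "\<forall>m\<in>M. set_mset m \<subseteq> coord_set n p \<and> size m \<le> D" "f = (\<lambda>z. \<Sum>m\<in>M. c m * (\<Prod>v\<in>#m. coord z v))"
    using assms by (auto simp: polynomials_def)
  have "(\<lambda>z. \<Prod>v\<in>#m. coord z v) \<in> borel_measurable (data_algebra n p)" if "set_mset m \<subseteq> coord_set n p" for m
    using that by (induction m) (auto intro!: borel_measurable_times measurable_coord_data)
  then show ?thesis unfolding f(2)
    using f(1) by (intro borel_measurable_sum borel_measurable_times borel_measurable_const) auto
qed

lemma mixture_polynomial:
  assumes w: "weights I wt" and sp: "\<forall>k\<in>I. \<theta> k \<in> space (param_algebra p)" and pos: "\<forall>k\<in>I. snd (snd (\<theta> k)) > 0"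
    and f: "f \<in> polynomials n p D"
  defines "Q \<equiv> mixture n p (finite_prior p I wt \<theta>)"
  shows "integrable Q f" "integrable Q (\<lambda>z. (f z - c)\<^sup>2)"
    and "(\<integral>z. f z \<partial>Q) = (\<Sum>k\<in>I. wt k * (\<integral>z. f z \<partial>data_law n p (\<theta> k)))"
    and "(\<integral>z. (f z - c)\<^sup>2 \<partial>Q) = (\<Sum>k\<in>I. wt k * (\<integral>z. (f z - c)\<^sup>2 \<partial>data_law n p (\<theta> k)))"
proof -
  have fm [measurable]: "f \<in> borel_measurable (data_algebra n p)" by (rule measurable_polynomial[OF f])
  have fcm: "(\<lambda>z. (f z - c)\<^sup>2) \<in> borel_measurable (data_algebra n p)" by measurable
  have am: "all_moments (data_law n p (\<theta> k)) f" if "k \<in> I" for k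
    using pos that by (intro all_moments_polynomial[OF _ f]) auto
  have i1: "integrable (data_law n p (\<theta> k)) f" if "k \<in> I" for k by (rule all_moments_integrable[OF am[OF that]])
  have i2: "integrable (data_law n p (\<theta> k)) (\<lambda>z. (f z - c)\<^sup>2)" if "k \<in> I" for k
  proof -
    have fin: "finite_measure (data_law n p (\<theta> k))"
      using pos that by (intro prob_space.finite_measure prob_space_data_law) auto
    have "all_moments (data_law n p (\<theta> k)) (\<lambda>z. (f z + (- c)) * (f z + (- c)))"
      by (intro all_moments_mult all_moments_add all_moments_const am[OF that] fin)
    then show ?thesis using all_moments_integrable by (fastforce simp: power2_eq_square)
  qed
  show "integrable Q f" unfolding Q_def by (rule mixture_integral(1)[OF w sp pos fm i1])
  show "integrable Q (\<lambda>z. (f z - c)\<^sup>2)" unfolding Q_def by (rule mixture_integral(1)[OF w sp pos fcm i2])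
  show "(\<integral>z. f z \<partial>Q) = (\<Sum>k\<in>I. wt k * (\<integral>z. f z \<partial>data_law n p (\<theta> k)))"
    unfolding Q_def by (rule mixture_integral(2)[OF w sp pos fm i1])
  show "(\<integral>z. (f z - c)\<^sup>2 \<partial>Q) = (\<Sum>k\<in>I. wt k * (\<integral>z. (f z - c)\<^sup>2 \<partial>data_law n p (\<theta> k)))"
    unfolding Q_def by (rule mixture_integral(2)[OF w sp pos fcm i2])
qed

lemma weights_single: "weights {()} (\<lambda>_. 1)"
  by (simp add: weights_def)

text \<open>For spaces with a common parameter: both priors are the point mass there and all gaps
  vanish. Used when the threshold is 0.\<close>

lemma good_priors_common:
  assumes \<theta>: "\<theta> \<in> T1" "\<theta> \<in> T2" "\<theta> \<in> space (param_algebra p)" "snd (snd \<theta>) > 0"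
  shows "\<exists>\<pi>1 \<pi>2. good_priors n p D T1 T2 \<pi>1 \<pi>2 0"
proof -
  let ?\<pi> = "finite_prior p {()} (\<lambda>_. 1) (\<lambda>_. \<theta>)"
  have sp: "\<forall>k\<in>{()}. (\<lambda>_. \<theta>) k \<in> space (param_algebra p)" and pos: "\<forall>k\<in>{()}. snd (snd ((\<lambda>_. \<theta>) k)) > 0" using \<theta> by auto
  have "prior_on p T1 ?\<pi>" "prior_on p T2 ?\<pi>"
    using prior_on_finite_prior[OF weights_single sp] \<theta> by auto
  moreover have "integrable (mixture n p ?\<pi>) f \<and> integrable (mixture n p ?\<pi>) (\<lambda>z. (f z)\<^sup>2)" if "f \<in> polynomials n p D" for f
    using mixture_polynomial(1)[OF weights_single sp pos that] mixture_polynomial(2)[OF weights_single sp pos that, of 0] by simp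
  ultimately have "good_priors n p D T1 T2 ?\<pi> ?\<pi> 0" by (auto simp: good_priors_def)
  then show ?thesis by blast
qed

text \<open>For the finitely many indices at which the asymptotic conditions fail: admissible priors
  still have to exist there, but no bound on the gap is asked for.\<close>

lemma good_priors_distinct:
  assumes \<theta>1: "\<theta>1 \<in> T1" "\<theta>1 \<in> space (param_algebra p)" "snd (snd \<theta>1) > 0"
    and \<theta>2: "\<theta>2 \<in> T2" "\<theta>2 \<in> space (param_algebra p)" "snd (snd \<theta>2) > 0"
  shows "\<exists>\<pi>1 \<pi>2. prior_on p T1 \<pi>1 \<and> prior_on p T2 \<pi>2 \<and>
     (\<forall>f\<in>polynomials n p D. \<forall>Q\<in>{mixture n p \<pi>1, mixture n p \<pi>2}. integrable Q f \<and> integrable Q (\<lambda>z. (f z)\<^sup>2))"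
proof -
  obtain \<pi>1 \<pi>1' where 1: "good_priors n p D T1 UNIV \<pi>1 \<pi>1' 0"
    using good_priors_common[of \<theta>1 T1 UNIV p n D] \<theta>1 by auto
  obtain \<pi>2 \<pi>2' where 2: "good_priors n p D T2 UNIV \<pi>2 \<pi>2' 0"
    using good_priors_common[of \<theta>2 T2 UNIV p n D] \<theta>2 by auto
  show ?thesis
    by (intro exI[of _ \<pi>1] exI[of _ \<pi>2]) (use 1 2 in \<open>auto simp: good_priors_def\<close>)
qed

text \<open>Here \<open>lp\<close> stands for log p and enters only through inequalities. 1024 \<le>
  lp yields q / K^2 \<le> 1/16 for K = k_u / 8; \<eta> \<le> 1/256 keeps the exponent within the
  range of the overlap bound; the two bounds on \<eta> (C2 + 16) give square integrability and the
  eigenvalue bounds. The number z is the cost of one shared pair.\<close>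

lemma construction:
  fixes n p ku k D q B :: nat and \<xi> :: "nat \<Rightarrow> real" and t0 M1 M2 C2 \<eta> c lp :: real
  assumes M: "M1 > 1" "M2 > 0" and C2: "C2 > 0"
    and \<eta>: "\<eta> > 0" "\<eta> \<le> 1 / 256" "\<eta> * (C2 + 16) \<le> 1 / 16" "\<eta> * (C2 + 16) \<le> ((1 - 1 / M1) / 3)\<^sup>2"
    and n: "0 < n" and lp: "1024 \<le> lp" and q: "1 \<le> q" "real q * lp \<le> real n" "real q * (real D * lp) \<le> (real ku)\<^sup>2"
    and ku: "real ku * lp \<le> C2 * real n" "8 \<le> ku" and D: "1 \<le> D" and k: "1 \<le> k" and \<xi>0: "\<xi> 0 \<noteq> 0"
    and B: "0 < B" "q + 2 * (ku div 8 * B) < p" and c: "0 < c" "c \<le> M2 * \<eta> / 32"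
  defines "z \<equiv> 32 * exp (2 * \<eta> * lp * (9 + 128 * (13 * C2 + 32768)))"
  shows "\<exists>\<pi>1 \<pi>2. good_priors n p D (Theta_null M1 M2 p ku \<xi> t0)
     (Theta_alt M1 M2 p k \<xi> t0 (c * sqrt (\<Sum>j<q. (\<xi> j)\<^sup>2) * (real ku * lp / real n))) \<pi>1 \<pi>2
     (2 * (exp (z * real (ku div 8) / real B) - 1))"
proof -
  \<comment> \<open>The budget for the support of \<beta> is 1 + 2 N + 4 K \<le> 1 + k_u / 4 + k_u /
    2, which is at most k_u because k_u \<ge> 8.\<close>
  define N where "N = ku div 8"
  define K where "K = real ku / 8"
  define \<nu> where "\<nu> = sqrt (\<Sum>j<q. (\<xi> j)\<^sup>2)"
  have N_ku: "real N \<le> real ku / 8" "real ku / 16 \<le> real N"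
  proof -
    have "8 * N \<le> ku" "ku \<le> 16 * N" using ku(2) unfolding N_def by presburger+
    then have "real (8 * N) \<le> real ku" "real ku \<le> real (16 * N)" by (simp_all only: of_nat_le_iff)
    then show "real N \<le> real ku / 8" "real ku / 16 \<le> real N" by simp_all
  qed
  have ku0: "0 < real ku" using ku(2) by simp
  have lp0: "0 < lp" using lp by simp
  have n0: "0 < real n" using n by simp
  have D0: "1 \<le> real D" using D by simp
  have p0: "0 < p" and pq: "q < p" using B by auto
  have \<nu>2: "(\<Sum>j<q. (\<xi> j)\<^sup>2) = \<nu>\<^sup>2" by (simp add: \<nu>_def sum_nonneg)
  have \<nu>0: "0 < \<nu>"
  proof -
    have "0 < (\<Sum>j<q. (\<xi> j)\<^sup>2)" using q(1) \<xi>0 by (intro sum_pos2[of _ 0]) auto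
    then show ?thesis by (simp add: \<nu>_def)
  qed
  have qD: "real q * lp * real D / (real ku)\<^sup>2 \<le> 1" using q(3) ku0 by (simp add: divide_le_eq mult_ac)
  have q_ku: "real q * 1024 \<le> (real ku)\<^sup>2"
  proof -
    have "1024 * 1 \<le> lp * real D" using lp D0 by (intro mult_mono) auto
    then have "real q * 1024 \<le> real q * (real D * lp)" by (intro mult_left_mono) (auto simp: mult.commute)
    then show ?thesis using q(3) by linarith
  qed
  have q0: "0 < q" using q(1) by simp
  have K: "1 \<le> K" using ku(2) by (simp add: K_def)
  have qK: "real q / K\<^sup>2 \<le> 1 / 16" using q_ku ku0 by (simp add: K_def power_divide divide_le_eq)
  obtain I \<omega> w where sf: "sparse_family q \<xi> K \<nu> I \<omega> w"
    using sparse_design[OF K q0 qK \<nu>0 \<nu>2] by blast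
  note sf' = sf[unfolded sparse_family_def]
  have I: "weights I \<omega>" using sf' by blast
  have w_supp: "j < q" if "T \<in> I" "w T j \<noteq> 0" for T j using sf' that by blast
  have w_card: "real (card {j. w T j \<noteq> 0}) \<le> 4 * K" if "T \<in> I" for T using sf' that by blast
  have w_\<xi>: "(\<Sum>j<q. \<xi> j * w T j) = \<nu>" if "T \<in> I" for T using sf' that by blast
  have w_norm: "(\<Sum>j<q. (w T j)\<^sup>2) \<le> 4 * (1 + 4 * real q / K)" if "T \<in> I" for T using sf' that by blast
  have w_nonneg: "0 \<le> (\<Sum>j<q. w T j * w T' j)" if "T \<in> I" "T' \<in> I" for T T' using sf' that by blast
  have w_exp: "(\<Sum>T\<in>I. \<Sum>T'\<in>I. \<omega> T * \<omega> T' * exp (l * (\<Sum>j<q. w T j * w T' j))) \<le> 4 * exp (8 * l)"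
    if "0 \<le> l" "4 * l * (real q / K\<^sup>2) \<le> 1" for l using sf' that by blast
  have I\<omega>: "finite I" "\<And>T. T \<in> I \<Longrightarrow> 0 \<le> \<omega> T" "(\<Sum>T\<in>I. \<omega> T) = 1" using I by (auto simp: weights_def)
  have to_q: "(\<Sum>j<p. f j * w T j) = (\<Sum>j<q. f j * w T j)" if "T \<in> I" for f T
  proof (rule sum.mono_neutral_right)
    show "\<forall>j\<in>{..<p} - {..<q}. f j * w T j = 0" using w_supp[OF that] by fastforce
  qed (use pq in auto)
  have inner_w: "inner_on p (w T) (w T') = (\<Sum>j<q. w T j * w T' j)" if "T' \<in> I" for T T'
    unfolding inner_on_def by (rule to_q[OF that])
  \<comment> \<open>This is 1 + 4 (1 + 4 q / K) with K = k_u / 8.\<close>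
  define Vb where "Vb = 5 + 128 * (real q / real ku)"
  have Vb0: "0 \<le> Vb" by (simp add: Vb_def)
  have w_le: "1 + inner_on p (w T) (w T) \<le> Vb" "0 \<le> inner_on p (w T) (w T)" if "T \<in> I" for T
    using w_norm[OF that] w_nonneg[OF that that] ku0 inner_w[OF that, of T]
    by (auto simp: Vb_def K_def power2_eq_square)
  define \<rho> where "\<rho> = sqrt (\<eta> * lp / real n)"
  have \<rho>2: "\<rho>\<^sup>2 = \<eta> * lp / real n" using \<eta> lp0 n0 by (simp add: \<rho>_def)
  have \<rho>0: "\<rho> \<noteq> 0" using \<eta> lp0 n0 by (simp add: \<rho>_def)
  have ku_lp: "real ku * lp / real n \<le> C2" using ku(1) n0 by (simp add: divide_le_eq)
  have q_lp: "real q * lp / real n \<le> 1" using q(2) n0 by (simp add: divide_le_eq)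
  \<comment> \<open>The bound q log p \<le> n is what compensates a squared norm of w of order q /
    k_u.\<close>
  have NVb: "real N * \<rho>\<^sup>2 * Vb \<le> \<eta> * (C2 + 16)"
  proof -
    have "real N * \<rho>\<^sup>2 * Vb \<le> real ku / 8 * \<rho>\<^sup>2 * Vb" using N_ku Vb0 by (intro mult_right_mono) auto
    also have "\<dots> = \<eta> * (5 / 8 * (real ku * lp / real n) + 16 * (real q * lp / real n))"
      using ku0 n0 by (simp add: \<rho>2 Vb_def field_simps)
    also have "\<dots> \<le> \<eta> * (C2 + 16)"
    proof (rule mult_left_mono)
      show "5 / 8 * (real ku * lp / real n) + 16 * (real q * lp / real n) \<le> C2 + 16"
        by (rule order_trans[OF add_mono[OF mult_left_mono[OF ku_lp] mult_left_mono[OF q_lp]]]) (use C2 in auto)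
    qed (use \<eta> in simp)
    finally show ?thesis .
  qed
  define G where "G = ({..<N} \<rightarrow>\<^sub>E {..<B})"
  define J where "J = G \<times> I"
  have gB: "g a < B" if "g \<in> G" "a < N" for g a using that by (auto simp: G_def)
  have pB: "q + 2 * (N * B) \<le> p" using B(2) by (simp add: N_def)
  have pB': "q + 2 * (N * B) < p" using B(2) by (simp add: N_def)
  define S where "S = pair_cols q N B"
  define s where "s = pair_dir q N B \<xi>"
  have S_range: "q \<le> j \<and> j < q + 2 * (N * B)" if "g \<in> G" "j \<in> S g" for g j
    using pair_cols_range[of N g B j q] gB[OF that(1)] that(2) by (auto simp: S_def)
  have s_out: "s g j = 0" if "j \<notin> S g" for g j using that by (simp add: s_def S_def pair_dir_def)
  have ww: "w T j = 0" if "T \<in> I" "g \<in> G" "j \<in> S g" for T g j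
    using w_supp[OF that(1), of j] S_range[OF that(2,3)] by force
  have ok: "hid_ok p (S g) (s g) (w T)" if "g \<in> G" "T \<in> I" for g T
    unfolding hid_ok_def
  proof (intro conjI allI ballI impI)
    show "0 \<notin> S g" using S_range[OF that(1), of 0] q(1) by auto
    show "S g \<subseteq> {..<p}" using S_range[OF that(1)] pB by force
    show "w T j = 0" if "j \<in> S g" for j by (rule ww[OF \<open>T \<in> I\<close> \<open>g \<in> G\<close> that])
    show "\<bar>s g j\<bar> \<le> 1" for j by (simp add: s_def pair_dir_le_one)
  qed (use p0 s_out in auto)
  have cardS: "card (S g) \<le> 2 * N" for g by (simp add: S_def card_pair_cols)
  have NN: "(\<Sum>j<p. (s g j)\<^sup>2) = real N" if "g \<in> G" for g
    unfolding s_def by (rule pair_dir_norm[OF gB[OF that] pB])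
  have s_\<xi>: "(\<Sum>j<p. \<xi> j * s g j) = 0" if "g \<in> G" for g
    unfolding s_def by (rule pair_dir_orth[OF gB[OF that] pB])
  have V_le: "\<rho>\<^sup>2 * (1 + inner_on p (w T) (w T)) * (\<rho>\<^sup>2 * (1 + inner_on p (w T') (w T'))) \<le> (\<rho>\<^sup>2 * Vb)\<^sup>2"
    if "T \<in> I" "T' \<in> I" for T T'
    unfolding power2_eq_square[of "\<rho>\<^sup>2 * Vb"]
    using w_le[OF that(1)] w_le[OF that(2)] Vb0 by (intro mult_mono mult_left_mono) auto
  \<comment> \<open>At most 2 N columns carry the factor, and (2 / 16)^2 = 1 / 64.\<close>
  have small: "hid_small p \<rho> (2 * N) (w T) (w T')" if "T \<in> I" "T' \<in> I" for T T'
    unfolding hid_small_def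
  proof (intro conjI \<rho>0)
    have "(real (2 * N))\<^sup>2 * (\<rho>\<^sup>2 * (1 + inner_on p (w T) (w T)) * (\<rho>\<^sup>2 * (1 + inner_on p (w T') (w T'))))
        \<le> (real (2 * N))\<^sup>2 * (\<rho>\<^sup>2 * Vb)\<^sup>2" by (intro mult_left_mono V_le that) auto
    also have "\<dots> = (2 * (real N * \<rho>\<^sup>2 * Vb))\<^sup>2" by (simp add: power_mult_distrib)
    also have "\<dots> \<le> (2 * (1 / 16))\<^sup>2"
      using NVb \<eta>(3) Vb0 by (intro power_mono mult_left_mono) auto
    finally show "(real (2 * N))\<^sup>2 * (\<rho>\<^sup>2 * (1 + inner_on p (w T) (w T)) * (\<rho>\<^sup>2 * (1 + inner_on p (w T') (w T')))) \<le> 1 / 64"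
      by (simp add: power2_eq_square)
  qed
  define wt where "wt = (\<lambda>(g :: nat \<Rightarrow> nat, T). (1 / real B ^ N) * \<omega> T)"
  have finG: "finite G" "card G = B ^ N" by (auto simp: G_def card_PiE intro!: finite_PiE)
  have wJ: "weights J wt"
  proof -
    have "(\<Sum>k\<in>J. wt k) = (\<Sum>g\<in>G. \<Sum>T\<in>I. (1 / real B ^ N) * \<omega> T)"
      unfolding J_def wt_def by (rule sum.cartesian_product[symmetric])
    also have "\<dots> = (\<Sum>g\<in>G. 1 / real B ^ N)" by (simp only: sum_distrib_left[symmetric] I\<omega>(3) mult_1_right)
    also have "\<dots> = 1" using finG B(1) by simp
    finally show ?thesis using I\<omega> finG by (auto simp: weights_def J_def wt_def)
  qed
  \<comment> \<open>The amount by which regressing out the factor lowers \<xi>^T \<beta>. The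
    coefficient \<open>a\<close>, common to both priors, places the null prior exactly at t0 and the
    point prior at t0 + sh.\<close>
  define sh where "sh = M2 * \<rho> / (1 + real N * \<rho>\<^sup>2) * (real N * \<rho>) * \<nu>"
  define a where "a = (t0 + sh) / \<xi> 0"
  define \<theta>1 where "\<theta>1 = (\<lambda>(g, T). hid_param p a M2 \<rho> (real N) (s g) (w T))"
  define \<theta>2 where "\<theta>2 = hid_param p a M2 \<rho> 0 (\<lambda>_. 0) (\<lambda>_. 0)"
  have a\<xi>: "a * \<xi> 0 = t0 + sh" using \<xi>0 by (simp add: a_def)
  have \<theta>1_null: "\<theta>1 k \<in> Theta_null M1 M2 p ku \<xi> t0" if kJ: "k \<in> J" for k
  proof -
    obtain g T where k: "k = (g, T)" "g \<in> G" "T \<in> I" using kJ by (auto simp: J_def)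
    have "hid_param p a M2 \<rho> (real N) (s g) (w T) \<in> Theta M1 M2 p ku"
    \<comment> \<open>The last column lies outside both supports, because the blocks of pairs end
      before it.\<close>
    proof (rule hid_param_Theta[where ?l0.0 = "p - 1", OF M(1,2) order.refl NN[OF k(2)]])
      have "real N * \<rho>\<^sup>2 * (1 + inner_on p (w T) (w T)) \<le> real N * \<rho>\<^sup>2 * Vb"
        using w_le[OF k(3)] by (intro mult_left_mono) auto
      then show "real N * \<rho>\<^sup>2 * (1 + inner_on p (w T) (w T)) \<le> ((1 - 1 / M1) / 3)\<^sup>2"
        using NVb \<eta>(4) by linarith
      show "p - 1 < p" using p0 by simp
      show "s g (p - 1) = 0" using S_range[OF k(2), of "p - 1"] pB' s_out by force
      show "w T (p - 1) = 0" using w_supp[OF k(3), of "p - 1"] pq by force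
      have subS: "{j. s g j \<noteq> 0} \<subseteq> S g" using s_out by auto
      have finS: "finite (S g)" by (simp add: S_def card_pair_cols)
      show finS': "finite {j. s g j \<noteq> 0}" by (rule finite_subset[OF subS finS])
      show finw: "finite {j. w T j \<noteq> 0}" by (rule finite_subset[of _ "{..<q}"]) (use w_supp[OF k(3)] in auto)
      have "card ({0} \<union> {j. s g j \<noteq> 0} \<union> {j. w T j \<noteq> 0}) \<le> card ({0} \<union> {j. s g j \<noteq> 0}) + card {j. w T j \<noteq> 0}"
        by (rule card_Un_le)
      also have "card ({0} \<union> {j. s g j \<noteq> 0}) \<le> card {0::nat} + card {j. s g j \<noteq> 0}" by (rule card_Un_le)
      also have "card {j. s g j \<noteq> 0} \<le> 2 * N" using card_mono[OF finS subS] cardS[of g] by simp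
      finally have "real (card ({0} \<union> {j. s g j \<noteq> 0} \<union> {j. w T j \<noteq> 0})) \<le> real (1 + 2 * N + card {j. w T j \<noteq> 0})"
        by simp
      also have "\<dots> \<le> 1 + 2 * (real ku / 8) + 4 * K" using w_card[OF k(3)] N_ku by simp
      also have "\<dots> \<le> real ku" using ku(2) by (simp add: K_def)
      finally show "card ({0} \<union> {j. s g j \<noteq> 0} \<union> {j. w T j \<noteq> 0}) \<le> ku" by simp
    qed
    moreover have "inner_on p \<xi> (fst (hid_param p a M2 \<rho> (real N) (s g) (w T))) = t0"
    proof -
      have "inner_on p \<xi> (w T) = \<nu>" unfolding inner_on_def to_q[OF k(3)] by (rule w_\<xi>[OF k(3)])
      then show ?thesis using hid_param_inner[OF p0 s_\<xi>[OF k(2)]] by (simp add: a\<xi> sh_def)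
    qed
    ultimately show ?thesis by (auto simp: \<theta>1_def k(1) Theta_null_def)
  qed
  have N\<rho>: "real N * \<rho>\<^sup>2 \<le> 1"
  proof -
    have "real N * \<rho>\<^sup>2 * 1 \<le> real N * \<rho>\<^sup>2 * Vb" by (intro mult_left_mono) (auto simp: Vb_def)
    then show ?thesis using NVb \<eta>(3) by linarith
  qed
  have \<theta>2_alt: "\<theta>2 \<in> Theta_alt M1 M2 p k \<xi> t0 (c * \<nu> * (real ku * lp / real n))"
  proof -
    have "\<theta>2 \<in> Theta M1 M2 p k"
      unfolding \<theta>2_def by (rule hid_param_Theta[where ?l0.0 = 0, OF M(1,2) order.refl]) (use p0 k in auto)
    moreover have "inner_on p \<xi> (fst \<theta>2) = t0 + sh"
      unfolding \<theta>2_def by (subst hid_param_inner[OF p0]) (auto simp: a\<xi>)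
    \<comment> \<open>The 32 in the bound on c collects N \<ge> k_u / 16 and 1 + N \<rho>^2 \<le>
      2.\<close>
    moreover have "c * \<nu> * (real ku * lp / real n) \<le> sh"
    proof -
      have "c * \<nu> * (real ku * lp / real n) \<le> M2 * \<eta> / 32 * \<nu> * (real ku * lp / real n)"
        using c \<nu>0 lp0 by (intro mult_right_mono) auto
      also have "\<dots> = M2 * \<rho>\<^sup>2 * \<nu> / 2 * (real ku / 16)" by (simp add: \<rho>2)
      also have "\<dots> \<le> M2 * \<rho>\<^sup>2 * \<nu> / 2 * real N" using M \<nu>0 N_ku by (intro mult_left_mono) auto
      also have "\<dots> = M2 * \<rho>\<^sup>2 * real N * \<nu> / 2" by simp
      also have "\<dots> \<le> M2 * \<rho>\<^sup>2 * real N * \<nu> / (1 + real N * \<rho>\<^sup>2)"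
        using N\<rho> M \<nu>0 by (intro divide_left_mono mult_nonneg_nonneg mult_pos_pos) (auto intro: add_pos_nonneg)
      also have "\<dots> = sh" by (simp add: sh_def power2_eq_square)
      finally show ?thesis .
    qed
    ultimately show ?thesis by (auto simp: Theta_alt_def split: prod.splits)
  qed
  have pos1: "\<forall>k\<in>J. snd (snd (\<theta>1 k)) > 0" by (auto simp: \<theta>1_def intro!: hid_param_noise_pos M)
  have sp1: "\<forall>k\<in>J. \<theta>1 k \<in> space (param_algebra p)" by (auto simp: \<theta>1_def intro!: hid_param_space)
  have pos2: "\<forall>k\<in>{()}. snd (snd ((\<lambda>_. \<theta>2) k)) > 0" by (auto simp: \<theta>2_def intro!: hid_param_noise_pos M)
  have sp2: "\<forall>k\<in>{()}. (\<lambda>_. \<theta>2) k \<in> space (param_algebra p)" by (auto simp: \<theta>2_def intro!: hid_param_space)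
  let ?K = "\<lambda>k k'. \<integral>y. Gfun n p \<rho> D (S (fst k)) (s (fst k)) (w (snd k)) y * Gfun n p \<rho> D (S (fst k')) (s (fst k')) (w (snd k')) y \<partial>noise_space n p"
  \<comment> \<open>The second-order term must be made linear in m. The surplus factor m is absorbed
    by m \<le> 2 N against the constant part of Vb, and by m \<le> D against the part of order q /
    k_u.\<close>
  have m_bound: "real n * (128 * (m\<^sup>2 * (\<rho>\<^sup>2 * Vb)\<^sup>2)) \<le> \<eta> * lp * m * (128 * (13 * C2 + 32768))"
    if m: "0 \<le> m" "m \<le> 2 * real N" "m \<le> real D" for m
  proof -
    have "Vb\<^sup>2 \<le> 50 + 32768 * (real q / real ku)\<^sup>2"
    proof -
      \<comment> \<open>An exact form of (x + y)^2 \<le> 2 x^2 + 2 y^2, with 50 = 2 * 5^2 and 32768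
        = 2 * 128^2.\<close>
      have "Vb\<^sup>2 + (5 - 128 * (real q / real ku))\<^sup>2 = 50 + 32768 * (real q / real ku)\<^sup>2"
        by (simp add: Vb_def power2_eq_square algebra_simps)
      then show ?thesis using zero_le_power2[of "5 - 128 * (real q / real ku)"] by linarith
    qed
    then have "m * lp / real n * Vb\<^sup>2 \<le> m * lp / real n * (50 + 32768 * (real q / real ku)\<^sup>2)"
      using m lp0 by (intro mult_left_mono) auto
    also have "\<dots> = 50 * (m * lp / real n) + 32768 * ((real q * lp * m / (real ku)\<^sup>2) * (real q / real n))"
      using n0 ku0 by (simp add: power2_eq_square field_simps)
    also have "\<dots> \<le> 50 * (C2 / 4) + 32768 * (1 * 1)"
    proof (intro add_mono mult_left_mono mult_mono)
      have "m \<le> real ku / 4" using m N_ku by linarith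
      then have "m * (lp / real n) \<le> real ku / 4 * (lp / real n)" using lp0 by (intro mult_right_mono) auto
      also have "real ku / 4 * (lp / real n) = (real ku * lp / real n) / 4" by simp
      also have "\<dots> \<le> C2 / 4" by (rule divide_right_mono[OF ku_lp]) simp
      finally show "m * lp / real n \<le> C2 / 4" by simp
      have "real q * lp * m / (real ku)\<^sup>2 \<le> real q * lp * real D / (real ku)\<^sup>2"
        using m lp0 by (intro divide_right_mono mult_left_mono) auto
      then show "real q * lp * m / (real ku)\<^sup>2 \<le> 1" using qD by linarith
      have "real q * 1 \<le> real q * lp" using lp by (intro mult_left_mono) auto
      then show "real q / real n \<le> 1" using q(2) n0 by (simp add: divide_le_eq)
    qed (use m lp0 in auto)
    also have "\<dots> \<le> 13 * C2 + 32768" using C2 by simp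
    finally have le: "m * lp / real n * Vb\<^sup>2 \<le> 13 * C2 + 32768" .
    have "real n * (128 * (m\<^sup>2 * (\<rho>\<^sup>2 * Vb)\<^sup>2)) = \<eta> * lp * m * \<eta> * (128 * (m * lp / real n * Vb\<^sup>2))"
      unfolding \<rho>2 using n0 by (simp add: power2_eq_square field_simps)
    also have "\<dots> \<le> \<eta> * lp * m * 1 * (128 * (13 * C2 + 32768))"
      using le \<eta> lp0 m C2 by (intro mult_mono mult_left_mono mult_nonneg_nonneg) auto
    finally show ?thesis by simp
  qed
  define C6 where "C6 = 128 * (13 * C2 + 32768)"
  have C60: "0 \<le> C6" using C2 by (simp add: C6_def)
  have z_def': "z = 32 * exp (2 * \<eta> * lp * (9 + C6))" by (simp add: z_def C6_def)
  have z2: "2 \<le> z"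
  proof -
    have "0 \<le> 2 * \<eta> * lp * (9 + C6)" using \<eta> lp0 C60 by simp
    then have "1 \<le> exp (2 * \<eta> * lp * (9 + C6))" by simp
    then show ?thesis unfolding z_def' by linarith
  qed
  \<comment> \<open>The loadings are averaged out with the column choices fixed. What remains is
    controlled by the number of shared pairs, to which \<open>agree_tail\<close> applies.\<close>
  have pair_sum: "(\<Sum>T\<in>I. \<Sum>T'\<in>I. \<omega> T * \<omega> T' * (?K (g, T) (g', T') - 1))
      \<le> (if agree N g g' = 0 then 0 else z ^ agree N g g')" if g: "g \<in> G" "g' \<in> G" for g g'
  proof -
    have wS: "\<forall>j\<in>S g. w T' j = 0" "\<forall>j\<in>S g'. w T' j = 0" if "T' \<in> I" for T' using ww[OF that] g by auto
    have ci: "card (S g \<inter> S g') \<le> 2 * agree N g g'"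
      unfolding S_def by (rule card_pair_cols_Int(1)) (use gB g in auto)
    have ci0: "S g \<inter> S g' = {}" if "agree N g g' = 0"
      unfolding S_def by (rule card_pair_cols_Int(2)[OF _ _ that]) (use gB g in auto)
    show ?thesis
    proof (cases "agree N g g' = 0")
      case True
      have "?K (g, T) (g', T') = 1" if "T \<in> I" "T' \<in> I" for T T'
        using Gfun_disjoint[OF ok[OF g(1) that(1)] ok[OF g(2) that(2)] wS(1)[OF that(2)] wS(2)[OF that(1)] small[OF that] cardS ci0[OF True], of n D]
        by simp
      then show ?thesis using True by simp
    next
      case False
      define t where "t = card (S g \<inter> S g')"
      define m where "m = real (min t D)"
      have t_le: "t \<le> 2 * agree N g g'" using ci by (simp add: t_def)
      have "t \<le> card (S g)" unfolding t_def by (rule card_mono) (auto simp: S_def card_pair_cols)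
      then have t2N: "t \<le> 2 * N" using cardS[of g] by simp
      have m: "0 \<le> m" "m \<le> 2 * real N" "m \<le> real D" "m \<le> 2 * real (agree N g g')"
        using t_le t2N by (auto simp: m_def)
      let ?l = "\<eta> * lp * m"
      have l0: "0 \<le> ?l" using \<eta> lp0 m by simp
      have lq: "4 * ?l * (real q / K\<^sup>2) \<le> 1"
      proof -
        have "4 * ?l * (real q / K\<^sup>2) = 256 * \<eta> * (real q * lp * m / (real ku)\<^sup>2)"
          by (simp add: K_def power_divide)
        also have "\<dots> \<le> 1 * 1"
        proof (intro mult_mono)
          have "real q * lp * m / (real ku)\<^sup>2 \<le> real q * lp * real D / (real ku)\<^sup>2"
            using m lp0 by (intro divide_right_mono mult_left_mono) auto
          then show "real q * lp * m / (real ku)\<^sup>2 \<le> 1" using qD by linarith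
        qed (use \<eta> lp0 m in auto)
        finally show ?thesis by simp
      qed
      have K_le: "?K (g, T) (g', T') \<le> 2 ^ t * (2 * (exp (?l * (1 + C6)) * exp (?l * (\<Sum>j<q. w T j * w T' j))))"
        if T: "T \<in> I" "T' \<in> I" for T T'
      proof -
        have "?K (g, T) (g', T') \<le> 2 ^ t * (2 * exp (real n * (m * (\<rho>\<^sup>2 * \<bar>1 + inner_on p (w T) (w T')\<bar>)
          + 128 * (m\<^sup>2 * (\<rho>\<^sup>2 * (1 + inner_on p (w T) (w T)) * (\<rho>\<^sup>2 * (1 + inner_on p (w T') (w T'))))))))"
          using Gfun_bound[OF ok[OF g(1) T(1)] ok[OF g(2) T(2)] wS(1)[OF T(2)] wS(2)[OF T(1)] small[OF T] cardS, of n D]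
          by (simp add: t_def m_def)
        also have "\<dots> \<le> 2 ^ t * (2 * exp (?l * (1 + (\<Sum>j<q. w T j * w T' j)) + ?l * C6))"
        proof -
          have ab: "\<bar>1 + inner_on p (w T) (w T')\<bar> = 1 + (\<Sum>j<q. w T j * w T' j)"
            using inner_w[OF T(2), of T] w_nonneg[OF T] by simp
          have "real n * (m * (\<rho>\<^sup>2 * \<bar>1 + inner_on p (w T) (w T')\<bar>)) = ?l * (1 + (\<Sum>j<q. w T j * w T' j))"
            unfolding ab \<rho>2 using n0 by simp
          moreover have "real n * (128 * (m\<^sup>2 * (\<rho>\<^sup>2 * (1 + inner_on p (w T) (w T)) * (\<rho>\<^sup>2 * (1 + inner_on p (w T') (w T'))))))
              \<le> ?l * C6"
          proof -
            have "real n * (128 * (m\<^sup>2 * (\<rho>\<^sup>2 * (1 + inner_on p (w T) (w T)) * (\<rho>\<^sup>2 * (1 + inner_on p (w T') (w T'))))))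
                \<le> real n * (128 * (m\<^sup>2 * (\<rho>\<^sup>2 * Vb)\<^sup>2))"
              by (intro mult_left_mono V_le T) auto
            also have "\<dots> \<le> ?l * C6" unfolding C6_def by (rule m_bound[OF m(1-3)])
            finally show ?thesis .
          qed
          ultimately show ?thesis by (simp add: distrib_left)
        qed
        also have "?l * (1 + (\<Sum>j<q. w T j * w T' j)) + ?l * C6 = ?l * (1 + C6) + ?l * (\<Sum>j<q. w T j * w T' j)"
          by (simp only: distrib_left mult_1_right)
        finally show ?thesis by (simp only: exp_add)
      qed
      have "(\<Sum>T\<in>I. \<Sum>T'\<in>I. \<omega> T * \<omega> T' * (?K (g, T) (g', T') - 1))
          \<le> (\<Sum>T\<in>I. \<Sum>T'\<in>I. 2 ^ t * 2 * exp (?l * (1 + C6)) * (\<omega> T * \<omega> T' * exp (?l * (\<Sum>j<q. w T j * w T' j))))"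
      proof (intro sum_mono)
        fix T T' assume T: "T \<in> I" "T' \<in> I"
        have "\<omega> T * \<omega> T' * (?K (g, T) (g', T') - 1)
            \<le> \<omega> T * \<omega> T' * (2 ^ t * (2 * (exp (?l * (1 + C6)) * exp (?l * (\<Sum>j<q. w T j * w T' j)))))"
          using K_le[OF T] I\<omega>(2)[OF T(1)] I\<omega>(2)[OF T(2)] by (intro mult_left_mono) auto
        then show "\<omega> T * \<omega> T' * (?K (g, T) (g', T') - 1)
            \<le> 2 ^ t * 2 * exp (?l * (1 + C6)) * (\<omega> T * \<omega> T' * exp (?l * (\<Sum>j<q. w T j * w T' j)))"
          by (simp only: mult_ac)
      qed
      also have "\<dots> = 2 ^ t * 2 * exp (?l * (1 + C6)) * (\<Sum>T\<in>I. \<Sum>T'\<in>I. \<omega> T * \<omega> T' * exp (?l * (\<Sum>j<q. w T j * w T' j)))"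
        by (simp only: sum_distrib_left)
      also have "\<dots> \<le> 2 ^ t * 2 * exp (?l * (1 + C6)) * (4 * exp (8 * ?l))"
        by (intro mult_left_mono w_exp[OF l0 lq]) auto
      \<comment> \<open>The 9 is 1 + 8: the component of the factor along the noise contributes 1,
        the overlap of the two loadings 8.\<close>
      also have "\<dots> = 8 * 2 ^ t * exp (?l * (9 + C6))"
      proof -
        have "?l * (9 + C6) = ?l * (1 + C6) + 8 * ?l" by (simp add: algebra_simps)
        then have "exp (?l * (9 + C6)) = exp (?l * (1 + C6)) * exp (8 * ?l)" by (simp only: exp_add)
        then show ?thesis by simp
      qed
      \<comment> \<open>With r \<ge> 1 shared pairs every factor is turned into an r-th power: 8
        \<le> 8^r, 2^t \<le> 4^r from t \<le> 2 r, and the exponential from m \<le> 2 r. Hence 32 =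
        8 * 4 in z.\<close>
      also have "\<dots> \<le> 8 ^ agree N g g' * 4 ^ agree N g g' * exp (2 * \<eta> * lp * (9 + C6)) ^ agree N g g'"
      proof (intro mult_mono)
        show "(8::real) \<le> 8 ^ agree N g g'" using False power_increasing[of 1 "agree N g g'" "8::real"] by simp
        have "(2::real) ^ t \<le> 2 ^ (2 * agree N g g')" using t_le by (intro power_increasing) auto
        then show "(2::real) ^ t \<le> 4 ^ agree N g g'" by (simp add: power_mult)
        have "?l * (9 + C6) \<le> \<eta> * lp * (2 * real (agree N g g')) * (9 + C6)"
          using m \<eta> lp0 C60 by (intro mult_right_mono mult_left_mono) auto
        also have "\<dots> = real (agree N g g') * (2 * \<eta> * lp * (9 + C6))" by simp
        finally show "exp (?l * (9 + C6)) \<le> exp (2 * \<eta> * lp * (9 + C6)) ^ agree N g g'"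
          by (simp only: exp_of_nat_mult[symmetric] exp_le_cancel_iff)
      qed auto
      also have "\<dots> = z ^ agree N g g'"
        unfolding z_def' power_mult_distrib[symmetric] by simp
      finally show ?thesis using False by simp
    qed
  qed
  have chi: "(\<Sum>k\<in>J. \<Sum>k'\<in>J. wt k * wt k' * ?K k k') - 1 \<le> 2 * (exp (z * real N / real B) - 1)"
  proof -
    \<comment> \<open>As the weights sum to 1, the 1 can be subtracted inside the double sum, where
      it annihilates all pairs without a common column.\<close>
    have one: "(\<Sum>k\<in>J. \<Sum>k'\<in>J. wt k * wt k') = 1"
      using wJ by (simp add: weights_def sum_distrib_left[symmetric])
    have "(\<Sum>k\<in>J. \<Sum>k'\<in>J. wt k * wt k' * (?K k k' - 1))
        = (\<Sum>k\<in>J. \<Sum>k'\<in>J. wt k * wt k' * ?K k k') - (\<Sum>k\<in>J. \<Sum>k'\<in>J. wt k * wt k')"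
      by (simp add: right_diff_distrib sum_subtractf)
    then have "(\<Sum>k\<in>J. \<Sum>k'\<in>J. wt k * wt k' * ?K k k') - 1 = (\<Sum>k\<in>J. \<Sum>k'\<in>J. wt k * wt k' * (?K k k' - 1))"
      using one by simp
    also have "\<dots> = (\<Sum>g\<in>G. \<Sum>T\<in>I. \<Sum>g'\<in>G. \<Sum>T'\<in>I. wt (g, T) * wt (g', T') * (?K (g, T) (g', T') - 1))"
      unfolding J_def by (simp only: sum.cartesian_product') 
    also have "\<dots> = (\<Sum>g\<in>G. \<Sum>g'\<in>G. \<Sum>T\<in>I. \<Sum>T'\<in>I. wt (g, T) * wt (g', T') * (?K (g, T) (g', T') - 1))"
      by (intro sum.cong refl sum.swap)
    also have "\<dots> = (\<Sum>g\<in>G. \<Sum>g'\<in>G. (1 / real B ^ N) * (1 / real B ^ N) * (\<Sum>T\<in>I. \<Sum>T'\<in>I. \<omega> T * \<omega> T' * (?K (g, T) (g', T') - 1)))"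
      unfolding sum_distrib_left by (intro sum.cong refl) (simp add: wt_def)
    also have "\<dots> \<le> (\<Sum>g\<in>G. \<Sum>g'\<in>G. (1 / real B ^ N) * (1 / real B ^ N) * (if agree N g g' = 0 then 0 else z ^ agree N g g'))"
      by (intro sum_mono mult_left_mono pair_sum) auto
    also have "\<dots> \<le> 2 * (exp (z * real N / real B) - 1)"
      unfolding G_def by (rule agree_tail[OF B(1) z2])
    finally show ?thesis .
  qed
  let ?\<pi>1 = "finite_prior p J wt \<theta>1" and ?\<pi>2 = "finite_prior p {()} (\<lambda>_. 1) (\<lambda>_. \<theta>2)"
  have "good_priors n p D (Theta_null M1 M2 p ku \<xi> t0)
     (Theta_alt M1 M2 p k \<xi> t0 (c * \<nu> * (real ku * lp / real n))) ?\<pi>1 ?\<pi>2 (2 * (exp (z * real N / real B) - 1))"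
    unfolding good_priors_def
  proof (intro conjI ballI)
    show "prior_on p (Theta_null M1 M2 p ku \<xi> t0) ?\<pi>1"
      by (rule prior_on_finite_prior[OF wJ sp1]) (use \<theta>1_null in auto)
    show "prior_on p (Theta_alt M1 M2 p k \<xi> t0 (c * \<nu> * (real ku * lp / real n))) ?\<pi>2"
      by (rule prior_on_finite_prior[OF weights_single sp2]) (use \<theta>2_alt in auto)
    fix f assume f: "f \<in> polynomials n p D"
    note mp1 = mixture_polynomial[OF wJ sp1 pos1 f] and mp2 = mixture_polynomial[OF weights_single sp2 pos2 f]
    show "integrable Q f" if "Q \<in> {mixture n p ?\<pi>1, mixture n p ?\<pi>2}" for Q
      using that mp1(1) mp2(1) by auto
    show "integrable Q (\<lambda>z. (f z)\<^sup>2)" if "Q \<in> {mixture n p ?\<pi>1, mixture n p ?\<pi>2}" for Q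
      using that mp1(2)[of 0] mp2(2)[of 0] by auto
    let ?P2 = "data_law n p \<theta>2"
    have E2: "(\<integral>z. f z \<partial>mixture n p ?\<pi>2) = (\<integral>z. f z \<partial>?P2)" using mp2(3) by simp
    have V2: "(\<integral>z. (f z - c)\<^sup>2 \<partial>mixture n p ?\<pi>2) = (\<integral>z. (f z - c)\<^sup>2 \<partial>?P2)" for c using mp2(4)[of c] by simp
    have E1: "(\<integral>z. f z \<partial>mixture n p ?\<pi>1)
        = (\<Sum>k\<in>J. wt k * (\<integral>z. f z \<partial>data_law n p (hid_param p a M2 \<rho> (real N) (s (fst k)) (w (snd k)))))"
      unfolding mp1(3) by (simp add: \<theta>1_def split_beta)
    have "((\<integral>z. f z \<partial>mixture n p ?\<pi>1) - (\<integral>z. f z \<partial>?P2))\<^sup>2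
        \<le> (\<integral>z. (f z - (\<integral>z. f z \<partial>?P2))\<^sup>2 \<partial>?P2) * ((\<Sum>k\<in>J. \<Sum>k'\<in>J. wt k * wt k' * ?K k k') - 1)"
      unfolding E1 \<theta>2_def
      by (rule low_degree_bound[OF wJ, where S = "\<lambda>k. S (fst k)" and s = "\<lambda>k. s (fst k)" and w = "\<lambda>k. w (snd k)" and L = "2 * N"])
        (use ok small cardS NN M(2) f in \<open>auto simp: J_def\<close>)
    also have "\<dots> \<le> (\<integral>z. (f z - (\<integral>z. f z \<partial>?P2))\<^sup>2 \<partial>?P2) * (2 * (exp (z * real N / real B) - 1))"
      by (intro mult_left_mono chi) simp
    finally show "((\<integral>z. f z \<partial>mixture n p ?\<pi>1) - (\<integral>z. f z \<partial>mixture n p ?\<pi>2))\<^sup>2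
        \<le> 2 * (exp (z * real N / real B) - 1) * (\<integral>z. (f z - (\<integral>z. f z \<partial>mixture n p ?\<pi>2))\<^sup>2 \<partial>mixture n p ?\<pi>2)"
      by (simp only: E2 V2 mult.commute)
  qed
  then show ?thesis unfolding \<nu>_def N_def by blast
qed

subsection \<open>Asymptotics\<close>

lemma good_priors_mono:
  assumes "good_priors n p D T1 T2 \<pi>1 \<pi>2 e" "e \<le> e'"
  shows "good_priors n p D T1 T2 \<pi>1 \<pi>2 e'"
proof -
  have "e * (\<integral>z. (f z - c)\<^sup>2 \<partial>Q) \<le> e' * (\<integral>z. (f z - c)\<^sup>2 \<partial>Q)" for f :: "data \<Rightarrow> real" and c Q
    using assms(2) by (intro mult_right_mono) auto
  then show ?thesis using assms(1) unfolding good_priors_def by (meson order_trans)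
qed

text \<open>Weak separation bounds the variance by C^2 d^2 for the gap d, and the hypothesis bounds
  d^2 by E times a variance. With d \<noteq> 0 this forces 1 \<le> \<bar>E\<bar> C^2, which fails
  eventually.\<close>

lemma not_weakly_separates:
  fixes E :: "nat \<Rightarrow> real"
  assumes bound: "\<forall>\<^sub>F m in sequentially. ((\<integral>z. f m z \<partial>Q1 m) - (\<integral>z. f m z \<partial>Q2 m))\<^sup>2
      \<le> E m * (\<integral>z. (f m z - (\<integral>z. f m z \<partial>Q2 m))\<^sup>2 \<partial>Q2 m)"
    and E: "E \<longlonglongrightarrow> 0"
  shows "\<not> weakly_separates f Q1 Q2"
proof
  assume ws: "weakly_separates f Q1 Q2"
  define d where "d m = \<bar>(\<integral>z. f m z \<partial>Q1 m) - (\<integral>z. f m z \<partial>Q2 m)\<bar>" for m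
  define V where "V m = max (\<integral>z. (f m z - (\<integral>z. f m z \<partial>Q1 m))\<^sup>2 \<partial>Q1 m) (\<integral>z. (f m z - (\<integral>z. f m z \<partial>Q2 m))\<^sup>2 \<partial>Q2 m)" for m
  have V0: "0 \<le> V m" for m
  proof -
    have "0 \<le> (\<integral>z. (f m z - (\<integral>z. f m z \<partial>Q2 m))\<^sup>2 \<partial>Q2 m)" by simp
    then show ?thesis by (simp add: V_def le_max_iff_disj)
  qed
  have ne: "\<forall>\<^sub>F m in sequentially. d m \<noteq> 0" and O: "(\<lambda>m. sqrt (V m)) \<in> O(d)"
    using ws unfolding weakly_separates_def d_def[abs_def] V_def[abs_def] by simp_all
  obtain C where C: "C > 0" "\<forall>\<^sub>F m in sequentially. norm (sqrt (V m)) \<le> C * norm (d m)"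
    using landau_o.bigE[OF O] by blast
  have "((\<lambda>m. \<bar>E m\<bar> * C\<^sup>2) \<longlongrightarrow> \<bar>0\<bar> * C\<^sup>2) sequentially" by (intro tendsto_intros E)
  then have small: "\<forall>\<^sub>F m in sequentially. \<bar>E m\<bar> * C\<^sup>2 < 1" by (rule order_tendstoD) simp
  from bound ne C(2) small have "\<forall>\<^sub>F m in sequentially. False"
  proof eventually_elim
    case (elim m)
    have d2: "(d m)\<^sup>2 > 0" using elim(2) by simp
    have sV: "sqrt (V m) \<le> C * d m" using elim(3) V0 by (simp add: d_def)
    have "V m = (sqrt (V m))\<^sup>2" using V0 by simp
    also have "\<dots> \<le> (C * d m)\<^sup>2" using sV V0 by (intro power_mono) auto
    finally have V_le: "V m \<le> C\<^sup>2 * (d m)\<^sup>2" by (simp add: power_mult_distrib)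
    have "(d m)\<^sup>2 \<le> E m * (\<integral>z. (f m z - (\<integral>z. f m z \<partial>Q2 m))\<^sup>2 \<partial>Q2 m)" using elim(1) by (simp add: d_def)
    also have "\<dots> \<le> \<bar>E m\<bar> * (\<integral>z. (f m z - (\<integral>z. f m z \<partial>Q2 m))\<^sup>2 \<partial>Q2 m)" by (intro mult_right_mono) auto
    also have "\<dots> \<le> \<bar>E m\<bar> * V m" by (intro mult_left_mono) (auto simp: V_def)
    also have "\<dots> \<le> \<bar>E m\<bar> * (C\<^sup>2 * (d m)\<^sup>2)" by (intro mult_left_mono V_le) auto
    also have "\<dots> = (\<bar>E m\<bar> * C\<^sup>2) * (d m)\<^sup>2" by simp
    also have "\<dots> < 1 * (d m)\<^sup>2" using elim(4) d2 by (intro mult_strict_right_mono) auto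
    finally show False by simp
  qed
  then show False by simp
qed

lemma H_nat: "0 \<le> i \<Longrightarrow> nat i \<le> p \<Longrightarrow> H p \<xi> (real_of_int i) = sqrt (\<Sum>j<nat i. (\<xi> j)\<^sup>2)"
  by (simp add: H_def min_absorb1)

lemma H_nonpos: "i \<le> 0 \<Longrightarrow> H p \<xi> (real_of_int i) = 0"
  by (simp add: H_def)

text \<open>Since the first loading is nonzero, \<beta> with a single nonzero entry there attains
  any prescribed value of \<xi>^T \<beta>; the covariance is the identity.\<close>

lemma single_param:
  assumes "M1 > 1" "M2 > 0" "0 < p" "\<xi> 0 \<noteq> 0" "1 \<le> k"
  defines "\<theta> x \<equiv> hid_param p (x / \<xi> 0) M2 0 0 (\<lambda>_. 0) (\<lambda>_. 0)"
  shows "\<theta> x \<in> Theta M1 M2 p k" "inner_on p \<xi> (fst (\<theta> x)) = x" "\<theta> x \<in> space (param_algebra p)" "snd (snd (\<theta> x)) > 0"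
proof -
  show "\<theta> x \<in> Theta M1 M2 p k"
    unfolding \<theta>_def by (rule hid_param_Theta[where ?l0.0 = 0, OF assms(1,2) order.refl]) (use assms in auto)
  show "inner_on p \<xi> (fst (\<theta> x)) = x" unfolding \<theta>_def by (subst hid_param_inner) (use assms in auto)
  show "\<theta> x \<in> space (param_algebra p)" unfolding \<theta>_def by (rule hid_param_space)
  show "snd (snd (\<theta> x)) > 0" unfolding \<theta>_def by (rule hid_param_noise_pos[OF assms(2)]) simp
qed

text \<open>With B of order p / N, the expected number N / B of shared pairs is of order k_u^2 / p,
  hence at most of order p^(2 \<gamma> - 1). The last condition on \<eta> makes z spend only half of
  that exponent.\<close>

lemma fixed_size_bound:
  fixes n p ku k D :: nat and \<xi> :: "nat \<Rightarrow> real" and t0 M1 M2 \<gamma> C1 C2 \<eta> c :: real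
  assumes M: "M1 > 1" "M2 > 0" and C: "C1 > 0" "C2 > 0"
    and \<eta>: "\<eta> > 0" "\<eta> \<le> 1 / 256" "\<eta> * (C2 + 16) \<le> 1 / 16" "\<eta> * (C2 + 16) \<le> ((1 - 1 / M1) / 3)\<^sup>2"
      "2 * \<eta> * (9 + 128 * (13 * C2 + 32768)) \<le> (1 - 2 * \<gamma>) / 2"
    and n: "0 < n" and lp: "1024 \<le> ln (real p)"
    and ku: "8 \<le> ku" "real ku \<le> C1 * real p powr \<gamma>" "real ku \<le> C2 * (real n / ln (real p))"
      "(real ku)\<^sup>2 \<le> real p / 4"
    and D: "1 \<le> D" and k: "1 \<le> k" and \<xi>0: "\<xi> 0 \<noteq> 0" and p0: "0 < p" and c: "0 < c" "c \<le> M2 * \<eta> / 32"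
  shows "\<exists>\<pi>1 \<pi>2. good_priors n p D (Theta_null M1 M2 p ku \<xi> t0)
     (Theta_alt M1 M2 p k \<xi> t0 (c * H p \<xi> (real_of_int (k_eff n p ku D)) * (real ku * ln (real p) / real n))) \<pi>1 \<pi>2
     (2 * (exp (4 * C1\<^sup>2 * real p powr (- ((1 - 2 * \<gamma>) / 2))) - 1))" (is "\<exists>\<pi>1 \<pi>2. good_priors _ _ _ ?T1 ?T2 _ _ ?E")
proof (cases "k_eff n p ku D \<le> 0")
  case True
  \<comment> \<open>With k_eff \<le> 0 the loading norm \<open>H\<close> is 0, so the threshold is 0
    and the two parameter spaces intersect.\<close>
  have "?E \<ge> 0" by simp
  note H0 = H_nonpos[OF True, of p \<xi>]
  let ?\<theta> = "hid_param p (t0 / \<xi> 0) M2 0 0 (\<lambda>_. 0) (\<lambda>_. 0)"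
  have ku1: "1 \<le> ku" using ku(1) by simp
  note s1 = single_param[OF M p0, where \<xi> = \<xi> and x = t0, OF \<xi>0 ku1]
    and s2 = single_param[OF M p0, where \<xi> = \<xi> and x = t0, OF \<xi>0 k]
  have "?\<theta> \<in> ?T1" using s1(1,2) by (auto simp: Theta_null_def split: prod.splits)
  moreover have "?\<theta> \<in> ?T2" using s2(1,2) unfolding H0 by (auto simp: Theta_alt_def split: prod.splits)
  ultimately obtain \<pi>1 \<pi>2 where "good_priors n p D ?T1 ?T2 \<pi>1 \<pi>2 0"
    using good_priors_common[of ?\<theta> ?T1 ?T2 p n D] s1(3,4) by auto
  then show ?thesis using good_priors_mono \<open>?E \<ge> 0\<close> by blast
next
  case False
  define lq where "lq = ln (real p)"
  have lq: "1024 \<le> lq" "0 < lq" using lp by (auto simp: lq_def)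
  define q where "q = nat (k_eff n p ku D)"
  have q1: "1 \<le> q" using False by (simp add: q_def)
  have q_real: "real q = real_of_int (k_eff n p ku D)" using False by (simp add: q_def)
  have kf: "real_of_int (k_eff n p ku D) \<le> min (real n / ln (real p)) ((real ku)\<^sup>2 / (real D * ln (real p)))"
    unfolding k_eff_def by (rule of_int_floor_le)
  have D0: "1 \<le> real D" using D by simp
  have q2: "real q * lq \<le> real n" using kf lq unfolding q_real[symmetric] lq_def[symmetric] by (simp add: le_divide_eq)
  have q3: "real q * (real D * lq) \<le> (real ku)\<^sup>2"
    using kf lq D0 unfolding q_real[symmetric] lq_def[symmetric] by (simp add: le_divide_eq)
  have ku_n: "real ku * lq \<le> C2 * real n" using ku(3) lq unfolding lq_def[symmetric] by (simp add: le_divide_eq)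
  have q_le: "real q \<le> (real ku)\<^sup>2"
  proof -
    have "1 * 1 \<le> real D * lq" using D0 lq by (intro mult_mono) auto
    then have "real q * 1 \<le> real q * (real D * lq)" by (intro mult_left_mono) auto
    then show ?thesis using q3 by linarith
  qed
  have qp: "q \<le> p"
  proof -
    have "real q \<le> real p" using q_le ku(4) by linarith
    then show ?thesis by simp
  qed
  have Hq: "H p \<xi> (real_of_int (k_eff n p ku D)) = sqrt (\<Sum>j<q. (\<xi> j)\<^sup>2)"
    unfolding q_def by (rule H_nat) (use False qp q_def in auto)
  define N where "N = ku div 8"
  have N1: "1 \<le> N" using ku(1) by (simp add: N_def)
  have N_ku: "real N \<le> real ku / 8"
  proof -
    have "8 * N \<le> ku" unfolding N_def by presburger
    then have "real (8 * N) \<le> real ku" by (simp only: of_nat_le_iff)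
    then show ?thesis by simp
  qed
  \<comment> \<open>One column is held back as the coordinate outside both supports.\<close>
  define B where "B = (p - q - 1) div (2 * N)"
  have room: "real q + 1 + 2 * real N \<le> 3 * real p / 4"
  proof -
    have "8 * real ku \<le> real ku * real ku" using ku(1) by (intro mult_right_mono) auto
    then have "1 + real ku / 4 \<le> (real ku)\<^sup>2" using ku(1) unfolding power2_eq_square by linarith
    then show ?thesis using q_le ku(4) N_ku by linarith
  qed
  have pq: "q + 1 \<le> p"
  proof -
    have "real (q + 1) \<le> real p" using room by simp
    then show ?thesis by (simp only: of_nat_le_iff)
  qed
  have B_le: "2 * N * B \<le> p - q - 1" unfolding B_def by (rule times_div_less_eq_dividend)
  have B_ge: "real p / (8 * real N) \<le> real B"
  proof -
    have "p - q - 1 < 2 * N * (B + 1)"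
      unfolding B_def using N1 by (simp add: dividend_less_times_div)
    then have "real (p - q - 1) \<le> real (2 * N * (B + 1))" by (simp only: of_nat_le_iff)
    then have "real p - real q - 1 \<le> 2 * real N * (real B + 1)" using pq by (simp add: of_nat_diff algebra_simps)
    then have "real p / 4 \<le> 2 * real N * real B" using room by (simp add: algebra_simps)
    then show ?thesis using N1 by (simp add: divide_le_eq algebra_simps)
  qed
  have B0: "0 < B"
  proof -
    have "0 < real p / (8 * real N)" using p0 N1 by simp
    then show ?thesis using B_ge by simp
  qed
  have fit: "q + 2 * (ku div 8 * B) < p" using B_le pq unfolding N_def[symmetric] by (simp add: mult.assoc)
  define C7 where "C7 = 9 + 128 * (13 * C2 + 32768)"
  define z where "z = 32 * exp (2 * \<eta> * lq * C7)"
  have "\<exists>\<pi>1 \<pi>2. good_priors n p D ?T1 ?T2 \<pi>1 \<pi>2 (2 * (exp (z * real (ku div 8) / real B) - 1))"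
    unfolding Hq z_def C7_def lq_def[symmetric]
    by (rule construction[where \<xi> = \<xi>]; fact)
  moreover have "2 * (exp (z * real (ku div 8) / real B) - 1) \<le> ?E"
  proof -
    have rp: "0 < real p" using p0 by simp
    have z_le: "z \<le> 32 * real p powr ((1 - 2 * \<gamma>) / 2)"
    proof -
      have "2 * \<eta> * lq * C7 = (2 * \<eta> * C7) * lq" by simp
      also have "\<dots> \<le> ((1 - 2 * \<gamma>) / 2) * lq" using \<eta>(5) lq unfolding C7_def by (intro mult_right_mono) auto
      finally show ?thesis using rp by (simp add: z_def powr_def lq_def)
    qed
    have z0: "0 \<le> z" by (simp add: z_def)
    have "z * real N / real B \<le> z * real N / (real p / (8 * real N))"
      using B_ge z0 rp N1 B0 by (intro divide_left_mono mult_nonneg_nonneg mult_pos_pos) auto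
    also have "\<dots> = z * (8 * (real N)\<^sup>2) / real p" using N1 rp by (simp add: power2_eq_square)
    also have "\<dots> \<le> (32 * real p powr ((1 - 2 * \<gamma>) / 2)) * (8 * (C1 * real p powr \<gamma> / 8)\<^sup>2) / real p"
    proof -
      have "real N \<le> C1 * real p powr \<gamma> / 8" using N_ku ku(2) by linarith
      then have "(real N)\<^sup>2 \<le> (C1 * real p powr \<gamma> / 8)\<^sup>2" by (intro power_mono) auto
      then show ?thesis using z_le z0 rp by (intro divide_right_mono mult_mono) auto
    qed
    \<comment> \<open>The constant is 32 * 8 / 8^2 = 4.\<close>
    also have "\<dots> = 4 * C1\<^sup>2 * (real p powr ((1 - 2 * \<gamma>) / 2) * (real p powr \<gamma>)\<^sup>2 / real p)"
      by (simp add: power_divide power_mult_distrib)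
    also have "real p powr ((1 - 2 * \<gamma>) / 2) * (real p powr \<gamma>)\<^sup>2 / real p = real p powr (- ((1 - 2 * \<gamma>) / 2))"
    proof -
      have "real p powr ((1 - 2 * \<gamma>) / 2) * (real p powr \<gamma>)\<^sup>2 / real p
          = real p powr ((1 - 2 * \<gamma>) / 2 + (\<gamma> + \<gamma>) - 1)"
        using rp by (simp only: powr_add powr_diff power2_eq_square powr_one)
      also have "(1 - 2 * \<gamma>) / 2 + (\<gamma> + \<gamma>) - 1 = - ((1 - 2 * \<gamma>) / 2)" by (simp add: field_simps)
      finally show ?thesis .
    qed
    finally show ?thesis unfolding N_def[symmetric] by simp
  qed
  ultimately show ?thesis using good_priors_mono by blast
qed


theorem theorem2:
  fixes M1 M2 \<gamma> C1 C2 C3 :: real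
  assumes "M1 > 1" and "M2 > 0" and "0 \<le> \<gamma>" and "\<gamma> < 1 / 2"
    and "C1 > 0" and "C2 > 0" and "C3 > 0"
  shows "\<exists>c0>0. \<forall>c. 0 < c \<and> c \<le> c0 \<longrightarrow>
    (\<forall>(n :: nat \<Rightarrow> nat) (p :: nat \<Rightarrow> nat) (ku :: nat \<Rightarrow> nat) (k :: nat \<Rightarrow> nat) (D :: nat \<Rightarrow> nat)
       (\<xi> :: nat \<Rightarrow> nat \<Rightarrow> real) (t0 :: nat \<Rightarrow> real).
       filterlim n at_top sequentially \<longrightarrow>
       filterlim p at_top sequentially \<longrightarrow>
       filterlim ku at_top sequentially \<longrightarrow>
       (\<forall>m. \<exists>j<p m. \<xi> m j \<noteq> 0) \<longrightarrow>
       (\<forall>m i j. i \<le> j \<longrightarrow> j < p m \<longrightarrow> \<bar>\<xi> m j\<bar> \<le> \<bar>\<xi> m i\<bar>) \<longrightarrow>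
       (\<forall>\<^sub>F m in sequentially. real (ku m) \<le> C1 * real (p m) powr \<gamma>) \<longrightarrow>
       ((\<lambda>m. (sqrt (real (n m)) / ln (real (p m))) / real (ku m)) \<longlonglongrightarrow> 0) \<longrightarrow>
       (\<forall>\<^sub>F m in sequentially. real (ku m) \<le> C2 * (real (n m) / ln (real (p m)))) \<longrightarrow>
       (\<forall>\<^sub>F m in sequentially. real (D m) \<le> C3 * real (p m)) \<longrightarrow>
       (\<forall>m. 1 \<le> D m) \<longrightarrow>
       (\<forall>m. 1 \<le> k m \<and> k m \<le> ku m) \<longrightarrow>
       no_polynomial_weakly_separates n p D
         (\<lambda>m. Theta_null M1 M2 (p m) (ku m) (\<xi> m) (t0 m))
         (\<lambda>m. Theta_alt M1 M2 (p m) (k m) (\<xi> m) (t0 m)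
            (c * H (p m) (\<xi> m) (real_of_int (k_eff (n m) (p m) (ku m) (D m))) *
             (real (ku m) * ln (real (p m)) / real (n m)))))"
proof -
  define C7 where "C7 = 9 + 128 * (13 * C2 + 32768)"
  \<comment> \<open>In this order the entries serve the range of the overlap bound, the square
    integrability of the likelihood ratios, the eigenvalues, and the power of p that a shared pair
    may cost.\<close>
  define \<eta> where "\<eta> = Min {1 / 256, 1 / (16 * (C2 + 16)), ((1 - 1 / M1) / 3)\<^sup>2 / (C2 + 16), (1 - 2 * \<gamma>) / (4 * C7)}"
  have C7: "C7 > 0" using assms by (simp add: C7_def)
  have C16: "C2 + 16 > 0" using assms by simp
  have \<eta>_le: "\<eta> \<le> 1 / 256" "\<eta> \<le> 1 / (16 * (C2 + 16))" "\<eta> \<le> ((1 - 1 / M1) / 3)\<^sup>2 / (C2 + 16)" "\<eta> \<le> (1 - 2 * \<gamma>) / (4 * C7)"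
    unfolding \<eta>_def by (rule Min_le; simp)+
  have \<eta>0: "\<eta> > 0"
    unfolding \<eta>_def using assms C7 C16 by (subst Min_gr_iff) auto
  have \<eta>3: "\<eta> * (C2 + 16) \<le> 1 / 16"
    using \<eta>_le(2) C16 by (simp add: field_simps)
  have \<eta>4: "\<eta> * (C2 + 16) \<le> ((1 - 1 / M1) / 3)\<^sup>2" using \<eta>_le(3) C16 by (simp add: le_divide_eq)
  have \<eta>5: "2 * \<eta> * (9 + 128 * (13 * C2 + 32768)) \<le> (1 - 2 * \<gamma>) / 2"
    using \<eta>_le(4) C7 unfolding C7_def[symmetric] by (simp add: le_divide_eq)
  define \<delta> where "\<delta> = (1 - 2 * \<gamma>) / 2"
  have \<delta>: "\<delta> > 0" using assms by (simp add: \<delta>_def)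
  show ?thesis
  proof (intro exI[of _ "M2 * \<eta> / 32"] conjI allI impI)
    show "0 < M2 * \<eta> / 32" using assms \<eta>0 by simp
    fix c n p ku k D \<xi> t0
    assume c: "0 < c \<and> c \<le> M2 * \<eta> / 32"
      and n: "filterlim (n :: nat \<Rightarrow> nat) at_top sequentially"
      and p: "filterlim (p :: nat \<Rightarrow> nat) at_top sequentially"
      and ku: "filterlim (ku :: nat \<Rightarrow> nat) at_top sequentially"
      and nz: "\<forall>m. \<exists>j<p m. (\<xi> :: nat \<Rightarrow> nat \<Rightarrow> real) m j \<noteq> 0"
      and sorted: "\<forall>m i j. i \<le> j \<longrightarrow> j < p m \<longrightarrow> \<bar>\<xi> m j\<bar> \<le> \<bar>\<xi> m i\<bar>"
      and ku1: "\<forall>\<^sub>F m in sequentially. real (ku m) \<le> C1 * real (p m) powr \<gamma>"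
      and ku2: "\<forall>\<^sub>F m in sequentially. real (ku m) \<le> C2 * (real (n m) / ln (real (p m)))"
      and D: "\<forall>m. 1 \<le> (D :: nat \<Rightarrow> nat) m" and k: "\<forall>m. 1 \<le> k m \<and> k m \<le> ku m"
    have p0: "0 < p m" for m using nz by (metis gr_implies_not0 gr0I)
    have \<xi>0: "\<xi> m 0 \<noteq> 0" for m
    proof -
      obtain j where "j < p m" "\<xi> m j \<noteq> 0" using nz by blast
      then show ?thesis using sorted[rule_format, of 0 j m] by auto
    qed
    let ?T1 = "\<lambda>m. Theta_null M1 M2 (p m) (ku m) (\<xi> m) (t0 m)"
    let ?T2 = "\<lambda>m. Theta_alt M1 M2 (p m) (k m) (\<xi> m) (t0 m)
            (c * H (p m) (\<xi> m) (real_of_int (k_eff (n m) (p m) (ku m) (D m))) * (real (ku m) * ln (real (p m)) / real (n m)))"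
    define E where "E m = 2 * (exp (4 * C1\<^sup>2 * real (p m) powr (- ((1 - 2 * \<gamma>) / 2))) - 1)" for m
    have rp: "filterlim (\<lambda>m. real (p m)) at_top sequentially"
      by (rule filterlim_compose[OF filterlim_real_sequentially p])
    have E_lim: "E \<longlonglongrightarrow> 0"
    proof -
      have "(\<lambda>m. real (p m) powr (- \<delta>)) \<longlonglongrightarrow> 0" using \<delta> by (intro tendsto_neg_powr rp) simp
      then have "(\<lambda>m. 2 * (exp (4 * C1\<^sup>2 * real (p m) powr (- \<delta>)) - 1)) \<longlonglongrightarrow> 2 * (exp (4 * C1\<^sup>2 * 0) - 1)"
        by (intro tendsto_intros)
      then show ?thesis by (simp add: E_def[abs_def] \<delta>_def)
    qed
    define good where "good m \<longleftrightarrow> 0 < n m \<and> 1024 \<le> ln (real (p m)) \<and> 8 \<le> ku m \<and> real (ku m) \<le> C1 * real (p m) powr \<gamma>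
      \<and> real (ku m) \<le> C2 * (real (n m) / ln (real (p m))) \<and> (real (ku m))\<^sup>2 \<le> real (p m) / 4" for m
    have good_ev: "\<forall>\<^sub>F m in sequentially. good m"
    proof -
      have "\<forall>\<^sub>F m in sequentially. 1 \<le> n m" using n by (simp add: filterlim_at_top)
      moreover have "\<forall>\<^sub>F m in sequentially. 1024 \<le> ln (real (p m))"
        using filterlim_compose[OF ln_at_top rp] by (simp add: filterlim_at_top)
      moreover have "\<forall>\<^sub>F m in sequentially. 8 \<le> ku m" using ku by (simp add: filterlim_at_top)
      \<comment> \<open>Since \<gamma> < 1/2, k_u^2 is of smaller order than p. This leaves room for
        the pairs beyond the first q columns.\<close>
      moreover have "\<forall>\<^sub>F m in sequentially. C1\<^sup>2 * real (p m) powr (- (1 - 2 * \<gamma>)) < 1 / 4"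
      proof -
        have "(\<lambda>m. real (p m) powr (- (1 - 2 * \<gamma>))) \<longlonglongrightarrow> 0" using assms by (intro tendsto_neg_powr rp) simp
        then have "(\<lambda>m. C1\<^sup>2 * real (p m) powr (- (1 - 2 * \<gamma>))) \<longlonglongrightarrow> C1\<^sup>2 * 0" by (intro tendsto_intros)
        then show ?thesis by (rule order_tendstoD) simp
      qed
      ultimately show ?thesis using ku1 ku2
      proof eventually_elim
        case (elim m)
        have rpm: "0 < real (p m)" using p0 by simp
        have "(real (ku m))\<^sup>2 \<le> (C1 * real (p m) powr \<gamma>)\<^sup>2" using elim(5) by (intro power_mono) auto
        also have "\<dots> = (C1\<^sup>2 * real (p m) powr (- (1 - 2 * \<gamma>))) * real (p m)"
        proof -
          have "real (p m) powr (- (1 - 2 * \<gamma>)) * real (p m) = real (p m) powr (- (1 - 2 * \<gamma>)) * real (p m) powr 1"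
            using rpm by simp
          also have "\<dots> = real (p m) powr (\<gamma> + \<gamma>)" by (simp only: powr_add[symmetric]) simp
          also have "\<dots> = (real (p m) powr \<gamma>)\<^sup>2" by (simp only: powr_add power2_eq_square)
          finally show ?thesis by (simp add: power_mult_distrib)
        qed
        also have "\<dots> \<le> 1 / 4 * real (p m)" using elim(4) rpm by (intro mult_right_mono) auto
        finally show ?case using elim by (simp add: good_def)
      qed
    qed
    \<comment> \<open>Priors have to be supplied at every index, the quantitative bound only
      eventually; hence the implication in the last conjunct.\<close>
    have "\<exists>\<pi>1 \<pi>2. prior_on (p m) (?T1 m) \<pi>1 \<and> prior_on (p m) (?T2 m) \<pi>2
        \<and> (\<forall>f\<in>polynomials (n m) (p m) (D m). \<forall>Q\<in>{mixture (n m) (p m) \<pi>1, mixture (n m) (p m) \<pi>2}. integrable Q f \<and> integrable Q (\<lambda>z. (f z)\<^sup>2))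
        \<and> (good m \<longrightarrow> good_priors (n m) (p m) (D m) (?T1 m) (?T2 m) \<pi>1 \<pi>2 (E m))" for m
    proof (cases "good m")
      case True
      have k1: "1 \<le> k m" and D1: "1 \<le> D m" using k D by auto
      have g: "0 < n m" "1024 \<le> ln (real (p m))" "8 \<le> ku m" "real (ku m) \<le> C1 * real (p m) powr \<gamma>"
        "real (ku m) \<le> C2 * (real (n m) / ln (real (p m)))" "(real (ku m))\<^sup>2 \<le> real (p m) / 4"
        using True unfolding good_def by blast+
      have c': "0 < c" "c \<le> M2 * \<eta> / 32" using c by auto
      obtain \<pi>1 \<pi>2 where "good_priors (n m) (p m) (D m) (?T1 m) (?T2 m) \<pi>1 \<pi>2 (E m)"
        unfolding E_def
        using fixed_size_bound[where \<xi> = "\<xi> m" and ?t0.0 = "t0 m", OF assms(1,2,5,6) \<eta>0 \<eta>_le(1) \<eta>3 \<eta>4 \<eta>5 g D1 k1 \<xi>0 p0 c']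
        by blast
      then show ?thesis unfolding good_priors_def by blast
    next
      case False
      have k1: "1 \<le> k m" and ku1: "1 \<le> ku m" using k by (auto intro: order_trans)
      define \<tau> where "\<tau> = c * H (p m) (\<xi> m) (real_of_int (k_eff (n m) (p m) (ku m) (D m))) * (real (ku m) * ln (real (p m)) / real (n m))"
      note s1 = single_param[where \<xi> = "\<xi> m" and p = "p m", OF assms(1,2) p0 \<xi>0 ku1]
        and s2 = single_param[where \<xi> = "\<xi> m" and p = "p m", OF assms(1,2) p0 \<xi>0 k1]
      have T1: "hid_param (p m) (t0 m / \<xi> m 0) M2 0 0 (\<lambda>_. 0) (\<lambda>_. 0) \<in> ?T1 m"
        using s1(1,2)[of "t0 m"] by (auto simp: Theta_null_def split: prod.splits)
      \<comment> \<open>Moving by the absolute value meets the threshold without a discussion of its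
        sign.\<close>
      have T2: "hid_param (p m) ((t0 m + \<bar>\<tau>\<bar>) / \<xi> m 0) M2 0 0 (\<lambda>_. 0) (\<lambda>_. 0) \<in> ?T2 m"
        using s2(1,2)[of "t0 m + \<bar>\<tau>\<bar>"] unfolding \<tau>_def[symmetric] by (auto simp: Theta_alt_def split: prod.splits)
      show ?thesis
        using good_priors_distinct[OF T1 s1(3,4) T2 s2(3,4), of "n m" "D m"] False by blast
    qed
    then obtain \<pi>1 \<pi>2 where \<pi>: "\<And>m. prior_on (p m) (?T1 m) (\<pi>1 m) \<and> prior_on (p m) (?T2 m) (\<pi>2 m)
        \<and> (\<forall>f\<in>polynomials (n m) (p m) (D m). \<forall>Q\<in>{mixture (n m) (p m) (\<pi>1 m), mixture (n m) (p m) (\<pi>2 m)}. integrable Q f \<and> integrable Q (\<lambda>z. (f z)\<^sup>2))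
        \<and> (good m \<longrightarrow> good_priors (n m) (p m) (D m) (?T1 m) (?T2 m) (\<pi>1 m) (\<pi>2 m) (E m))"
      by metis
    show "no_polynomial_weakly_separates n p D ?T1 ?T2"
      unfolding no_polynomial_weakly_separates_def
    proof (rule exI[of _ \<pi>1], rule exI[of _ \<pi>2], intro conjI allI impI)
      fix m
      show "prior_on (p m) (?T1 m) (\<pi>1 m)" "prior_on (p m) (?T2 m) (\<pi>2 m)" using \<pi>[of m] by auto
      show "\<forall>f\<in>polynomials (n m) (p m) (D m). \<forall>Q\<in>{mixture (n m) (p m) (\<pi>1 m), mixture (n m) (p m) (\<pi>2 m)}.
        integrable Q f \<and> integrable Q (\<lambda>z. (f z)\<^sup>2)" using \<pi>[of m] by blast
    next
      fix f assume f: "\<forall>m. f m \<in> polynomials (n m) (p m) (D m)"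
      show "\<not> weakly_separates f (\<lambda>m. mixture (n m) (p m) (\<pi>1 m)) (\<lambda>m. mixture (n m) (p m) (\<pi>2 m))"
      proof (rule not_weakly_separates[OF _ E_lim])
        show "\<forall>\<^sub>F m in sequentially. ((\<integral>z. f m z \<partial>mixture (n m) (p m) (\<pi>1 m)) - (\<integral>z. f m z \<partial>mixture (n m) (p m) (\<pi>2 m)))\<^sup>2
          \<le> E m * (\<integral>z. (f m z - (\<integral>z. f m z \<partial>mixture (n m) (p m) (\<pi>2 m)))\<^sup>2 \<partial>mixture (n m) (p m) (\<pi>2 m))"
          using good_ev
        proof eventually_elim
          case (elim m)
          then have "good_priors (n m) (p m) (D m) (?T1 m) (?T2 m) (\<pi>1 m) (\<pi>2 m) (E m)" using \<pi>[of m] by blast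
          then show ?case using f unfolding good_priors_def by blast
        qed
      qed
    qed
  qed
qed

end
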